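(* Let $n,l$ be positive integers. For all but finitely many $\alpha\in\mathbb{C}$, the multiplicity $m^\lambda_{n,l}(\alpha)$ of $\mathcal{M}_n^\lambda$ in the cyclic module $\mathcal{U}(\mathfrak{gl}_n)\cdot\det^{(\alpha)}(X)^l$ equals the Kostka number $K_{\lambda(l^n)}$ for every partition $\lambda\vdash nl$; that is, for all but finitely many $\alpha$, the $\mathcal{U}(\mathfrak{gl}_n)$-module $\mathcal{U}(\mathfrak{gl}_n)\cdot\det^{(\alpha)}(X)^l$ is isomorphic to $(\mathrm{Sym}^l(\mathbb{C}^n))^{\otimes n}$.
   Context: $\mathcal{A}(\mathrm{Mat}_n)$ is the polynomial algebra over $\mathbb{C}$ in the variables $x_{ij}$ ($1\le i,j\le n$), $X=(x_{ij})$. The universal enveloping algebra $\mathcal{U}(\mathfrak{gl}_n)$ of $\mathfrak{gl}_n(\mathbb{C})$ acts on $\mathcal{A}(\mathrm{Mat}_n)$ by $E_{ij}\cdot f=\sum_{k=1}^n x_{ik}\,\partial f/\partial x_{jk}$. The $\alpha$-determinant is $\det^{(\alpha)}(X)=\sum_{\sigma\in\mathfrak{S}_n}\alpha^{\nu(\sigma)}x_{\sigma(1)1}\cdots x_{\sigma(n)n}$, where $\nu(\sigma)$ is $n$ minus the number of cycles of $\sigma$ ($0^0=1$). $\mathcal{U}(\mathfrak{gl}_n)\cdot f$ is the submodule generated by $f$. $\mathcal{M}_n^\lambda$ is the irreducible highest weight module of highest weight $\lambda$ (zero if $\lambda$ has more than $n$ parts, in which case the multiplicity is read as $0$). $K_{\lambda(l^n)}$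 is the number of semistandard tableaux of shape $\lambda$ and weight $(l,\dots,l)$ ($n$ entries). $\mathcal{U}(\mathfrak{gl}_n)$ acts on $(\mathrm{Sym}^l(\mathbb{C}^n))^{\otimes n}$ in the natural way. *)

theory Defs
  imports
    Complex_Main
    "HOL-Library.Poly_Mapping"
    "HOL-Library.FuncSet"
    "HOL-Combinatorics.Orbits"
begin

text \<open>
  All indices run over \<open>{..<n}\<close> instead of \<open>{1..n}\<close>.
  Every vector space below is a subspace of some \<open>'b \<Rightarrow>\<^sub>0 complex\<close>,
  the space with basis \<open>'b\<close>.
\<close>

section \<open>Complex vector spaces of finitely supported functions\<close>

definition cscale :: "complex \<Rightarrow> ('b \<Rightarrow>\<^sub>0 complex) \<Rightarrow> ('b \<Rightarrow>\<^sub>0 complex)" where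
  "cscale c = Poly_Mapping.map ((*) c)"

lemma lookup_cscale [simp]: "Poly_Mapping.lookup (cscale c p) b = c * Poly_Mapping.lookup p b"
  by (simp add: cscale_def Poly_Mapping.map.rep_eq when_def)

interpretation cvec: vector_space cscale
  by unfold_locales (auto intro!: poly_mapping_eqI simp: lookup_add algebra_simps)


section \<open>Modules over the universal enveloping algebra of \<open>gl_n\<close>\<close>

text \<open>
  The universal enveloping algebra of \<open>gl_n\<close> is the associative algebra generated by the
  \<open>E i j\<close> subject to \<open>[E i j, E k m] = \<delta> j k (E i m) - \<delta> m i (E k j)\<close>.  A module over it is
  therefore a vector space with operators \<open>E i j\<close> satisfying these relations, and its
  submodules and homomorphisms are the subspaces stable under, and the linear maps commuting
  with, these operators.
\<close>

definition gl_module ::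
    "nat \<Rightarrow> (nat \<Rightarrow> nat \<Rightarrow> ('b \<Rightarrow>\<^sub>0 complex) \<Rightarrow> ('b \<Rightarrow>\<^sub>0 complex)) \<Rightarrow> ('b \<Rightarrow>\<^sub>0 complex) set \<Rightarrow> bool" where
  "gl_module n E V \<longleftrightarrow>
     cvec.subspace V \<and>
     (\<forall>i<n. \<forall>j<n. \<forall>v\<in>V. E i j v \<in> V) \<and>
     (\<forall>i<n. \<forall>j<n. \<forall>v\<in>V. \<forall>w\<in>V. E i j (v + w) = E i j v + E i j w) \<and>
     (\<forall>i<n. \<forall>j<n. \<forall>c. \<forall>v\<in>V. E i j (cscale c v) = cscale c (E i j v)) \<and>
     (\<forall>i<n. \<forall>j<n. \<forall>k<n. \<forall>m<n. \<forall>v\<in>V.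
        E i j (E k m v) - E k m (E i j v) =
          (if j = k then E i m v else 0) - (if m = i then E k j v else 0))"

definition gl_submodule ::
    "nat \<Rightarrow> (nat \<Rightarrow> nat \<Rightarrow> ('b \<Rightarrow>\<^sub>0 complex) \<Rightarrow> ('b \<Rightarrow>\<^sub>0 complex)) \<Rightarrow> ('b \<Rightarrow>\<^sub>0 complex) set
      \<Rightarrow> ('b \<Rightarrow>\<^sub>0 complex) set \<Rightarrow> bool" where
  "gl_submodule n E V U \<longleftrightarrow> U \<subseteq> V \<and> gl_module n E U"

definition gl_cyclic ::
    "nat \<Rightarrow> (nat \<Rightarrow> nat \<Rightarrow> ('b \<Rightarrow>\<^sub>0 complex) \<Rightarrow> ('b \<Rightarrow>\<^sub>0 complex)) \<Rightarrow> ('b \<Rightarrow>\<^sub>0 complex) set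
      \<Rightarrow> ('b \<Rightarrow>\<^sub>0 complex) \<Rightarrow> ('b \<Rightarrow>\<^sub>0 complex) set" where
  "gl_cyclic n E V f = \<Inter> {U. gl_submodule n E V U \<and> f \<in> U}"

definition gl_isomorphic ::
    "nat \<Rightarrow> (nat \<Rightarrow> nat \<Rightarrow> ('b \<Rightarrow>\<^sub>0 complex) \<Rightarrow> ('b \<Rightarrow>\<^sub>0 complex)) \<Rightarrow> ('b \<Rightarrow>\<^sub>0 complex) set
      \<Rightarrow> (nat \<Rightarrow> nat \<Rightarrow> ('d \<Rightarrow>\<^sub>0 complex) \<Rightarrow> ('d \<Rightarrow>\<^sub>0 complex)) \<Rightarrow> ('d \<Rightarrow>\<^sub>0 complex) set \<Rightarrow> bool" where
  "gl_isomorphic n E V F W \<longleftrightarrow>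
     (\<exists>\<phi>. bij_betw \<phi> V W \<and>
        (\<forall>v\<in>V. \<forall>w\<in>V. \<phi> (v + w) = \<phi> v + \<phi> w) \<and>
        (\<forall>c. \<forall>v\<in>V. \<phi> (cscale c v) = cscale c (\<phi> v)) \<and>
        (\<forall>i<n. \<forall>j<n. \<forall>v\<in>V. \<phi> (E i j v) = F i j (\<phi> v)))"

definition gl_irreducible ::
    "nat \<Rightarrow> (nat \<Rightarrow> nat \<Rightarrow> ('b \<Rightarrow>\<^sub>0 complex) \<Rightarrow> ('b \<Rightarrow>\<^sub>0 complex)) \<Rightarrow> ('b \<Rightarrow>\<^sub>0 complex) set \<Rightarrow> bool" where
  "gl_irreducible n E V \<longleftrightarrow>
     gl_module n E V \<and> V \<noteq> {0} \<and> (\<forall>U. gl_submodule n E V U \<longrightarrow> U = {0} \<or> U = V)"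


section \<open>Partitions and Kostka numbers\<close>

definition is_partition_of :: "nat list \<Rightarrow> nat \<Rightarrow> bool" where
  "is_partition_of lam N \<longleftrightarrow> sorted_wrt (\<ge>) lam \<and> (\<forall>k\<in>set lam. 0 < k) \<and> sum_list lam = N"

definition part :: "nat list \<Rightarrow> nat \<Rightarrow> nat" where
  "part lam i = (if i < length lam then lam ! i else 0)"

definition cells :: "nat list \<Rightarrow> (nat \<times> nat) set" where
  "cells lam = {(r, c). r < length lam \<and> c < lam ! r}"

definition semistandard_tableaux :: "nat list \<Rightarrow> nat list \<Rightarrow> (nat \<times> nat \<Rightarrow> nat) set" where
  "semistandard_tableaux lam mu =
     {T \<in> cells lam \<rightarrow>\<^sub>E {..<length mu}.
        (\<forall>r c. (r, c) \<in> cells lam \<and> (r, Suc c) \<in> cells lam \<longrightarrow> T (r, c) \<le> T (r, Suc c)) \<and>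
        (\<forall>r c. (r, c) \<in> cells lam \<and> (Suc r, c) \<in> cells lam \<longrightarrow> T (r, c) < T (Suc r, c)) \<and>
        (\<forall>k<length mu. card {x \<in> cells lam. T x = k} = mu ! k)}"

definition kostka :: "nat list \<Rightarrow> nat list \<Rightarrow> nat" where
  "kostka lam mu = card (semistandard_tableaux lam mu)"


section \<open>Highest weight modules and multiplicities\<close>

definition highest_weight_vector ::
    "nat \<Rightarrow> (nat \<Rightarrow> nat \<Rightarrow> ('b \<Rightarrow>\<^sub>0 complex) \<Rightarrow> ('b \<Rightarrow>\<^sub>0 complex)) \<Rightarrow> nat list \<Rightarrow> ('b \<Rightarrow>\<^sub>0 complex) \<Rightarrow> bool" where
  "highest_weight_vector n E lam v \<longleftrightarrow>
     v \<noteq> 0 \<and>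
     (\<forall>i<n. \<forall>j<n. i < j \<longrightarrow> E i j v = 0) \<and>
     (\<forall>i<n. E i i v = cscale (of_nat (part lam i)) v)"

text \<open>
  The irreducible highest weight module of a given highest weight is determined only up to
  isomorphism; this is the predicate of being (a copy of) that module.
\<close>

definition irreducible_highest_weight_module ::
    "nat \<Rightarrow> (nat \<Rightarrow> nat \<Rightarrow> ('b \<Rightarrow>\<^sub>0 complex) \<Rightarrow> ('b \<Rightarrow>\<^sub>0 complex)) \<Rightarrow> nat list \<Rightarrow> ('b \<Rightarrow>\<^sub>0 complex) set \<Rightarrow> bool" where
  "irreducible_highest_weight_module n E lam V \<longleftrightarrow>
     gl_irreducible n E V \<and>
     (\<exists>v\<in>V. highest_weight_vector n E lam v \<and> gl_cyclic n E V v = V)"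

text \<open>
  Nonzero summands of a direct sum are pairwise distinct subspaces, so an internal direct sum
  of irreducible submodules can be given by the set of its summands.
\<close>

definition irreducible_decomposition ::
    "nat \<Rightarrow> (nat \<Rightarrow> nat \<Rightarrow> ('b \<Rightarrow>\<^sub>0 complex) \<Rightarrow> ('b \<Rightarrow>\<^sub>0 complex)) \<Rightarrow> ('b \<Rightarrow>\<^sub>0 complex) set
      \<Rightarrow> ('b \<Rightarrow>\<^sub>0 complex) set set \<Rightarrow> bool" where
  "irreducible_decomposition n E V D \<longleftrightarrow>
     finite D \<and>
     (\<forall>U\<in>D. gl_submodule n E V U \<and> gl_irreducible n E U) \<and>
     (\<forall>v\<in>V. \<exists>!g. g \<in> (\<Pi>\<^sub>E U\<in>D. U) \<and> v = (\<Sum>U\<in>D. g U))"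

text \<open>
  The description has a unique solution for finite direct sums of irreducible modules
  (Krull-Schmidt), and nothing can be proved about its value otherwise.
\<close>

definition gl_multiplicity ::
    "nat \<Rightarrow> (nat \<Rightarrow> nat \<Rightarrow> ('b \<Rightarrow>\<^sub>0 complex) \<Rightarrow> ('b \<Rightarrow>\<^sub>0 complex)) \<Rightarrow> ('b \<Rightarrow>\<^sub>0 complex) set
      \<Rightarrow> nat list \<Rightarrow> nat" where
  "gl_multiplicity n E V lam =
     (if length lam > n then 0
      else THE m. \<exists>D. irreducible_decomposition n E V D \<and>
                      m = card {U \<in> D. irreducible_highest_weight_module n E lam U})"


section \<open>Polynomials\<close>

text \<open>Polynomials in variables \<open>'x\<close>; a monomial is its finitely supported exponent function.\<close>

type_synonym 'x cpoly = "('x \<Rightarrow>\<^sub>0 nat) \<Rightarrow>\<^sub>0 complex"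

definition pvar :: "'x \<Rightarrow> 'x cpoly" where
  "pvar x = Poly_Mapping.single (Poly_Mapping.single x 1) 1"

definition pconst :: "complex \<Rightarrow> 'x cpoly" where
  "pconst c = Poly_Mapping.single 0 c"

definition pdiff :: "'x \<Rightarrow> 'x cpoly \<Rightarrow> 'x cpoly" where
  "pdiff x p = (\<Sum>m\<in>Poly_Mapping.keys p.
     Poly_Mapping.single (m - Poly_Mapping.single x 1)
       (of_nat (Poly_Mapping.lookup m x) * Poly_Mapping.lookup p m))"

definition mat_poly :: "nat \<Rightarrow> (nat \<times> nat) cpoly set" where
  "mat_poly n = {p. \<forall>m\<in>Poly_Mapping.keys p. Poly_Mapping.keys m \<subseteq> {..<n} \<times> {..<n}}"

definition mat_act :: "nat \<Rightarrow> nat \<Rightarrow> nat \<Rightarrow> (nat \<times> nat) cpoly \<Rightarrow> (nat \<times> nat) cpoly" where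
  "mat_act n i j f = (\<Sum>k<n. pvar (i, k) * pdiff (j, k) f)"


section \<open>The \<open>\<alpha>\<close>-determinant\<close>

text \<open>Each cycle is counted through its orbit, so fixed points are cycles of length 1.\<close>

definition cycle_count :: "nat \<Rightarrow> (nat \<Rightarrow> nat) \<Rightarrow> nat" where
  "cycle_count n \<sigma> = card (orbit \<sigma> ` {..<n})"

definition alpha_det :: "nat \<Rightarrow> complex \<Rightarrow> (nat \<times> nat) cpoly" where
  "alpha_det n \<alpha> =
     (\<Sum>\<sigma> | \<sigma> permutes {..<n}. pconst (\<alpha> ^ (n - cycle_count n \<sigma>)) * (\<Prod>i<n. pvar (\<sigma> i, i)))"


section \<open>Symmetric powers and tensor powers\<close>

text \<open>
  The \<open>l\<close>-th symmetric power of the natural module is the degree \<open>l\<close> part of the symmetric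
  algebra, i.e. of the polynomials in the standard basis vectors \<open>pvar 0, \<dots>, pvar (n - 1)\<close>;
  \<open>E i j\<close> acts as the derivation with \<open>pvar k \<mapsto> \<delta> j k (pvar i)\<close>.
\<close>

definition sym_power :: "nat \<Rightarrow> nat \<Rightarrow> nat cpoly set" where
  "sym_power n l = {p. \<forall>m\<in>Poly_Mapping.keys p.
     Poly_Mapping.keys m \<subseteq> {..<n} \<and> (\<Sum>x\<in>Poly_Mapping.keys m. Poly_Mapping.lookup m x) = l}"

definition sym_act :: "nat \<Rightarrow> nat \<Rightarrow> nat cpoly \<Rightarrow> nat cpoly" where
  "sym_act i j f = pvar i * pdiff j f"

text \<open>
  The tensor product of \<open>r\<close> spaces with basis \<open>'b\<close> has the lists \<open>[b\<^sub>1, \<dots>, b\<^sub>r]\<close>, standing for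
  \<open>b\<^sub>1 \<otimes> \<dots> \<otimes> b\<^sub>r\<close>, as its basis.  \<open>pure_tensor [v\<^sub>1, \<dots>, v\<^sub>r]\<close> is \<open>v\<^sub>1 \<otimes> \<dots> \<otimes> v\<^sub>r\<close>, and
  \<open>tensor_act\<close> extends an operator by the Leibniz rule.
\<close>

definition pure_tensor :: "('b \<Rightarrow>\<^sub>0 complex) list \<Rightarrow> ('b list \<Rightarrow>\<^sub>0 complex)" where
  "pure_tensor vs =
     (\<Sum>bs\<in>listset (map Poly_Mapping.keys vs).
        Poly_Mapping.single bs (\<Prod>p<length vs. Poly_Mapping.lookup (vs ! p) (bs ! p)))"

definition tensor_power :: "nat \<Rightarrow> ('b \<Rightarrow>\<^sub>0 complex) set \<Rightarrow> ('b list \<Rightarrow>\<^sub>0 complex) set" where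
  "tensor_power r V = cvec.span {pure_tensor vs |vs. length vs = r \<and> set vs \<subseteq> V}"

definition tensor_act ::
    "(('b \<Rightarrow>\<^sub>0 complex) \<Rightarrow> ('b \<Rightarrow>\<^sub>0 complex)) \<Rightarrow> ('b list \<Rightarrow>\<^sub>0 complex) \<Rightarrow> ('b list \<Rightarrow>\<^sub>0 complex)" where
  "tensor_act e t =
     (\<Sum>bs\<in>Poly_Mapping.keys t. cscale (Poly_Mapping.lookup t bs)
        (\<Sum>p<length bs. pure_tensor
           ((map (\<lambda>b. Poly_Mapping.single b 1) bs)[p := e (Poly_Mapping.single (bs ! p) 1)])))"

end

theory Submission
  imports Defs "Jordan_Normal_Form.Determinant"
begin

text \<open>
  The power \<open>det\<^sup>(\<^sup>\<alpha>\<^sup>)(X)\<^sup>l\<close> lies in the space of the polynomials of degree \<open>l\<close> in the variables of every column,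
  which is isomorphic to the tensor power.  At \<open>\<alpha> = 0\<close> it is the monomial \<open>(x 0 0 \<cdots> x (n-1) (n-1))\<^sup>l\<close>, which
  generates this space; hence so it does for all \<open>\<alpha>\<close> at which a certain determinant, a polynomial in \<open>\<alpha>\<close>
  with value \<open>1\<close> at \<open>0\<close>, does not vanish.

  By an invariant inner product the space is a direct sum of irreducible submodules, and a multiplicity is
  the dimension of a space of highest weight vectors.  This dimension is the number of leading monomials of
  such vectors in a suitable lexicographic order.  The exponent matrices of these leading monomials encode
  semistandard tableaux (by \<open>sl\<^sub>2\<close> theory), and every semistandard tableau occurs, through its bideterminant.
\<close>

text \<open>The cyclic module comes with no basis that varies with \<alpha>, so the passage from
  \<alpha> = 0 to generic \<alpha> goes through families that are polynomial in \<alpha> and lie in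
  the cyclic module for every \<alpha>: their values at 0 form a submodule containing the diagonal
  monomial.

  \<open>gl_multiplicity\<close> is a definite description over all decompositions, so a
  decomposition must exist and the count must be the same for each; highest weight vectors settle
  the second point.

  The dimension of the space of highest weight vectors is caught between two injections, so neither
  the classification of irreducible modules nor a character formula enters. One order of monomials
  has to serve both: the diagonal term of a minor on initial rows must be the leading one, and
  moving a unit from row \<open>r\<close> to row \<open>r + 1\<close> within a column must raise the
  weight. Ranking columns and rows by decreasing index does both. Its numerical form
  \<open>lexwt\<close> is additive, so leading monomials multiply; the base \<open>l + 2\<close>
  exceeds every exponent up to \<open>l\<close> and is at least 2, as minors require.\<close>

abbreviation lookup :: "('a \<Rightarrow>\<^sub>0 'b::zero) \<Rightarrow> 'a \<Rightarrow> 'b" where "lookup \<equiv> Poly_Mapping.lookup"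
abbreviation keys :: "('a \<Rightarrow>\<^sub>0 'b::zero) \<Rightarrow> 'a set" where "keys \<equiv> Poly_Mapping.keys"
abbreviation single :: "'a \<Rightarrow> 'b::zero \<Rightarrow> 'a \<Rightarrow>\<^sub>0 'b" where "single \<equiv> Poly_Mapping.single"
abbreviation expo :: "'x \<Rightarrow> 'x \<Rightarrow>\<^sub>0 nat" where "expo x \<equiv> Poly_Mapping.single x 1"

declare One_nat_def [simp del] \<comment> \<open>otherwise simp rewrites \<open>expo x\<close> to \<open>single x (Suc 0)\<close>\<close>

section \<open>Polynomials\<close>

lemma sum_single_lookup:
  assumes "finite A" "keys p \<subseteq> A"
  shows "p = (\<Sum>m\<in>A. single m (lookup p m))"
proof (rule poly_mapping_eqI)
  fix k
  have "(\<Sum>m\<in>A. lookup (single m (lookup p m)) k) = (\<Sum>m\<in>A. if m = k then lookup p k else 0)"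
    by (rule sum.cong) (auto simp: lookup_single when_def)
  also have "\<dots> = lookup p k"
    using assms by (auto simp: in_keys_iff)
  finally show "lookup p k = lookup (\<Sum>m\<in>A. single m (lookup p m)) k"
    by (simp add: lookup_sum)
qed

lemma single_eq_cscale: "single m c = cscale c (single m 1)"
  by (rule poly_mapping_eqI) (simp add: lookup_single when_def)

lemma poly_induct_single [case_names single add]:
  fixes P :: "('a \<Rightarrow>\<^sub>0 'b::comm_monoid_add) \<Rightarrow> bool"
  assumes "\<And>m c. P (single m c)" "\<And>p q. P p \<Longrightarrow> P q \<Longrightarrow> P (p + q)"
  shows "P p"
proof -
  have "P (\<Sum>m\<in>A. single m (lookup p m))" if "finite A" for A
    using that
  proof (induction A)
    case empty
    show ?case using assms(1)[of undefined 0] by simp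
  qed (simp add: assms)
  from this[of "keys p"] show ?thesis
    using sum_single_lookup[of "keys p" p] by simp
qed

lemma keys_add_subset: "keys (p + q) \<subseteq> keys p \<union> keys q"
  by (auto simp: in_keys_iff lookup_add)

lemma keys_cscale_subset: "keys (cscale c p) \<subseteq> keys p"
  by (auto simp: in_keys_iff)

lemma minus_add_expo:
  fixes m :: "'x \<Rightarrow>\<^sub>0 nat"
  assumes "0 < lookup m x"
  shows "m - expo x + expo x = m"
  using assms by (intro poly_mapping_eqI) (auto simp: lookup_add lookup_minus lookup_single when_def)

lemma minus_expo_eq_iff:
  fixes m :: "'x \<Rightarrow>\<^sub>0 nat"
  assumes "0 < lookup m x"
  shows "m - expo x = k \<longleftrightarrow> m = k + expo x"
  using minus_add_expo[OF assms] by auto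

lemma lookup_pvar_times:
  "lookup (pvar x * p) m = (if 0 < lookup m x then lookup p (m - expo x) else 0)"
proof (induction p rule: poly_induct_single)
  case (single k c)
  show ?case
  proof (cases "lookup m x = 0")
    case True
    then have "expo x + k \<noteq> m" by (auto simp: lookup_add)
    then show ?thesis
      using True by (simp add: pvar_def mult_single lookup_single)
  next
    case False
    then show ?thesis
      using minus_expo_eq_iff[of m x k]
      by (auto simp: pvar_def mult_single lookup_single when_def add.commute)
  qed
next
  case (add p q)
  then show ?case by (auto simp: distrib_left lookup_add)
qed

text \<open>Read coefficientwise, differentiation shifts exponents upwards, so no truncated
  subtraction remains and identities between operators can be checked at a single exponent.\<close>

lemma lookup_pdiff: "lookup (pdiff x p) m = of_nat (lookup m x + 1) * lookup p (m + expo x)"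
proof -
  have "lookup (pdiff x p) m =
      (\<Sum>k\<in>keys p. if k = m + expo x then of_nat (lookup m x + 1) * lookup p (m + expo x) else 0)"
    unfolding pdiff_def lookup_sum
  proof (rule sum.cong)
    fix k
    show "lookup (single (k - expo x) (of_nat (lookup k x) * lookup p k)) m =
      (if k = m + expo x then of_nat (lookup m x + 1) * lookup p (m + expo x) else 0)"
      using minus_expo_eq_iff[of k x m]
      by (cases "lookup k x = 0") (auto simp: lookup_single when_def lookup_add)
  qed simp
  also have "\<dots> = of_nat (lookup m x + 1) * lookup p (m + expo x)"
    by (auto simp: in_keys_iff)
  finally show ?thesis .
qed

lemma pdiff_single: "pdiff x (single m c) = single (m - expo x) (of_nat (lookup m x) * c)"
  by (cases "c = 0") (auto simp: pdiff_def)

lemma pdiff_add: "pdiff x (p + q) = pdiff x p + pdiff x q"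
  by (rule poly_mapping_eqI) (simp add: lookup_pdiff lookup_add distrib_left)

lemma pdiff_cscale: "pdiff x (cscale c p) = cscale c (pdiff x p)"
  by (rule poly_mapping_eqI) (simp add: lookup_pdiff)

lemma pvar_times_cscale: "pvar x * cscale c p = cscale c (pvar x * p)"
  by (rule poly_mapping_eqI) (simp add: lookup_pvar_times)

lemma pdiff_commute: "pdiff x (pdiff y p) = pdiff y (pdiff x p)"
proof (rule poly_mapping_eqI)
  fix m
  show "lookup (pdiff x (pdiff y p)) m = lookup (pdiff y (pdiff x p)) m"
    by (cases "x = y") (simp_all add: lookup_pdiff lookup_add lookup_single when_def
        add.commute add.left_commute)
qed

lemma pdiff_pvar_times: "pdiff x (pvar y * p) = (if x = y then p else 0) + pvar y * pdiff x p"
proof (rule poly_mapping_eqI)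
  fix m :: "'a \<Rightarrow>\<^sub>0 nat"
  consider "x = y" | "x \<noteq> y" "lookup m y = 0" | "x \<noteq> y" "lookup m y \<noteq> 0" by blast
  then show "lookup (pdiff x (pvar y * p)) m = lookup ((if x = y then p else 0) + pvar y * pdiff x p) m"
  proof cases
    case 1
    show ?thesis
    proof (cases "lookup m y = 0")
      case True
      then show ?thesis
        using 1 by (simp add: lookup_pdiff lookup_pvar_times lookup_add)
    next
      case False
      then have "m - expo y + expo y = m" by (simp add: minus_add_expo)
      then show ?thesis
        using 1 False by (simp add: lookup_pdiff lookup_pvar_times lookup_add lookup_minus
            of_nat_diff) (simp add: algebra_simps)
    qed
  next
    case 2
    then show ?thesis
      by (simp add: lookup_pdiff lookup_pvar_times lookup_add lookup_single)
  next
    case 3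
    have "m + expo x - expo y = m - expo y + expo x"
      using 3(2) by (intro poly_mapping_eqI) (auto simp: lookup_add lookup_minus lookup_single when_def)
    then show ?thesis
      using 3 by (simp add: lookup_pdiff lookup_pvar_times lookup_add lookup_minus lookup_single)
  qed
qed

lemma pdiff_mult: "pdiff x (p * q) = pdiff x p * q + p * pdiff x q"
proof (induction p rule: poly_induct_single)
  case (single a c)
  show ?case
  proof (induction q rule: poly_induct_single)
    case (single b d)
    \<comment> \<open>Where the truncated subtraction would spoil these equations, the exponent of
      \<open>x\<close> is 0 and with it the factor produced by \<open>pdiff_single\<close>.\<close>
    have *: "a + b - expo x = a - expo x + b" if "0 < lookup a x"
      using that by (intro poly_mapping_eqI) (auto simp: lookup_add lookup_minus lookup_single when_def)
    have **: "a + b - expo x = a + (b - expo x)" if "0 < lookup b x"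
      using that by (intro poly_mapping_eqI) (auto simp: lookup_add lookup_minus lookup_single when_def)
    show ?case
      using * ** by (cases "lookup a x = 0"; cases "lookup b x = 0")
        (simp_all add: pdiff_single mult_single lookup_add algebra_simps flip: single_add)
  next
    case (add p q)
    then show ?case by (simp add: algebra_simps pdiff_add)
  qed
next
  case (add p q)
  then show ?case by (simp add: algebra_simps pdiff_add)
qed

section \<open>The operators \<open>E i j\<close> as first-order differential operators\<close>

lemma mat_act_add: "mat_act n i j (p + q) = mat_act n i j p + mat_act n i j q"
  by (simp add: mat_act_def pdiff_add algebra_simps sum.distrib)

lemma cscale_sum: "cscale c (\<Sum>x\<in>A. f x) = (\<Sum>x\<in>A. cscale c (f x))"
  by (rule cvec.scale_sum_right)

lemma mat_act_cscale: "mat_act n i j (cscale c p) = cscale c (mat_act n i j p)"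
  by (simp add: mat_act_def pdiff_cscale pvar_times_cscale cscale_sum)

lemma mat_act_zero [simp]: "mat_act n i j 0 = 0"
  using mat_act_cscale[of n i j 0 0] by simp

lemma mat_act_sum: "mat_act n i j (\<Sum>x\<in>A. f x) = (\<Sum>x\<in>A. mat_act n i j (f x))"
  by (induction A rule: infinite_finite_induct) (auto simp: mat_act_add)

lemma mat_act_mult: "mat_act n i j (p * q) = mat_act n i j p * q + p * mat_act n i j q"
  by (simp add: mat_act_def pdiff_mult sum_distrib_left sum_distrib_right sum.distrib algebra_simps)

lemma pdiff_pvar: "pdiff x (pvar y) = (if x = y then 1 else 0)"
  by (auto simp: pvar_def pdiff_single lookup_single when_def)

lemma mat_act_pvar:
  "mat_act n i j (pvar (a, k)) = (if j = a \<and> k < n then pvar (i, k) else 0)"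
proof -
  have "mat_act n i j (pvar (a, k)) = (\<Sum>k'<n. if k' = k then (if j = a then pvar (i, k) else 0) else 0)"
    unfolding mat_act_def by (rule sum.cong) (auto simp: pdiff_pvar)
  then show ?thesis by simp
qed

lemma pdiff_zero: "pdiff x 0 = 0"
  by (simp add: pdiff_def)

lemma pdiff_sum: "pdiff x (\<Sum>a\<in>A. f a) = (\<Sum>a\<in>A. pdiff x (f a))"
  by (induction A rule: infinite_finite_induct) (auto simp: pdiff_add pdiff_zero)

text \<open>The composition splits into a first-order and a second-order part. The latter is
  symmetric under exchanging \<open>(i, j)\<close> with \<open>(k, m)\<close>, since multiplications
  and derivatives commute among themselves, so only the former survives in the commutator.\<close>

lemma mat_act_comp:
  "mat_act n i j (mat_act n k m p) =
    (if j = k then mat_act n i m p else 0)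
      + (\<Sum>a<n. \<Sum>b<n. pvar (i, a) * (pvar (k, b) * pdiff (j, a) (pdiff (m, b) p)))"
proof -
  have "mat_act n i j (mat_act n k m p) =
      (\<Sum>a<n. \<Sum>b<n. pvar (i, a) * (if j = k \<and> a = b then pdiff (m, b) p else 0)
         + pvar (i, a) * (pvar (k, b) * pdiff (j, a) (pdiff (m, b) p)))"
    by (simp add: mat_act_def pdiff_sum pdiff_pvar_times sum_distrib_left distrib_left)
  also have "\<dots> = (\<Sum>a<n. \<Sum>b<n. if a = b then (if j = k then pvar (i, a) * pdiff (m, a) p else 0) else 0)
      + (\<Sum>a<n. \<Sum>b<n. pvar (i, a) * (pvar (k, b) * pdiff (j, a) (pdiff (m, b) p)))"
    unfolding sum.distrib by (rule arg_cong2[where f = "(+)"])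
      (auto intro!: sum.cong simp: if_distrib[of "(*) (pvar _)"] cong: if_cong)
  also have "(\<Sum>a<n. \<Sum>b<n. if a = b then (if j = k then pvar (i, a) * pdiff (m, a) p else 0) else 0)
      = (if j = k then mat_act n i m p else 0)"
    by (simp add: mat_act_def)
  finally show ?thesis .
qed

lemma mat_act_commutator:
  "mat_act n i j (mat_act n k m p) - mat_act n k m (mat_act n i j p) =
     (if j = k then mat_act n i m p else 0) - (if m = i then mat_act n k j p else 0)"
proof -
  have "(\<Sum>a<n. \<Sum>b<n. pvar (i, a) * (pvar (k, b) * pdiff (j, a) (pdiff (m, b) p))) =
      (\<Sum>b<n. \<Sum>a<n. pvar (k, b) * (pvar (i, a) * pdiff (m, b) (pdiff (j, a) p)))"
    by (subst sum.swap) (simp add: pdiff_commute[of "(j, _)"] mult.left_commute)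
  then show ?thesis
    by (simp add: mat_act_comp)
qed

text \<open>Linearity and the commutation relations hold on all polynomials, so only stability of a
  subspace remains to be checked.\<close>

lemma gl_module_mat_act_iff:
  "gl_module n (mat_act n) U \<longleftrightarrow> cvec.subspace U \<and> (\<forall>i<n. \<forall>j<n. \<forall>v\<in>U. mat_act n i j v \<in> U)"
  by (auto simp: gl_module_def mat_act_add mat_act_cscale mat_act_commutator)

lemma lookup_mat_act:
  "lookup (mat_act n i j f) m =
    (\<Sum>k<n. if 0 < lookup m (i, k)
       then of_nat (lookup (m - expo (i, k)) (j, k) + 1) * lookup f (m - expo (i, k) + expo (j, k)) else 0)"
  unfolding mat_act_def lookup_sum by (rule sum.cong) (auto simp: lookup_pvar_times lookup_pdiff)

lemma mat_act_single:
  "mat_act n i j (single m c) =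
    (\<Sum>k<n. single (m - expo (j, k) + expo (i, k)) (of_nat (lookup m (j, k)) * c))"
  by (simp add: mat_act_def pdiff_single pvar_def mult_single add.commute)

section \<open>The polynomials of degree \<open>l\<close> in every column\<close>

definition rowsum :: "nat \<Rightarrow> nat \<Rightarrow> (nat \<times> nat \<Rightarrow>\<^sub>0 nat) \<Rightarrow> nat" where
  "rowsum n r m = (\<Sum>k<n. lookup m (r, k))"

text \<open>\<open>rowsum n r\<close> is the eigenvalue of \<open>E r r\<close> on a monomial;
  \<open>colsum n k\<close> is its degree in column \<open>k\<close>, which every
  \<open>E i j\<close> preserves because it moves units within columns.\<close>

definition colsum :: "nat \<Rightarrow> nat \<Rightarrow> (nat \<times> nat \<Rightarrow>\<^sub>0 nat) \<Rightarrow> nat" where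
  "colsum n k m = (\<Sum>i<n. lookup m (i, k))"

definition col_monos :: "nat \<Rightarrow> nat \<Rightarrow> (nat \<times> nat \<Rightarrow>\<^sub>0 nat) set" where
  "col_monos n l = {m. keys m \<subseteq> {..<n} \<times> {..<n} \<and> (\<forall>k<n. colsum n k m = l)}"

definition col_space :: "nat \<Rightarrow> nat \<Rightarrow> (nat \<times> nat) cpoly set" where
  "col_space n l = {p. keys p \<subseteq> col_monos n l}"

lemma rowsum_add: "rowsum n r (a + b) = rowsum n r a + rowsum n r b"
  by (simp add: rowsum_def lookup_add sum.distrib)

lemma colsum_add: "colsum n k (a + b) = colsum n k a + colsum n k b"
  by (simp add: colsum_def lookup_add sum.distrib)

lemma rowsum_expo: "k < n \<Longrightarrow> rowsum n r (expo (i, k)) = (if i = r then 1 else 0)"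
  by (auto simp: rowsum_def lookup_single when_def)

lemma colsum_expo: "i < n \<Longrightarrow> colsum n k (expo (i, k')) = (if k = k' then 1 else 0)"
  by (auto simp: colsum_def lookup_single when_def)

lemma lookup_le_of_col_monos:
  assumes "m \<in> col_monos n l"
  shows "lookup m x \<le> l"
proof (cases "x \<in> keys m")
  case True
  then obtain i k where x: "x = (i, k)" "i < n" "k < n"
    using assms by (auto simp: col_monos_def)
  then have "lookup m x \<le> colsum n k m"
    unfolding colsum_def x(1) by (intro member_le_sum) auto
  then show ?thesis
    using assms x by (simp add: col_monos_def)
qed (simp add: in_keys_iff)

lemma finite_bounded_monos:
  assumes "finite X"
  shows "finite {m :: 'x \<Rightarrow>\<^sub>0 nat. keys m \<subseteq> X \<and> (\<forall>x. lookup m x \<le> l)}" (is "finite ?M")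
proof -
  have "inj_on (\<lambda>m. restrict (lookup m) X) ?M"
  proof (rule inj_onI, rule poly_mapping_eqI)
    fix a b :: "'x \<Rightarrow>\<^sub>0 nat" and x
    assume ab: "a \<in> ?M" "b \<in> ?M" "restrict (lookup a) X = restrict (lookup b) X"
    show "lookup a x = lookup b x"
    proof (cases "x \<in> X")
      case True
      then show ?thesis using fun_cong[OF ab(3), of x] by simp
    next
      case False
      then have "x \<notin> keys a" "x \<notin> keys b" using ab by auto
      then show ?thesis by (simp add: in_keys_iff)
    qed
  qed
  moreover have "(\<lambda>m. restrict (lookup m) X) ` ?M \<subseteq> X \<rightarrow>\<^sub>E {..l}"
    by auto
  moreover have "finite (X \<rightarrow>\<^sub>E {..l})"
    using assms by (simp add: finite_PiE)
  ultimately show ?thesis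
    by (rule inj_on_finite)
qed

lemma finite_col_monos: "finite (col_monos n l)"
proof (rule finite_subset)
  show "col_monos n l \<subseteq> {m. keys m \<subseteq> {..<n} \<times> {..<n} \<and> (\<forall>x. lookup m x \<le> l)}"
    using lookup_le_of_col_monos by (auto simp: col_monos_def)
qed (rule finite_bounded_monos, simp)

lemma move_in_col_monos:
  assumes "m \<in> col_monos n l" "0 < lookup m (j, k)" "i < n"
  shows "m - expo (j, k) + expo (i, k) \<in> col_monos n l"
proof -
  define b where "b = m - expo (j, k)"
  have m: "m = b + expo (j, k)"
    using minus_add_expo[OF assms(2)] by (simp add: b_def)
  have "(j, k) \<in> keys m"
    using assms(2) by (simp add: in_keys_iff)
  then have jk: "j < n" "k < n"
    using assms(1) by (auto simp: col_monos_def)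
  have "keys b \<subseteq> keys m"
    by (auto simp: in_keys_iff m lookup_add)
  then have "keys (b + expo (i, k)) \<subseteq> {..<n} \<times> {..<n}"
    using assms jk keys_add_subset[of b "expo (i, k)"] by (auto simp: col_monos_def)
  moreover have "colsum n c (b + expo (i, k)) = l" if "c < n" for c
    using assms(1,3) that jk by (simp add: col_monos_def m colsum_add colsum_expo)
  ultimately show ?thesis
    by (simp add: b_def col_monos_def)
qed

lemma subspace_keys: "cvec.subspace {p. keys p \<subseteq> A}"
proof -
  have "keys (p + q) \<subseteq> A" if "keys p \<subseteq> A" "keys q \<subseteq> A" for p q :: "'a \<Rightarrow>\<^sub>0 complex"
    using that keys_add_subset[of p q] by blast
  moreover have "keys (cscale c p) \<subseteq> A" if "keys p \<subseteq> A" for c and p :: "'a \<Rightarrow>\<^sub>0 complex"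
    using that keys_cscale_subset[of c p] by blast
  ultimately show ?thesis by (simp add: cvec.subspace_def)
qed

lemma subspace_col_space: "cvec.subspace (col_space n l)"
  unfolding col_space_def by (rule subspace_keys)

lemma in_subspace_if_singles:
  assumes "cvec.subspace U" "finite A" "keys p \<subseteq> A" "\<And>m. m \<in> A \<Longrightarrow> single m 1 \<in> U"
  shows "p \<in> U"
proof -
  have "(\<Sum>m\<in>A. single m (lookup p m)) \<in> U"
    by (rule cvec.subspace_sum[OF assms(1)])
      (subst single_eq_cscale, intro cvec.subspace_scale assms)
  then show ?thesis
    using sum_single_lookup[OF assms(2,3)] by simp
qed

lemma mat_act_eq_sum:
  assumes "finite A" "keys p \<subseteq> A"
  shows "mat_act n i j p = (\<Sum>m\<in>A. cscale (lookup p m) (mat_act n i j (single m 1)))"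
proof -
  have "mat_act n i j p = mat_act n i j (\<Sum>m\<in>A. single m (lookup p m))"
    using sum_single_lookup[OF assms] by simp
  also have "\<dots> = (\<Sum>m\<in>A. mat_act n i j (cscale (lookup p m) (single m 1)))"
    unfolding mat_act_sum by (subst single_eq_cscale) (rule refl)
  finally show ?thesis by (simp add: mat_act_cscale)
qed

lemma mat_act_col_space:
  assumes "p \<in> col_space n l" "i < n"
  shows "mat_act n i j p \<in> col_space n l"
proof -
  have "mat_act n i j (single m 1) \<in> col_space n l" if "m \<in> col_monos n l" for m
  proof -
    have "single (m - expo (j, k) + expo (i, k)) (of_nat (lookup m (j, k)) * 1) \<in> col_space n l" for k
      using move_in_col_monos[OF that _ assms(2)]
      by (cases "lookup m (j, k) = 0") (auto simp: col_space_def)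
    then show ?thesis
      unfolding mat_act_single by (intro cvec.subspace_sum subspace_col_space)
  qed
  then show ?thesis
    using assms(1) by (subst mat_act_eq_sum[OF finite_keys order_refl], intro cvec.subspace_sum subspace_col_space cvec.subspace_scale)
      (auto simp: col_space_def)
qed

definition diag :: "nat \<Rightarrow> nat \<Rightarrow> (nat \<times> nat \<Rightarrow>\<^sub>0 nat)" where
  "diag n l = (\<Sum>i<n. single (i, i) l)"

lemma lookup_diag: "lookup (diag n l) (i, k) = (if i = k \<and> i < n then l else 0)"
proof -
  have "lookup (diag n l) (i, k) = (\<Sum>a<n. if a = i then (if i = k then l else 0) else 0)"
    unfolding diag_def lookup_sum by (rule sum.cong) (auto simp: lookup_single when_def)
  then show ?thesis by simp
qed

text \<open>Distance of an exponent from the diagonal one: the induction that generates all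
  monomials from \<open>diag n l\<close> runs over it.\<close>

definition offdiag :: "nat \<Rightarrow> (nat \<times> nat \<Rightarrow>\<^sub>0 nat) \<Rightarrow> nat" where
  "offdiag n m = (\<Sum>x\<in>{..<n} \<times> {..<n}. if fst x = snd x then 0 else lookup m x)"

lemma offdiag_add: "offdiag n (a + b) = offdiag n a + offdiag n b"
  unfolding offdiag_def sum.distrib[symmetric] by (rule sum.cong) (auto simp: lookup_add)

lemma offdiag_expo: "i < n \<Longrightarrow> k < n \<Longrightarrow> offdiag n (expo (i, k)) = (if i = k then 0 else 1)"
proof -
  assume "i < n" "k < n"
  have "offdiag n (expo (i, k)) = (\<Sum>x\<in>{..<n} \<times> {..<n}. if x = (i, k) then (if i = k then 0 else 1) else 0)"
    unfolding offdiag_def by (rule sum.cong) (auto simp: lookup_single when_def)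
  then show ?thesis using \<open>i < n\<close> \<open>k < n\<close> by simp
qed

lemma eq_diag_if_offdiag_0:
  assumes "m \<in> col_monos n l" "offdiag n m = 0"
  shows "m = diag n l"
proof (rule poly_mapping_eqI)
  fix x :: "nat \<times> nat"
  obtain i k where x: "x = (i, k)" by (cases x)
  have off: "lookup m (i, k) = 0" if "i < n" "k < n" "i \<noteq> k" for i k
  proof -
    have "\<forall>x\<in>{..<n} \<times> {..<n}. (if fst x = snd x then 0 else lookup m x) = 0"
      using assms(2) by (simp add: offdiag_def)
    from bspec[OF this, of "(i, k)"] show ?thesis using that by simp
  qed
  have "lookup m (k, k) = l" if "k < n" for k
  proof -
    have "l = colsum n k m"
      using assms(1) that by (simp add: col_monos_def)
    also have "\<dots> = (\<Sum>i<n. if i = k then lookup m (k, k) else 0)"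
      unfolding colsum_def by (rule sum.cong) (use off that in auto)
    finally show ?thesis using that by simp
  qed
  moreover have "lookup m (i, k) = 0" if "\<not> (i < n \<and> k < n)"
    using assms(1) that by (auto simp: col_monos_def simp flip: not_in_keys_iff_lookup_eq_zero)
  ultimately show "lookup m x = lookup (diag n l) x"
    using off by (auto simp: x lookup_diag)
qed

text \<open>
  Applying \<open>E i j\<close> to a monomial divisible by \<open>x j j\<close> replaces one factor \<open>x j j\<close> by \<open>x i j\<close>, up to
  terms with fewer off-diagonal variables.
\<close>

lemma single_in_generated:
  assumes U: "cvec.subspace U" "\<And>i j v. i < n \<Longrightarrow> j < n \<Longrightarrow> v \<in> U \<Longrightarrow> mat_act n i j v \<in> U"
    and diag: "single (diag n l) 1 \<in> U"
  shows "m \<in> col_monos n l \<Longrightarrow> single m 1 \<in> U"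
proof (induction "offdiag n m" arbitrary: m rule: less_induct)
  case less
  show ?case
  proof (cases "offdiag n m = 0")
    case True
    then show ?thesis
      using eq_diag_if_offdiag_0 less.prems diag by metis
  next
    case False
    then obtain i j where ij: "i < n" "j < n" "i \<noteq> j" "0 < lookup m (i, j)"
      by (auto simp: offdiag_def split: if_splits)
    define b where "b = m - expo (i, j)"
    have m: "m = b + expo (i, j)"
      using minus_add_expo[OF ij(4)] by (simp add: b_def)
    \<comment> \<open>Moving the unit back from \<open>(i, j)\<close> to \<open>(j, j)\<close>
      removes one off-diagonal variable, and \<open>E i j\<close> applied to the result brings
      \<open>m\<close> back.\<close>
    define m' where "m' = b + expo (j, j)"
    have m'_in: "m' \<in> col_monos n l"
      unfolding m'_def b_def using move_in_col_monos less.prems ij by blast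
    have off: "offdiag n m = offdiag n b + 1" "offdiag n m' = offdiag n b"
      using ij by (simp_all add: m m'_def offdiag_add offdiag_expo)
    define c :: complex where "c = of_nat (lookup m' (j, j))"
    have c: "c \<noteq> 0" unfolding c_def of_nat_eq_0_iff by (simp add: m'_def lookup_add)
    define t where "t k = single (m' - expo (j, k) + expo (i, k)) (of_nat (lookup m' (j, k)) :: complex)" for k
    have tj: "t j = single m c"
      by (simp add: t_def c_def m'_def m)
    have tk: "t k \<in> U" if "k \<in> {..<n} - {j}" for k
    proof (cases "lookup m' (j, k) = 0")
      case True
      then show ?thesis using U(1) by (simp add: t_def cvec.subspace_0)
    next
      case False
      define d where "d = m' - expo (j, k)"
      have d: "m' = d + expo (j, k)"
        using False by (simp add: d_def minus_add_expo)
      \<comment> \<open>With \<open>k\<close> different from \<open>j\<close> the unit taken from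
        \<open>(j, k)\<close> was off the diagonal, so putting it at \<open>(i, k)\<close> gives at
        most the off-diagonal degree of \<open>m'\<close>, which is one below that of
        \<open>m\<close>.\<close>
      have "offdiag n (d + expo (i, k)) < offdiag n m"
        using that ij off by (auto simp: d offdiag_add offdiag_expo split: if_splits)
      moreover have "d + expo (i, k) \<in> col_monos n l"
        unfolding d_def using False m'_in ij by (intro move_in_col_monos) auto
      ultimately have "single (d + expo (i, k)) 1 \<in> U"
        using less.hyps by blast
      then show ?thesis
        unfolding t_def d_def by (subst single_eq_cscale) (rule cvec.subspace_scale[OF U(1)])
    qed
    have "single m' 1 \<in> U"
      using less.hyps[OF _ m'_in] off by simp
    then have "mat_act n i j (single m' 1) \<in> U"
      by (rule U(2)[OF ij(1,2)])
    then have "(\<Sum>k<n. t k) \<in> U"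
      by (simp add: mat_act_single t_def)
    moreover have "(\<Sum>k<n. t k) = t j + (\<Sum>k\<in>{..<n} - {j}. t k)"
      using ij by (intro sum.remove) auto
    ultimately have "t j \<in> U"
      using tk U(1) cvec.subspace_sum[OF U(1), of "{..<n} - {j}" t] cvec.subspace_diff[OF U(1)]
      by (metis add_diff_cancel_right')
    then have "cscale (1 / c) (single m c) \<in> U"
      using tj U(1) cvec.subspace_scale by metis
    moreover have "cscale (1 / c) (single m c) = single m 1"
      using c by (intro poly_mapping_eqI) (simp add: lookup_single when_def)
    ultimately show ?thesis by simp
  qed
qed

section \<open>Polynomial families\<close>

text \<open>A polynomial in \<alpha> is represented by its values, so operators apply pointwise and
  specialising at 0 is function application. The common finite support makes the family a finite
  combination of fixed vectors.\<close>

definition poly_family :: "(complex \<Rightarrow> ('b \<Rightarrow>\<^sub>0 complex)) \<Rightarrow> bool" where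
  "poly_family g \<longleftrightarrow>
     (\<exists>A. finite A \<and> (\<forall>\<alpha>. keys (g \<alpha>) \<subseteq> A)) \<and> (\<forall>m. \<exists>q. \<forall>\<alpha>. lookup (g \<alpha>) m = poly q \<alpha>)"

lemma poly_family_cscale_const: "poly_family (\<lambda>\<alpha>. cscale (poly q \<alpha>) h)"
  unfolding poly_family_def
proof (intro conjI allI)
  show "\<exists>A. finite A \<and> (\<forall>\<alpha>. keys (cscale (poly q \<alpha>) h) \<subseteq> A)"
    by (intro exI[of _ "keys h"] conjI allI finite_keys keys_cscale_subset)
  show "\<exists>q'. \<forall>\<alpha>. lookup (cscale (poly q \<alpha>) h) m = poly q' \<alpha>" for m
    by (rule exI[of _ "Polynomial.smult (lookup h m) q"]) simp
qed

lemma poly_family_add: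
  assumes "poly_family f" "poly_family g"
  shows "poly_family (\<lambda>\<alpha>. f \<alpha> + g \<alpha>)"
  unfolding poly_family_def
proof (intro conjI allI)
  obtain A B where "finite A" "\<And>\<alpha>. keys (f \<alpha>) \<subseteq> A" "finite B" "\<And>\<alpha>. keys (g \<alpha>) \<subseteq> B"
    using assms unfolding poly_family_def by blast
  moreover have "keys (f \<alpha> + g \<alpha>) \<subseteq> A \<union> B" for \<alpha>
    using keys_add_subset[of "f \<alpha>" "g \<alpha>"] calculation(2,4)[of \<alpha>] by blast
  ultimately show "\<exists>A. finite A \<and> (\<forall>\<alpha>. keys (f \<alpha> + g \<alpha>) \<subseteq> A)"
    by (intro exI[of _ "A \<union> B"]) simp
  fix m
  obtain p q where "\<And>\<alpha>. lookup (f \<alpha>) m = poly p \<alpha>" "\<And>\<alpha>. lookup (g \<alpha>) m = poly q \<alpha>"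
    using assms unfolding poly_family_def by blast
  then show "\<exists>q. \<forall>\<alpha>. lookup (f \<alpha> + g \<alpha>) m = poly q \<alpha>"
    by (intro exI[of _ "p + q"]) (simp add: lookup_add)
qed

lemma poly_family_const: "poly_family (\<lambda>\<alpha>. h)"
proof -
  have "cscale (poly 1 \<alpha>) h = h" for \<alpha> by simp
  then show ?thesis using poly_family_cscale_const[of 1 h] by simp
qed

lemma poly_family_sum:
  assumes "\<And>x. x \<in> A \<Longrightarrow> poly_family (f x)"
  shows "poly_family (\<lambda>\<alpha>. \<Sum>x\<in>A. f x \<alpha>)"
  using assms
  by (induction A rule: infinite_finite_induct) (auto intro: poly_family_const poly_family_add)

text \<open>Separates \<alpha> from the basis vectors, which reduces products and linear operators
  to finite sums with polynomial coefficients.\<close>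

lemma poly_family_expansion:
  assumes "poly_family f"
  obtains A q where "finite A" "\<And>\<alpha>. keys (f \<alpha>) \<subseteq> A"
    "\<And>\<alpha>. f \<alpha> = (\<Sum>m\<in>A. cscale (poly (q m) \<alpha>) (single m 1))"
    "\<And>\<alpha> m. lookup (f \<alpha>) m = poly (q m) \<alpha>"
proof -
  obtain A where A: "finite A" "\<And>\<alpha>. keys (f \<alpha>) \<subseteq> A"
    using assms unfolding poly_family_def by blast
  obtain q where q: "\<And>\<alpha> m. lookup (f \<alpha>) m = poly (q m) \<alpha>"
    using assms unfolding poly_family_def by metis
  have "f \<alpha> = (\<Sum>m\<in>A. cscale (poly (q m) \<alpha>) (single m 1))" for \<alpha>
  proof -
    have "f \<alpha> = (\<Sum>m\<in>A. single m (lookup (f \<alpha>) m))"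
      using sum_single_lookup[OF A] .
    also have "\<dots> = (\<Sum>m\<in>A. cscale (lookup (f \<alpha>) m) (single m 1))"
      by (subst single_eq_cscale) (rule refl)
    finally show ?thesis by (simp add: q)
  qed
  with A q that show ?thesis by blast
qed

lemma cscale_mult: "cscale c p * cscale d q = cscale (c * d) (p * (q :: 'x cpoly))"
proof -
  have [simp]: "cscale c p = single 0 c * p" for c and p :: "'x cpoly"
    unfolding cscale_def by (rule mult_map_scale_conv_mult)
  have "single 0 (c * d) = single 0 c * (single 0 d :: 'x cpoly)"
    by (simp add: mult_single)
  then show ?thesis by (simp add: ac_simps)
qed

lemma poly_family_mult:
  fixes f g :: "complex \<Rightarrow> 'x cpoly"
  assumes "poly_family f" "poly_family g"
  shows "poly_family (\<lambda>\<alpha>. f \<alpha> * g \<alpha>)"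
proof -
  from assms(1) obtain A p where f: "\<And>\<alpha>. f \<alpha> = (\<Sum>m\<in>A. cscale (poly (p m) \<alpha>) (single m 1))"
    by (rule poly_family_expansion) blast
  from assms(2) obtain B q where g: "\<And>\<alpha>. g \<alpha> = (\<Sum>m\<in>B. cscale (poly (q m) \<alpha>) (single m 1))"
    by (rule poly_family_expansion) blast
  have "f \<alpha> * g \<alpha> = (\<Sum>a\<in>A. \<Sum>b\<in>B. cscale (poly (p a * q b) \<alpha>) (single a 1 * single b 1))" for \<alpha>
    unfolding f g sum_product by (simp add: cscale_mult)
  then show ?thesis
    by (simp only:) (intro poly_family_sum poly_family_cscale_const)
qed

lemma poly_family_power:
  fixes f :: "complex \<Rightarrow> 'x cpoly"
  shows "poly_family f \<Longrightarrow> poly_family (\<lambda>\<alpha>. f \<alpha> ^ k)"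
  by (induction k) (auto intro: poly_family_const poly_family_mult)

lemma poly_family_mat_act:
  assumes "poly_family f"
  shows "poly_family (\<lambda>\<alpha>. mat_act n i j (f \<alpha>))"
proof -
  from assms obtain A q where A: "finite A" "\<And>\<alpha>. keys (f \<alpha>) \<subseteq> A"
    and q: "\<And>\<alpha> m. lookup (f \<alpha>) m = poly (q m) \<alpha>"
    by (rule poly_family_expansion) blast
  show ?thesis
    unfolding mat_act_eq_sum[OF A] q by (intro poly_family_sum poly_family_cscale_const)
qed

text \<open>The coefficient matrix of the family is the identity at \<open>0\<close>, so its determinant is a nonzero polynomial.\<close>

lemma poly_families_span:
  fixes g :: "'b \<Rightarrow> complex \<Rightarrow> ('b \<Rightarrow>\<^sub>0 complex)"
  assumes S: "finite S"
    and fam: "\<And>m. m \<in> S \<Longrightarrow> poly_family (g m)"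
    and keys: "\<And>m \<alpha>. m \<in> S \<Longrightarrow> keys (g m \<alpha>) \<subseteq> S"
    and g0: "\<And>m. m \<in> S \<Longrightarrow> g m 0 = single m 1"
  shows "finite {\<alpha>. \<not> (\<forall>m\<in>S. single m 1 \<in> cvec.span ((\<lambda>m. g m \<alpha>) ` S))}"
proof -
  define N where "N = card S"
  obtain e where e: "bij_betw e {0..<N} S"
    using ex_bij_betw_nat_finite[OF S] by (auto simp: N_def)
  have eS: "e i \<in> S" if "i < N" for i
    using e that by (auto simp: bij_betw_def)
  have e_eq: "e i = e j \<longleftrightarrow> i = j" if "i < N" "j < N" for i j
    using e that by (auto simp: bij_betw_def inj_on_def)
  have "\<forall>m m'. \<exists>q. m \<in> S \<longrightarrow> (\<forall>\<alpha>. lookup (g m \<alpha>) m' = poly q \<alpha>)"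
    using fam unfolding poly_family_def by blast
  then obtain q where q: "\<And>m m' \<alpha>. m \<in> S \<Longrightarrow> lookup (g m \<alpha>) m' = poly (q m m') \<alpha>"
    by metis
  define A where "A = mat N N (\<lambda>(i, j). q (e i) (e j))"
  define A' where "A' \<alpha> = map_mat (\<lambda>p. poly p \<alpha>) A" for \<alpha>
  have A'_carrier: "A' \<alpha> \<in> carrier_mat N N" for \<alpha>
    by (simp add: A'_def A_def)
  have A'_entry: "A' \<alpha> $$ (i, j) = lookup (g (e i) \<alpha>) (e j)" if "i < N" "j < N" for \<alpha> i j
    using that by (simp add: A'_def A_def q eS)
  have det: "det (A' \<alpha>) = poly (det A) \<alpha>" for \<alpha>
  proof -
    have "comm_ring_hom (\<lambda>p. poly p \<alpha>)" by unfold_locales auto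
    then show ?thesis unfolding A'_def by (rule comm_ring_hom.hom_det)
  qed
  have "A' 0 = 1\<^sub>m N"
    by (rule eq_matI) (use A'_carrier[of 0] in \<open>auto simp: A'_entry g0 eS lookup_single e_eq when_def\<close>)
  then have "poly (det A) 0 = 1"
    using det[of 0] by simp
  then have "finite {\<alpha>. poly (det A) \<alpha> = 0}"
    by (intro poly_roots_finite) auto
  moreover have "single m 1 \<in> cvec.span ((\<lambda>m. g m \<alpha>) ` S)"
    if nz: "poly (det A) \<alpha> \<noteq> 0" and m: "m \<in> S" for \<alpha> m
  proof -
    define d where "d = det (A' \<alpha>)"
    have d: "d \<noteq> 0" using nz det d_def by simp
    obtain j where j: "j < N" "m = e j"
      using m e by (auto simp: bij_betw_def)
    \<comment> \<open>Row \<open>j\<close> of the inverse of \<open>A' \<alpha>\<close>, by the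
      adjugate: it expresses the \<open>j\<close>-th unit vector through the rows, which are the
      coordinates of the \<open>g (e i) \<alpha>\<close>.\<close>
    define c where "c i = adj_mat (A' \<alpha>) $$ (j, i) / d" for i
    have adj: "adj_mat (A' \<alpha>) \<in> carrier_mat N N" "adj_mat (A' \<alpha>) * A' \<alpha> = d \<cdot>\<^sub>m 1\<^sub>m N"
      using adj_mat[OF A'_carrier] by (auto simp: d_def)
    have sum: "(\<Sum>i = 0..<N. c i * lookup (g (e i) \<alpha>) (e k)) = (if j = k then 1 else 0)" if "k < N" for k
    proof -
      have "(adj_mat (A' \<alpha>) * A' \<alpha>) $$ (j, k) = (\<Sum>i = 0..<N. adj_mat (A' \<alpha>) $$ (j, i) * A' \<alpha> $$ (i, k))"
        using adj(1) A'_carrier[of \<alpha>] j that by (simp add: scalar_prod_def)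
      also have "\<dots> = d * (\<Sum>i = 0..<N. c i * lookup (g (e i) \<alpha>) (e k))"
        using d that by (simp add: c_def sum_distrib_left A'_entry)
      finally show ?thesis
        using adj(2) d j that by (simp split: if_splits)
    qed
    have "single m 1 = (\<Sum>i = 0..<N. cscale (c i) (g (e i) \<alpha>))"
    proof (rule poly_mapping_eqI)
      fix x
      show "lookup (single m 1) x = lookup (\<Sum>i = 0..<N. cscale (c i) (g (e i) \<alpha>)) x"
      proof (cases "x \<in> S")
        case True
        then obtain k where "k < N" "x = e k"
          using e by (auto simp: bij_betw_def)
        then show ?thesis
          using sum[of k] j e_eq by (simp add: lookup_sum lookup_single when_def)
      next
        case False
        then have "lookup (g (e i) \<alpha>) x = 0" if "i < N" for i
          using keys[OF eS[OF that], of \<alpha>] by (meson in_keys_iff subsetD)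
        then show ?thesis
          using False m by (auto simp: lookup_sum lookup_single when_def)
      qed
    qed
    also have "\<dots> \<in> cvec.span ((\<lambda>m. g m \<alpha>) ` S)"
      by (intro cvec.span_sum cvec.span_scale cvec.span_base) (use eS in auto)
    finally show ?thesis .
  qed
  ultimately show ?thesis
    by (elim finite_subset[rotated]) auto
qed

section \<open>Genericity of the cyclic module\<close>

lemma col_space_subset_mat_poly: "col_space n l \<subseteq> mat_poly n"
  by (auto simp: col_space_def mat_poly_def col_monos_def)

lemma gl_module_col_space: "gl_module n (mat_act n) (col_space n l)"
  by (simp add: gl_module_mat_act_iff subspace_col_space mat_act_col_space)

lemma gl_module_Inter:
  assumes "\<And>U. U \<in> \<U> \<Longrightarrow> gl_module n (mat_act n) U"
  shows "gl_module n (mat_act n) (\<Inter>\<U>)"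
  using assms unfolding gl_module_mat_act_iff cvec.subspace_def by blast

text \<open>\<open>U\<close> below collects the values at 0 of polynomial families that stay in the
  cyclic module for every \<alpha>. It is a stable subspace containing \<open>f 0\<close>, hence
  contains all monomials of \<open>col_space n l\<close>. This lifts the monomial basis to families
  inside the module, and these span the space for all but finitely many \<alpha>.\<close>

lemma generic_cyclic:
  assumes fam: "poly_family f"
    and f: "\<And>\<alpha>. f \<alpha> \<in> col_space n l"
    and f0: "f 0 = single (diag n l) 1"
  shows "finite {\<alpha>. gl_cyclic n (mat_act n) (mat_poly n) (f \<alpha>) \<noteq> col_space n l}"
proof -
  define C where "C \<alpha> = gl_cyclic n (mat_act n) (mat_poly n) (f \<alpha>)" for \<alpha>
  have C_sub: "C \<alpha> \<subseteq> col_space n l" for \<alpha>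
    unfolding C_def gl_cyclic_def gl_submodule_def
    by (rule Inter_lower) (simp add: f col_space_subset_mat_poly gl_module_col_space)
  have C_mod: "gl_module n (mat_act n) (C \<alpha>)" for \<alpha>
    unfolding C_def gl_cyclic_def gl_submodule_def by (rule gl_module_Inter) auto
  have C_space: "cvec.subspace (C \<alpha>)"
    and C_act: "\<And>i j v. i < n \<Longrightarrow> j < n \<Longrightarrow> v \<in> C \<alpha> \<Longrightarrow> mat_act n i j v \<in> C \<alpha>" for \<alpha>
    using C_mod by (auto simp: gl_module_mat_act_iff)
  have f_C: "f \<alpha> \<in> C \<alpha>" for \<alpha>
    unfolding C_def gl_cyclic_def by blast
  define U where "U = {g 0 |g. poly_family g \<and> (\<forall>\<alpha>. g \<alpha> \<in> C \<alpha>)}"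
  have UI: "g 0 \<in> U" if "poly_family g" "\<And>\<alpha>. g \<alpha> \<in> C \<alpha>" for g
    unfolding U_def using that by blast
  have "cvec.subspace U"
    unfolding cvec.subspace_def
  proof (intro conjI ballI allI)
    show "0 \<in> U"
      using UI[of "\<lambda>\<alpha>. 0"] C_space by (simp add: poly_family_const cvec.subspace_0)
  next
    fix x y assume "x \<in> U" "y \<in> U"
    then obtain g h where "poly_family g" "\<And>\<alpha>. g \<alpha> \<in> C \<alpha>" "x = g 0"
      "poly_family h" "\<And>\<alpha>. h \<alpha> \<in> C \<alpha>" "y = h 0"
      unfolding U_def by blast
    then show "x + y \<in> U"
      using UI[of "\<lambda>\<alpha>. g \<alpha> + h \<alpha>"] C_space by (simp add: poly_family_add cvec.subspace_add)
  next
    fix c x assume "x \<in> U"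
    then obtain g where g: "poly_family g" "\<And>\<alpha>. g \<alpha> \<in> C \<alpha>" "x = g 0"
      unfolding U_def by blast
    from g(1) obtain A q where gq: "\<And>\<alpha>. g \<alpha> = (\<Sum>m\<in>A. cscale (poly (q m) \<alpha>) (single m 1))"
      by (rule poly_family_expansion) blast
    have "cscale c (g \<alpha>) = (\<Sum>m\<in>A. cscale (poly (Polynomial.smult c (q m)) \<alpha>) (single m 1))" for \<alpha>
      by (simp add: gq cscale_sum)
    then have "poly_family (\<lambda>\<alpha>. cscale c (g \<alpha>))"
      by (simp only:) (intro poly_family_sum poly_family_cscale_const)
    then show "cscale c x \<in> U"
      using UI[of "\<lambda>\<alpha>. cscale c (g \<alpha>)"] C_space g by (simp add: cvec.subspace_scale)
  qed
  moreover have "mat_act n i j v \<in> U" if ij: "i < n" "j < n" and v: "v \<in> U" for i j v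
  proof -
    obtain g where "poly_family g" "\<And>\<alpha>. g \<alpha> \<in> C \<alpha>" "v = g 0"
      using v unfolding U_def by blast
    then show ?thesis
      using UI[of "\<lambda>\<alpha>. mat_act n i j (g \<alpha>)"] C_act ij by (simp add: poly_family_mat_act)
  qed
  moreover have "single (diag n l) 1 \<in> U"
    using UI[OF fam f_C] f0 by simp
  ultimately have "\<forall>m\<in>col_monos n l. single m 1 \<in> U"
    using single_in_generated[of U n l] by blast
  then have "\<forall>m\<in>col_monos n l. \<exists>g. poly_family g \<and> (\<forall>\<alpha>. g \<alpha> \<in> C \<alpha>) \<and> g 0 = single m 1"
    unfolding U_def mem_Collect_eq by metis
  then obtain g where g: "\<And>m. m \<in> col_monos n l \<Longrightarrow> poly_family (g m)"
    "\<And>m \<alpha>. m \<in> col_monos n l \<Longrightarrow> g m \<alpha> \<in> C \<alpha>"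
    "\<And>m. m \<in> col_monos n l \<Longrightarrow> g m 0 = single m 1"
    by metis
  have "finite {\<alpha>. \<not> (\<forall>m\<in>col_monos n l. single m 1 \<in> cvec.span ((\<lambda>m. g m \<alpha>) ` col_monos n l))}"
  proof (rule poly_families_span)
    show "keys (g m \<alpha>) \<subseteq> col_monos n l" if "m \<in> col_monos n l" for m \<alpha>
      using g(2)[OF that] C_sub by (auto simp: col_space_def)
  qed (auto simp: g finite_col_monos)
  moreover have "C \<alpha> = col_space n l"
    if singles: "\<forall>m\<in>col_monos n l. single m 1 \<in> cvec.span ((\<lambda>m. g m \<alpha>) ` col_monos n l)" for \<alpha>
  proof -
    have "cvec.span ((\<lambda>m. g m \<alpha>) ` col_monos n l) \<subseteq> C \<alpha>"
      by (rule cvec.span_minimal[OF _ C_space]) (use g(2) in blast)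
    then have singles_C: "single m 1 \<in> C \<alpha>" if "m \<in> col_monos n l" for m
      using singles that by blast
    have "p \<in> C \<alpha>" if "p \<in> col_space n l" for p
      by (rule in_subspace_if_singles[OF C_space finite_col_monos _ singles_C])
        (use that in \<open>simp add: col_space_def\<close>)
    then show ?thesis using C_sub by blast
  qed
  ultimately show ?thesis
    unfolding C_def[symmetric] by (elim finite_subset[rotated]) blast
qed

section \<open>The \<alpha>-determinant at \<alpha> = 0 and its column degrees\<close>

lemma cycle_count_eq_imp_id:
  assumes "\<sigma> permutes {..<n}" "cycle_count n \<sigma> \<ge> n"
  shows "\<sigma> = id"
proof
  fix i
  show "\<sigma> i = id i"
  proof (cases "i < n")
    case True
    have "card (orbit \<sigma> ` {..<n}) = card {..<n}"
      using assms(2) card_image_le[of "{..<n}" "orbit \<sigma>"] by (simp add: cycle_count_def)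
    then have inj: "inj_on (orbit \<sigma>) {..<n}"
      by (intro eq_card_imp_inj_on) auto
    have "permutation \<sigma>"
      using assms(1) permutation_permutes by blast
    \<comment> \<open>\<open>i\<close> and \<open>\<sigma> i\<close> lie on one cycle, so
      injectivity of the orbit map forces \<sigma> to fix \<open>i\<close>.\<close>
    then have "orbit \<sigma> (\<sigma> i) = orbit \<sigma> i"
      using permutation_self_in_orbit permutation_orbit_step by metis
    moreover have "\<sigma> i < n"
      using True permutes_in_image[OF assms(1)] by auto
    ultimately show ?thesis
      using inj True by (simp add: inj_on_def)
  next
    case False
    then show ?thesis using assms(1) by (simp add: permutes_def)
  qed
qed

text \<open>\<open>0 ^ 0 = 1\<close> and all other powers of 0 vanish, so only the permutation with
  \<open>n\<close> cycles, the identity, contributes.\<close>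

lemma alpha_det_0: "alpha_det n 0 = (\<Prod>i<n. pvar (i, i))"
proof -
  have zero: "(0::complex) ^ (n - cycle_count n \<sigma>) = (if \<sigma> = id then 1 else 0)" if "\<sigma> permutes {..<n}" for \<sigma>
  proof (cases "\<sigma> = id")
    case True
    have "orbit id i = {i}" for i :: nat
      by (simp add: orbit_eq_singleton_iff)
    then have "cycle_count n id = n"
      by (simp add: cycle_count_def card_image)
    then show ?thesis using True by simp
  next
    case False
    then show ?thesis
      using cycle_count_eq_imp_id[OF that] by (auto simp: not_le)
  qed
  have "alpha_det n 0 = (\<Sum>\<sigma> | \<sigma> permutes {..<n}. if \<sigma> = id then \<Prod>i<n. pvar (i, i) else 0)"
    unfolding alpha_det_def by (rule sum.cong) (auto simp: zero pconst_def)
  then show ?thesis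
    by (simp add: finite_permutations permutes_id)
qed

lemma prod_pvar: "(\<Prod>i\<in>A. pvar (f i)) = single (\<Sum>i\<in>A. expo (f i)) 1"
  by (induction A rule: infinite_finite_induct) (auto simp: pvar_def mult_single)

lemma single_power: "single a 1 ^ k = single (\<Sum>i<k. a) (1::complex)"
  by (induction k) (auto simp: mult_single add.commute)

lemma alpha_det_power_0: "alpha_det n 0 ^ l = single (diag n l) 1"
proof -
  have "(\<Sum>i<l. \<Sum>j<n. expo (j, j)) = diag n l"
    by (rule poly_mapping_eqI, rename_tac x, case_tac x)
      (auto simp: lookup_sum diag_def lookup_single when_def sum_distrib_left intro!: sum.cong)
  then show ?thesis
    by (simp add: alpha_det_0 prod_pvar single_power)
qed

lemma poly_family_alpha_det_power: "poly_family (\<lambda>\<alpha>. alpha_det n \<alpha> ^ l)"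
proof -
  have eq: "pconst (\<alpha> ^ k) * p = cscale (poly (monom 1 k) \<alpha>) p" for \<alpha> k and p :: "'x cpoly"
    by (simp add: pconst_def cscale_def mult_map_scale_conv_mult poly_monom)
  show ?thesis
    unfolding alpha_det_def eq
    by (intro poly_family_power poly_family_sum poly_family_cscale_const)
qed

lemma col_space_mult:
  assumes "p \<in> col_space n a" "q \<in> col_space n b"
  shows "p * q \<in> col_space n (a + b)"
proof -
  have "m \<in> col_monos n (a + b)" if m: "m \<in> keys (p * q)" for m
  proof -
    obtain x y where "m = x + y" "x \<in> keys p" "y \<in> keys q"
      using m keys_mult[of p q] by blast
    then show ?thesis
      using assms keys_add_subset[of x y] by (fastforce simp: col_space_def col_monos_def colsum_add)
  qed
  then show ?thesis by (auto simp: col_space_def)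
qed

lemma one_in_col_space: "1 \<in> col_space n 0"
  by (simp add: col_space_def col_monos_def colsum_def)

lemma col_space_power: "p \<in> col_space n a \<Longrightarrow> p ^ k \<in> col_space n (k * a)"
  by (induction k) (auto simp: one_in_col_space col_space_mult)

lemma alpha_det_power_in_col_space: "alpha_det n \<alpha> ^ l \<in> col_space n l"
proof -
  have "pconst c * (\<Prod>i<n. pvar (\<sigma> i, i)) \<in> col_space n 1" if "\<sigma> permutes {..<n}" for \<sigma> c
  proof -
    define a where "a = (\<Sum>i<n. expo (\<sigma> i, i))"
    have \<sigma>: "\<sigma> i < n" if "i < n" for i
      using permutes_in_image[OF \<open>\<sigma> permutes _\<close>] that by auto
    have "keys a \<subseteq> {..<n} \<times> {..<n}"
      unfolding a_def using keys_sum[of "\<lambda>i. expo (\<sigma> i, i)" "{..<n}"] \<sigma> by (auto split: if_splits)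
    moreover have "colsum n k a = 1" if "k < n" for k
    proof -
      have "colsum n k a = (\<Sum>j<n. colsum n k (expo (\<sigma> j, j)))"
        unfolding a_def colsum_def lookup_sum by (rule sum.swap)
      also have "\<dots> = 1"
        using that \<sigma> by (simp add: colsum_expo)
      finally show ?thesis .
    qed
    ultimately show ?thesis
      unfolding prod_pvar a_def[symmetric]
      by (auto simp: pconst_def mult_single col_space_def col_monos_def)
  qed
  then have "alpha_det n \<alpha> \<in> col_space n 1"
    unfolding alpha_det_def by (intro cvec.subspace_sum subspace_col_space) auto
  then show ?thesis
    using col_space_power[of _ n 1 l] by simp
qed

lemma finite_nongeneric:
  "finite {\<alpha>. gl_cyclic n (mat_act n) (mat_poly n) (alpha_det n \<alpha> ^ l) \<noteq> col_space n l}"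
  by (intro generic_cyclic poly_family_alpha_det_power alpha_det_power_in_col_space alpha_det_power_0)

section \<open>Leading basis elements\<close>

text \<open>Terms are compared by a number instead of an order relation. All other keys must be
  strictly lighter, so the leading element is unique even for a weight that is not
  injective.\<close>

definition is_lead :: "('b \<Rightarrow> nat) \<Rightarrow> ('b \<Rightarrow>\<^sub>0 complex) \<Rightarrow> 'b \<Rightarrow> bool" where
  "is_lead wt p m \<longleftrightarrow> m \<in> keys p \<and> (\<forall>k\<in>keys p. k \<noteq> m \<longrightarrow> wt k < wt m)"

definition leads :: "('b \<Rightarrow> nat) \<Rightarrow> ('b \<Rightarrow>\<^sub>0 complex) set \<Rightarrow> 'b set" where
  "leads wt H = {m. \<exists>p\<in>H. is_lead wt p m}"

lemma leads_mono: "H \<subseteq> H' \<Longrightarrow> leads wt H \<subseteq> leads wt H'"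
  by (auto simp: leads_def)

lemma leads_subset: "H \<subseteq> {p. keys p \<subseteq> S} \<Longrightarrow> leads wt H \<subseteq> S"
  by (auto simp: leads_def is_lead_def)

text \<open>Gaussian elimination from the top: a multiple of \<open>f m\<close> cancels the leading
  term \<open>m\<close> of \<open>p\<close>, and injectivity of \<open>wt\<close> makes the maximal
  weight drop.\<close>

lemma subset_span_leads:
  assumes inj: "inj_on wt S" and H: "cvec.subspace H" "H \<subseteq> {p. keys p \<subseteq> S}"
    and f: "\<And>m. m \<in> leads wt H \<Longrightarrow> f m \<in> H \<and> is_lead wt (f m) m"
  shows "H \<subseteq> cvec.span (f ` leads wt H)"
proof -
  have "p \<in> cvec.span (f ` leads wt H)" if "p \<in> H" "\<forall>k\<in>keys p. wt k < w" for p w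
    using that
  proof (induction w arbitrary: p)
    case 0
    then have "p = 0" by (auto simp flip: keys_eq_empty)
    then show ?case by (simp add: cvec.span_zero)
  next
    case (Suc w)
    show ?case
    proof (cases "\<exists>m\<in>keys p. wt m = w")
      case False
      then show ?thesis using Suc by (metis less_Suc_eq)
    next
      case True
      then obtain m where m: "m \<in> keys p" "wt m = w" by blast
      have unique: "k = m" if "k \<in> S" "wt k = w" for k
        using inj H(2) m that Suc.prems(1) by (auto simp: inj_on_def)
      have "is_lead wt p m"
        using m Suc.prems H(2) unique unfolding is_lead_def by (metis less_Suc_eq mem_Collect_eq subset_iff)
      then have "m \<in> leads wt H" using Suc.prems(1) by (auto simp: leads_def)
      note fm = f[OF this]
      define c where "c = lookup p m / lookup (f m) m"
      define p' where "p' = p - cscale c (f m)"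
      have p'_H: "p' \<in> H"
        unfolding p'_def using Suc.prems(1) fm H(1) by (intro cvec.subspace_diff cvec.subspace_scale) auto
      have "lookup (f m) m \<noteq> 0"
        using fm by (auto simp: is_lead_def in_keys_iff)
      then have p'_m: "lookup p' m = 0"
        by (simp add: p'_def c_def lookup_minus)
      have "wt k < w" if k: "k \<in> keys p'" for k
      proof -
        have "k \<noteq> m" using k p'_m by (auto simp: in_keys_iff)
        have "k \<in> S" using k p'_H H(2) by auto
        have "k \<in> keys p \<or> k \<in> keys (f m)"
          using k by (auto simp: p'_def in_keys_iff lookup_minus)
        then have "wt k < Suc w"
          using Suc.prems(2) fm m(2) \<open>k \<noteq> m\<close> by (auto simp: is_lead_def)
        then show ?thesis
          using unique \<open>k \<noteq> m\<close> \<open>k \<in> S\<close> by (metis less_Suc_eq)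
      qed
      then have "p' \<in> cvec.span (f ` leads wt H)"
        using Suc.IH p'_H by blast
      moreover have "cscale c (f m) \<in> cvec.span (f ` leads wt H)"
        using \<open>m \<in> leads wt H\<close> by (intro cvec.span_scale cvec.span_base) auto
      ultimately have "p' + cscale c (f m) \<in> cvec.span (f ` leads wt H)"
        by (rule cvec.span_add)
      then show ?thesis by (simp add: p'_def)
    qed
  qed
  moreover have "\<exists>w. \<forall>k\<in>keys p. wt k < w" for p
    using finite_nat_set_iff_bounded[of "wt ` keys p"] by auto
  ultimately show ?thesis by blast
qed

lemma ex_is_lead_family:
  obtains f where "\<And>m. m \<in> leads wt H \<Longrightarrow> f m \<in> H \<and> is_lead wt (f m) m"
proof -
  have "\<forall>m. \<exists>p. m \<in> leads wt H \<longrightarrow> p \<in> H \<and> is_lead wt p m"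
    by (auto simp: leads_def)
  then show ?thesis using that by metis
qed

text \<open>With finitely many leading elements this makes their number a strictly monotone measure
  of subspaces, on which the arguments by minimality and induction over submodules rest.\<close>

lemma eq_if_leads_eq:
  assumes "inj_on wt S" "cvec.subspace H" "H \<subseteq> H'" "cvec.subspace H'" "H' \<subseteq> {p. keys p \<subseteq> S}"
    and "leads wt H = leads wt H'"
  shows "H = H'"
proof -
  obtain f where f: "\<And>m. m \<in> leads wt H \<Longrightarrow> f m \<in> H \<and> is_lead wt (f m) m"
    using ex_is_lead_family by blast
  have "H' \<subseteq> cvec.span (f ` leads wt H')"
    using assms f by (intro subset_span_leads) auto
  also have "\<dots> \<subseteq> H"
    using f assms(6) by (intro cvec.span_minimal assms(2)) auto
  finally show ?thesis using assms(3) by blast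
qed

text \<open>The vectors \<open>f m\<close> are in echelon form: in a vanishing combination the
  heaviest \<open>m\<close> with nonzero coefficient would occur in no other term with nonzero
  coefficient.\<close>

lemma dim_eq_card_leads:
  assumes S: "finite S" "inj_on wt S" and H: "cvec.subspace H" "H \<subseteq> {p. keys p \<subseteq> S}"
  shows "cvec.dim H = card (leads wt H)"
proof -
  obtain f where f: "\<And>m. m \<in> leads wt H \<Longrightarrow> f m \<in> H \<and> is_lead wt (f m) m"
    using ex_is_lead_family by blast
  have fin: "finite (leads wt H)"
    using leads_subset[OF H(2)] S(1) finite_subset by blast
  have "inj_on f (leads wt H)"
  proof (rule inj_onI)
    fix x y assume xy: "x \<in> leads wt H" "y \<in> leads wt H" "f x = f y"
    then show "x = y"
      using f[OF xy(1)] f[OF xy(2)] unfolding is_lead_def by (metis less_asym)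
  qed
  then have card: "card (f ` leads wt H) = card (leads wt H)"
    by (rule card_image)
  have zero: "c x = 0" if sum: "(\<Sum>m\<in>leads wt H. cscale (c m) (f m)) = 0" and x: "x \<in> leads wt H" for c x
  proof (rule ccontr)
    assume "c x \<noteq> 0"
    define Z where "Z = {m \<in> leads wt H. c m \<noteq> 0}"
    have Z: "finite Z" "Z \<noteq> {}"
      using fin x \<open>c x \<noteq> 0\<close> by (auto simp: Z_def)
    obtain m where m: "m \<in> Z" "\<And>k. k \<in> Z \<Longrightarrow> wt k \<le> wt m"
    proof -
      have "Max (wt ` Z) \<in> wt ` Z" using Z by (intro Max_in) auto
      then obtain m where "m \<in> Z" "wt m = Max (wt ` Z)" by auto
      then show ?thesis using that[of m] Z(1) by simp
    qed
    have off: "c k * lookup (f k) m = 0" if "k \<in> leads wt H" "k \<noteq> m" for k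
    proof (cases "c k = 0")
      case False
      then have "wt k \<le> wt m" using m(2) that by (auto simp: Z_def)
      then have "m \<notin> keys (f k)"
        using f[OF that(1)] that(2) unfolding is_lead_def by (metis not_le)
      then show ?thesis by (simp add: in_keys_iff)
    qed simp
    have "0 = (\<Sum>k\<in>leads wt H. c k * lookup (f k) m)"
      using arg_cong[OF sum, of "\<lambda>p. lookup p m"] by (simp add: lookup_sum)
    also have "\<dots> = (\<Sum>k\<in>leads wt H. if k = m then c m * lookup (f m) m else 0)"
      by (rule sum.cong) (use off in auto)
    also have "\<dots> = c m * lookup (f m) m"
      using m(1) fin by (simp add: Z_def)
    finally show False
      using m(1) f[of m] by (auto simp: Z_def is_lead_def in_keys_iff)
  qed
  have "cvec.independent (f ` leads wt H)"
  proof (rule cvec.independent_if_scalars_zero)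
    fix c x assume "(\<Sum>v\<in>f ` leads wt H. cscale (c v) v) = 0" "x \<in> f ` leads wt H"
    then show "c x = 0"
      using zero[of "\<lambda>m. c (f m)"] \<open>inj_on f _\<close> by (auto simp: sum.reindex)
  qed (simp add: fin)
  moreover have "f ` leads wt H \<subseteq> H" using f by blast
  moreover have "H \<subseteq> cvec.span (f ` leads wt H)"
    by (rule subset_span_leads[OF S(2) H f])
  ultimately show ?thesis
    using card by (intro cvec.dim_unique)
qed

section \<open>The invariant inner product\<close>

text \<open>The Fischer inner product, for which multiplication by \<open>x\<close> is adjoint to \<open>\<partial>/\<partial>x\<close>.\<close>

definition mono_fact :: "('x \<Rightarrow>\<^sub>0 nat) \<Rightarrow> nat" where
  "mono_fact m = (\<Prod>x\<in>keys m. fact (lookup m x))"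

text \<open>Hermitian rather than bilinear, so that \<open>fischer p p\<close> vanishes only for
  \<open>p = 0\<close>.\<close>

definition fischer :: "'x cpoly \<Rightarrow> 'x cpoly \<Rightarrow> complex" where
  "fischer p q = (\<Sum>m\<in>keys p. of_nat (mono_fact m) * (lookup p m * cnj (lookup q m)))"

lemma mono_fact_superset:
  assumes "finite X" "keys m \<subseteq> X"
  shows "mono_fact m = (\<Prod>x\<in>X. fact (lookup m x))"
  unfolding mono_fact_def using assms
  by (intro prod.mono_neutral_left) (auto simp: in_keys_iff)

lemma mono_fact_add_expo: "mono_fact (m + expo x) = (lookup m x + 1) * mono_fact m"
proof -
  define X where "X = insert x (keys m)"
  have X: "finite X" "keys m \<subseteq> X" "keys (m + expo x) \<subseteq> X" "x \<in> X"
    using keys_add_subset[of m "expo x"] by (auto simp: X_def)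
  have "mono_fact (m + expo x) = (\<Prod>y\<in>X. (if y = x then lookup m x + 1 else 1) * fact (lookup m y))"
    unfolding mono_fact_superset[OF X(1,3)]
    by (rule prod.cong) (auto simp: lookup_add lookup_single when_def simp flip: Suc_eq_plus1)
  also have "\<dots> = (lookup m x + 1) * mono_fact m"
    using X by (simp add: prod.distrib mono_fact_superset[OF X(1,2)])
  finally show ?thesis .
qed

lemma mono_fact_pos: "0 < mono_fact m"
  by (simp add: mono_fact_def prod_pos)

lemma fischer_superset:
  assumes "finite A" "keys p \<subseteq> A"
  shows "fischer p q = (\<Sum>m\<in>A. of_nat (mono_fact m) * (lookup p m * cnj (lookup q m)))"
  unfolding fischer_def using assms
  by (intro sum.mono_neutral_left) (auto simp: in_keys_iff)

lemma fischer_add_left: "fischer (p + p') q = fischer p q + fischer p' q"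
proof -
  define A where "A = keys p \<union> keys p'"
  have A: "finite A" "keys p \<subseteq> A" "keys p' \<subseteq> A" "keys (p + p') \<subseteq> A"
    using keys_add_subset[of p p'] by (auto simp: A_def)
  show ?thesis
    unfolding A(2-)[THEN fischer_superset[OF A(1)]]
    by (simp add: lookup_add algebra_simps sum.distrib)
qed

lemma fischer_cscale_left: "fischer (cscale c p) q = c * fischer p q"
  unfolding fischer_superset[OF finite_keys keys_cscale_subset[of c p]]
  by (simp add: fischer_def sum_distrib_left ac_simps)

lemma fischer_commute: "fischer q p = cnj (fischer p q)"
proof -
  define A where "A = keys p \<union> keys q"
  have A: "finite A" "keys p \<subseteq> A" "keys q \<subseteq> A" by (auto simp: A_def)
  show ?thesis
    unfolding A(2-)[THEN fischer_superset[OF A(1)]] by (simp add: ac_simps)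
qed

lemma fischer_zero_left [simp]: "fischer 0 q = 0"
  by (simp add: fischer_def)

lemma fischer_zero_right [simp]: "fischer p 0 = 0"
  by (simp add: fischer_def)

lemma fischer_add_right: "fischer p (q + q') = fischer p q + fischer p q'"
  using fischer_add_left[of q q' p] by (metis fischer_commute complex_cnj_add)

lemma fischer_cscale_right: "fischer p (cscale c q) = cnj c * fischer p q"
  by (metis fischer_commute complex_cnj_mult fischer_cscale_left)

lemma fischer_diff_left: "fischer (p - p') q = fischer p q - fischer p' q"
  using fischer_add_left[of "p - p'" p' q] by simp

lemma fischer_sum_left: "fischer (\<Sum>x\<in>A. f x) q = (\<Sum>x\<in>A. fischer (f x) q)"
  by (induction A rule: infinite_finite_induct) (auto simp: fischer_add_left)

lemma fischer_sum_right: "fischer p (\<Sum>x\<in>A. f x) = (\<Sum>x\<in>A. fischer p (f x))"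
  by (induction A rule: infinite_finite_induct) (auto simp: fischer_add_right)

text \<open>The value is handed over as a real number \<open>r\<close>, so that positivity of norms
  can be exploited by real inequalities.\<close>

lemma fischer_self:
  obtains r :: real where "fischer p p = of_real r" "0 \<le> r" "r = 0 \<longleftrightarrow> p = 0"
proof -
  define r where "r = (\<Sum>m\<in>keys p. real (mono_fact m) * (cmod (lookup p m))\<^sup>2)"
  have 1: "fischer p p = of_real r"
    unfolding fischer_def r_def of_real_sum
    by (rule sum.cong) (simp_all add: complex_norm_square[symmetric])
  have 2: "0 \<le> r"
    unfolding r_def by (intro sum_nonneg) simp
  have 3: "p = 0" if "r = 0"
  proof -
    have "\<forall>m\<in>keys p. real (mono_fact m) * (cmod (lookup p m))\<^sup>2 = 0"
      using that unfolding r_def by (subst (asm) sum_nonneg_eq_0_iff) auto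
    moreover have "mono_fact m \<noteq> 0" for m :: "'a \<Rightarrow>\<^sub>0 nat"
      using mono_fact_pos[of m] by simp
    ultimately show ?thesis
      by (intro poly_mapping_eqI) (auto simp: in_keys_iff)
  qed
  have "r = 0" if "p = 0"
    using that by (simp add: r_def)
  with 1 2 3 show ?thesis by (intro that[of r]) blast+
qed

lemma fischer_self_eq_0_iff: "fischer p p = 0 \<longleftrightarrow> p = 0"
  by (rule fischer_self[of p]) auto

text \<open>On monomials \<open>mono_fact (m + expo x)\<close> supplies exactly the factor that
  \<open>pdiff\<close> produces.\<close>

lemma fischer_pvar_times: "fischer (pvar x * p) q = fischer p (pdiff x q)"
proof (induction p rule: poly_induct_single)
  case (single m c)
  show ?case
    by (cases "c = 0")
      (auto simp: pvar_def mult_single fischer_def lookup_pdiff add.commute[of _ m] mono_fact_add_expo)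
next
  case (add p p')
  then show ?case by (simp add: distrib_left fischer_add_left)
qed

text \<open>Raising operators are adjoint to lowering ones. Hence orthogonal complements of
  submodules are submodules, and squared norms along a string of lowering operators can be
  computed.\<close>

lemma fischer_mat_act: "fischer (mat_act n i j p) q = fischer p (mat_act n j i q)"
proof -
  have "fischer (pdiff x p) q = fischer p (pvar x * q)" for x and p q :: "(nat \<times> nat) cpoly"
    by (metis fischer_commute fischer_pvar_times)
  then show ?thesis
    by (simp add: mat_act_def fischer_sum_left fischer_sum_right fischer_pvar_times)
qed

text \<open>Gram-Schmidt: \<open>w\<close> is the part of the new vector \<open>b\<close> orthogonal
  to the old span, and \<open>c\<close> is the coefficient of \<open>v - u\<close> along it.\<close>

lemma ex_orthogonal_projection:
  assumes "finite B"
  shows "\<exists>u\<in>cvec.span B. \<forall>b\<in>cvec.span B. fischer (v - u) b = 0"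
  using assms
proof (induction B arbitrary: v)
  case empty
  show ?case by simp
next
  case (insert b B)
  obtain u where u: "u \<in> cvec.span B" "\<forall>x\<in>cvec.span B. fischer (v - u) x = 0"
    using insert.IH by blast
  obtain u' where u': "u' \<in> cvec.span B" "\<forall>x\<in>cvec.span B. fischer (b - u') x = 0"
    using insert.IH by blast
  define w where "w = b - u'"
  define c where "c = fischer (v - u) w / fischer w w"
  have sub: "x \<in> cvec.span (insert b B)" if "x \<in> cvec.span B" for x
    using that cvec.span_mono[of B "insert b B"] by blast
  have w_span: "w \<in> cvec.span (insert b B)"
    unfolding w_def using sub u' by (intro cvec.span_diff) (auto intro: cvec.span_base)
  show ?case
  proof (intro bexI ballI)
    show "u + cscale c w \<in> cvec.span (insert b B)"
      using u w_span sub by (intro cvec.span_add cvec.span_scale) auto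
    fix x assume "x \<in> cvec.span (insert b B)"
    then obtain k where k: "x - cscale k b \<in> cvec.span B"
      by (auto simp: cvec.span_insert)
    define y where "y = x - cscale k b + cscale k u'"
    have y: "y \<in> cvec.span B"
      unfolding y_def using k u' by (intro cvec.span_add cvec.span_scale) auto
    have x: "x = y + cscale k w"
      by (simp add: y_def w_def cvec.scale_right_diff_distrib)
    have "fischer w y = 0"
      using u' y by (simp add: w_def)
    \<comment> \<open>If \<open>w = 0\<close> the division in \<open>c\<close> yields 0, and both
      pairings with \<open>w\<close> vanish.\<close>
    moreover have "fischer (v - u) w - c * fischer w w = 0"
      by (cases "fischer w w = 0") (auto simp: c_def fischer_self_eq_0_iff)
    ultimately have "fischer (v - u - cscale c w) x = 0"
      using u(2) y
      by (simp add: x fischer_add_right fischer_cscale_right fischer_diff_left fischer_cscale_left)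
    then show "fischer (v - (u + cscale c w)) x = 0"
      by (simp add: diff_diff_eq)
  qed
qed

section \<open>Irreducible decompositions\<close>

lemma gl_submodule_iff:
  "gl_submodule n (mat_act n) V U \<longleftrightarrow>
    U \<subseteq> V \<and> cvec.subspace U \<and> (\<forall>i<n. \<forall>j<n. \<forall>v\<in>U. mat_act n i j v \<in> U)"
  by (simp add: gl_submodule_def gl_module_mat_act_iff)

text \<open>The difference of two decompositions of a vector is a decomposition of 0, so uniqueness
  is checked only there. \<open>restrict\<close> provides the canonical function required by the
  extensional product.\<close>

lemma irreducible_decompositionI:
  assumes "finite D" "\<And>U. U \<in> D \<Longrightarrow> gl_submodule n E V U \<and> gl_irreducible n E U"
    and sub: "\<And>U. U \<in> D \<Longrightarrow> cvec.subspace U"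
    and span: "\<And>v. v \<in> V \<Longrightarrow> \<exists>g. (\<forall>U\<in>D. g U \<in> U) \<and> v = (\<Sum>U\<in>D. g U)"
    and direct: "\<And>g U. \<forall>U\<in>D. g U \<in> U \<Longrightarrow> (\<Sum>U\<in>D. g U) = 0 \<Longrightarrow> U \<in> D \<Longrightarrow> g U = 0"
  shows "irreducible_decomposition n E V D"
  unfolding irreducible_decomposition_def
proof (intro conjI ballI)
  fix v assume "v \<in> V"
  then obtain g where g: "\<forall>U\<in>D. g U \<in> U" "v = (\<Sum>U\<in>D. g U)"
    using span by blast
  show "\<exists>!g. g \<in> (\<Pi>\<^sub>E U\<in>D. U) \<and> v = (\<Sum>U\<in>D. g U)"
  proof (rule ex1I[of _ "restrict g D"])
    show "restrict g D \<in> (\<Pi>\<^sub>E U\<in>D. U) \<and> v = (\<Sum>U\<in>D. restrict g D U)"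
      using g by auto
    fix h assume h: "h \<in> (\<Pi>\<^sub>E U\<in>D. U) \<and> v = (\<Sum>U\<in>D. h U)"
    have "h U - g U = 0" if "U \<in> D" for U
    proof (rule direct[OF _ _ that])
      show "\<forall>U\<in>D. h U - g U \<in> U"
        using h g by (auto intro!: cvec.subspace_diff sub)
      show "(\<Sum>U\<in>D. h U - g U) = 0"
        using h g by (simp add: sum_subtractf)
    qed
    then show "h = restrict g D"
      using h by (intro ext) (auto simp: PiE_def extensional_def)
  qed
qed (use assms in auto)

lemma irreducible_decompositionD:
  assumes D: "irreducible_decomposition n E V D"
  shows "finite D" "\<And>U. U \<in> D \<Longrightarrow> gl_submodule n E V U" "\<And>U. U \<in> D \<Longrightarrow> gl_irreducible n E U"
    and "v \<in> V \<Longrightarrow> \<exists>g. (\<forall>U\<in>D. g U \<in> U) \<and> v = (\<Sum>U\<in>D. g U)"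
    and "0 \<in> V \<Longrightarrow> \<forall>U\<in>D. g U \<in> U \<Longrightarrow> (\<Sum>U\<in>D. g U) = 0 \<Longrightarrow> U \<in> D \<Longrightarrow> g U = 0"
proof -
  show "finite D" "\<And>U. U \<in> D \<Longrightarrow> gl_submodule n E V U" "\<And>U. U \<in> D \<Longrightarrow> gl_irreducible n E U"
    using D unfolding irreducible_decomposition_def by blast+
  show "\<exists>g. (\<forall>U\<in>D. g U \<in> U) \<and> v = (\<Sum>U\<in>D. g U)" if v: "v \<in> V"
    using D v unfolding irreducible_decomposition_def by (meson PiE_mem)
  assume V: "0 \<in> V" and g: "\<forall>U\<in>D. g U \<in> U" "(\<Sum>U\<in>D. g U) = 0" and U: "U \<in> D"
  have "\<exists>!h. h \<in> (\<Pi>\<^sub>E U\<in>D. U) \<and> 0 = (\<Sum>U\<in>D. h U)"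
    using D V unfolding irreducible_decomposition_def by blast
  moreover have "restrict g D \<in> (\<Pi>\<^sub>E U\<in>D. U) \<and> 0 = (\<Sum>U\<in>D. restrict g D U)"
    using g by auto
  moreover have "0 \<in> U" if "U \<in> D" for U
    using D that unfolding irreducible_decomposition_def gl_submodule_def gl_module_def
    by (meson cvec.subspace_0)
  then have "restrict (\<lambda>U. 0) D \<in> (\<Pi>\<^sub>E U\<in>D. U) \<and> 0 = (\<Sum>U\<in>D. restrict (\<lambda>U. 0) D U)"
    by auto
  ultimately have "restrict g D = restrict (\<lambda>U. 0) D"
    by blast
  then show "g U = 0"
    using U by (metis restrict_apply')
qed

text \<open>Among the nonzero submodules one with the fewest leading elements is minimal: a nonzero
  submodule of it has the same leading elements and hence equals it. Any injective weight serves
  here.\<close>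

lemma ex_irreducible_submodule:
  assumes S: "finite S" and V: "gl_module n (mat_act n) V" "V \<subseteq> {p. keys p \<subseteq> S}" "V \<noteq> {0}"
  shows "\<exists>U. gl_submodule n (mat_act n) V U \<and> gl_irreducible n (mat_act n) U"
proof -
  obtain wt :: "(nat \<times> nat \<Rightarrow>\<^sub>0 nat) \<Rightarrow> nat" where wt: "inj_on wt S"
    using finite_imp_inj_to_nat_seg[OF S] by blast
  define P where "P U \<longleftrightarrow> gl_submodule n (mat_act n) V U \<and> U \<noteq> {0}" for U
  have "P V" using V by (simp add: P_def gl_submodule_def)
  then obtain U where U: "P U" "\<And>U'. P U' \<Longrightarrow> card (leads wt U) \<le> card (leads wt U')"
    using ex_has_least_nat[of P V "\<lambda>U. card (leads wt U)"] by blast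
  have "U' = {0} \<or> U' = U" if U': "gl_submodule n (mat_act n) U U'" for U'
  proof (cases "U' = {0}")
    case False
    have "U' \<subseteq> U" using U' by (simp add: gl_submodule_def)
    have "P U'" using U' U(1) False by (auto simp: P_def gl_submodule_iff)
    have US: "U \<subseteq> {p. keys p \<subseteq> S}"
      using U(1) V(2) by (auto simp: P_def gl_submodule_def)
    then have "finite (leads wt U)"
      using leads_subset S finite_subset by metis
    then have "leads wt U' = leads wt U"
      using leads_mono[OF \<open>U' \<subseteq> U\<close>] U(2)[OF \<open>P U'\<close>] by (simp add: card_seteq)
    then show ?thesis
      using eq_if_leads_eq[OF wt _ \<open>U' \<subseteq> U\<close> _ US] U(1) U' by (simp add: P_def gl_submodule_iff)
  qed simp
  then have "gl_irreducible n (mat_act n) U"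
    using U(1) by (simp add: gl_irreducible_def P_def gl_submodule_def)
  then show ?thesis using U(1) by (auto simp: P_def)
qed

text \<open>Complete reducibility by the unitary argument: the orthogonal complement of an
  irreducible submodule is stable because the adjoint of \<open>E i j\<close> is
  \<open>E j i\<close>, and it has fewer leading elements.\<close>

lemma ex_irreducible_decomposition:
  assumes S: "finite S" and "gl_module n (mat_act n) V" "V \<subseteq> {p. keys p \<subseteq> S}"
  shows "\<exists>D. irreducible_decomposition n (mat_act n) V D"
proof -
  obtain wt :: "(nat \<times> nat \<Rightarrow>\<^sub>0 nat) \<Rightarrow> nat" where wt: "inj_on wt S"
    using finite_imp_inj_to_nat_seg[OF S] by blast
  show ?thesis
    using assms(2,3)
  proof (induction "card (leads wt V)" arbitrary: V rule: less_induct)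
    case less
    note V = less.prems
    have V_space: "cvec.subspace V"
      using V(1) by (simp add: gl_module_mat_act_iff)
    show ?case
    proof (cases "V = {0}")
      case True
      have "irreducible_decomposition n (mat_act n) V {}"
        by (rule irreducible_decompositionI) (auto simp: True)
      then show ?thesis by blast
    next
      case False
      obtain U where U: "gl_submodule n (mat_act n) V U" "gl_irreducible n (mat_act n) U"
        using ex_irreducible_submodule[OF S V False] by blast
      have UV: "U \<subseteq> V" "cvec.subspace U" "\<And>i j v. i < n \<Longrightarrow> j < n \<Longrightarrow> v \<in> U \<Longrightarrow> mat_act n i j v \<in> U"
        using U(1) by (auto simp: gl_submodule_iff)
      define W where "W = {v \<in> V. \<forall>u\<in>U. fischer v u = 0}"
      have W_space: "cvec.subspace W"
        using V_space unfolding cvec.subspace_def W_def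
        by (simp add: fischer_add_left fischer_cscale_left)
      have W: "gl_module n (mat_act n) W"
        using W_space V(1) UV(3) by (auto simp: gl_module_mat_act_iff W_def fischer_mat_act)
      have WV: "W \<subseteq> V" by (auto simp: W_def)
      have UW: "u = 0" if "u \<in> U" "u \<in> W" for u
        using that fischer_self_eq_0_iff by (auto simp: W_def)
      have "U \<noteq> {0}" using U(2) by (simp add: gl_irreducible_def)
      then obtain u where "u \<in> U" "u \<noteq> 0"
        using cvec.subspace_0[OF UV(2)] by blast
      then have "W \<noteq> V" using UW UV(1) by blast
      have fin: "finite (leads wt V)"
        using leads_subset[OF V(2)] S finite_subset by metis
      have "leads wt W \<noteq> leads wt V"
        using eq_if_leads_eq[OF wt W_space WV V_space V(2)] \<open>W \<noteq> V\<close> by blast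
      then have "card (leads wt W) < card (leads wt V)"
        using fin leads_mono[OF WV] by (intro psubset_card_mono) auto
      then obtain D where D: "irreducible_decomposition n (mat_act n) W D"
        using less.hyps[OF _ W] WV V(2) by blast
      note D' = irreducible_decompositionD[OF D]
      \<comment> \<open>Otherwise \<open>U\<close> would lie in \<open>W\<close>, although the two
        meet only in 0. The sums over \<open>insert U D\<close> below rely on this.\<close>
      have "U \<notin> D"
        using D'(2)[of U] UW \<open>u \<in> U\<close> \<open>u \<noteq> 0\<close> by (auto simp: gl_submodule_def)
      have W_sum: "(\<Sum>X\<in>D. g X) \<in> W" if "\<forall>X\<in>D. g X \<in> X" for g
        using D'(2) that by (intro cvec.subspace_sum W_space) (auto simp: gl_submodule_def)
      have "irreducible_decomposition n (mat_act n) V (insert U D)"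
      proof (rule irreducible_decompositionI)
        show "finite (insert U D)" using D'(1) by simp
        fix X assume "X \<in> insert U D"
        then show "gl_submodule n (mat_act n) V X \<and> gl_irreducible n (mat_act n) X"
          using U D'(2,3) WV by (auto simp: gl_submodule_def)
        then show "cvec.subspace X" by (simp add: gl_submodule_iff)
      next
        fix v assume "v \<in> V"
        have "finite (leads wt U)"
          using leads_mono[OF UV(1)] fin finite_subset by blast
        obtain f where f: "\<And>m. m \<in> leads wt U \<Longrightarrow> f m \<in> U \<and> is_lead wt (f m) m"
          using ex_is_lead_family by blast
        have span_U: "cvec.span (f ` leads wt U) = U"
        proof
          show "cvec.span (f ` leads wt U) \<subseteq> U"
            by (rule cvec.span_minimal[OF _ UV(2)]) (use f in blast)
          show "U \<subseteq> cvec.span (f ` leads wt U)"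
            using UV V(2) by (intro subset_span_leads[OF wt] f) auto
        qed
        obtain x where x: "x \<in> U" "\<forall>b\<in>U. fischer (v - x) b = 0"
          using ex_orthogonal_projection[of "f ` leads wt U" v] \<open>finite (leads wt U)\<close> span_U by auto
        then have "v - x \<in> W"
          using \<open>v \<in> V\<close> UV(1) V_space by (auto simp: W_def intro: cvec.subspace_diff)
        then obtain g where g: "\<forall>X\<in>D. g X \<in> X" "v - x = (\<Sum>X\<in>D. g X)"
          using D'(4) by blast
        have "(\<Sum>X\<in>D. (g(U := x)) X) = (\<Sum>X\<in>D. g X)"
          using \<open>U \<notin> D\<close> by (intro sum.cong) auto
        then have "v = (\<Sum>X\<in>insert U D. (g(U := x)) X)"
          using \<open>U \<notin> D\<close> D'(1) g(2) by (simp add: algebra_simps)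
        then show "\<exists>g. (\<forall>X\<in>insert U D. g X \<in> X) \<and> v = (\<Sum>X\<in>insert U D. g X)"
          using g(1) x(1) by (intro exI[of _ "g(U := x)"]) auto
      next
        fix g X assume g: "\<forall>X\<in>insert U D. g X \<in> X" "(\<Sum>X\<in>insert U D. g X) = 0" "X \<in> insert U D"
        have "g U = - (\<Sum>X\<in>D. g X)"
          using g(2) \<open>U \<notin> D\<close> D'(1) by (simp add: eq_neg_iff_add_eq_0)
        then have "g U \<in> W"
          using W_sum[of g] g(1) W_space cvec.subspace_neg by auto
        then have "g U = 0" using UW g(1) by blast
        then show "g X = 0"
          using g D'(5)[OF cvec.subspace_0[OF W_space], of g X] \<open>U \<notin> D\<close> D'(1) by auto
      qed
      then show ?thesis by blast
    qed
  qed
qed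

section \<open>Highest weight vectors\<close>

text \<open>0 is included, so that this is a subspace whose dimension counts highest weight
  vectors.\<close>

definition hw_space :: "nat \<Rightarrow> nat list \<Rightarrow> (nat \<times> nat) cpoly set \<Rightarrow> (nat \<times> nat) cpoly set" where
  "hw_space n lam V = {v \<in> V. (\<forall>i<n. \<forall>j<n. i < j \<longrightarrow> mat_act n i j v = 0) \<and>
     (\<forall>i<n. mat_act n i i v = cscale (of_nat (part lam i)) v)}"

lemma subspace_hw_space: "cvec.subspace V \<Longrightarrow> cvec.subspace (hw_space n lam V)"
  unfolding hw_space_def cvec.subspace_def
  by (simp add: mat_act_add mat_act_cscale cvec.scale_right_distrib)

text \<open>Every nonzero vector of an irreducible module generates it, so the generation condition
  holds automatically.\<close>

lemma irreducible_highest_weight_module_iff: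
  assumes "gl_irreducible n (mat_act n) U"
  shows "irreducible_highest_weight_module n (mat_act n) lam U \<longleftrightarrow> hw_space n lam U \<noteq> {0}"
proof -
  have U: "gl_module n (mat_act n) U" "cvec.subspace U"
    using assms by (simp_all add: gl_irreducible_def gl_module_mat_act_iff)
  have "gl_cyclic n (mat_act n) U v = U" if v: "v \<in> U" "v \<noteq> 0" for v
  proof -
    define C where "C = gl_cyclic n (mat_act n) U v"
    have "v \<in> C" by (auto simp: C_def gl_cyclic_def)
    moreover have "C \<subseteq> U"
      unfolding C_def gl_cyclic_def
      by (rule Inter_lower) (simp add: gl_submodule_def U v)
    moreover have "gl_module n (mat_act n) C"
      unfolding C_def gl_cyclic_def by (rule gl_module_Inter) (auto simp: gl_submodule_def)
    ultimately show ?thesis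
      using assms v(2) unfolding gl_irreducible_def gl_submodule_def C_def[symmetric] by blast
  qed
  moreover have "0 \<in> hw_space n lam U"
    using subspace_hw_space[OF U(2)] by (rule cvec.subspace_0)
  then have "hw_space n lam U \<noteq> {0} \<longleftrightarrow> (\<exists>v\<in>U. highest_weight_vector n (mat_act n) lam v)"
    unfolding hw_space_def highest_weight_vector_def by blast
  moreover have "v \<noteq> 0" if "highest_weight_vector n (mat_act n) lam v" for v
    using that by (simp add: highest_weight_vector_def)
  ultimately show ?thesis
    using assms unfolding irreducible_highest_weight_module_def by blast
qed

text \<open>
  The smallest subspace that contains a highest weight vector \<open>v\<close> and is stable under the lowering
  operators is a submodule.  A highest weight vector orthogonal to \<open>v\<close> is orthogonal to all of it,
  because lowering operators are adjoint to raising operators.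
\<close>

lemma hw_vector_unique:
  assumes irr: "gl_irreducible n (mat_act n) U"
    and v: "v \<in> hw_space n lam U" "v \<noteq> 0" and w: "w \<in> hw_space n lam U"
  shows "\<exists>c. w = cscale c v"
proof -
  have U: "cvec.subspace U" "\<And>i j x. i < n \<Longrightarrow> j < n \<Longrightarrow> x \<in> U \<Longrightarrow> mat_act n i j x \<in> U"
    using irr by (auto simp: gl_irreducible_def gl_module_mat_act_iff)
  define Q where "Q X \<longleftrightarrow> cvec.subspace X \<and> v \<in> X \<and>
    (\<forall>a<n. \<forall>b<n. b < a \<longrightarrow> (\<forall>x\<in>X. mat_act n a b x \<in> X))" for X
  define N where "N = \<Inter> {X. Q X}"
  have QN: "Q N"
    unfolding Q_def
  proof (intro conjI allI impI ballI)
    show "cvec.subspace N"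
      unfolding N_def cvec.subspace_def by (auto simp: Q_def cvec.subspace_0 cvec.subspace_add cvec.subspace_scale)
    show "v \<in> N" by (simp add: N_def Q_def)
    show "mat_act n a b x \<in> N" if "a < n" "b < n" "b < a" "x \<in> N" for a b x
      using that by (simp add: N_def Q_def)
  qed
  have N_least: "N \<subseteq> X" if "Q X" for X
    using that by (auto simp: N_def)
  have N_space: "cvec.subspace N" and vN: "v \<in> N" using QN by (auto simp: Q_def)
  have lower: "mat_act n a b x \<in> N" if "a < n" "b < a" "x \<in> N" for a b x
    using QN that unfolding Q_def by (meson less_trans)
  \<comment> \<open>Stability of \<open>N\<close> under all operators is shown by minimality: the
    vectors of \<open>N\<close> that all \<open>E i j\<close> keep in \<open>N\<close> again satisfy
    \<open>Q\<close>.\<close>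
  define X where "X = {x \<in> N. \<forall>i<n. \<forall>j<n. mat_act n i j x \<in> N}"
  have "Q X"
    unfolding Q_def
  proof (intro conjI allI impI ballI)
    show "cvec.subspace X"
      using N_space unfolding X_def cvec.subspace_def by (simp add: mat_act_add mat_act_cscale)
    have "mat_act n i j v \<in> N" if "i < n" "j < n" for i j
    proof (cases i j rule: linorder_cases)
      case less
      then show ?thesis using v that N_space cvec.subspace_0 by (auto simp: hw_space_def)
    next
      case equal
      then show ?thesis using v that N_space vN by (auto simp: hw_space_def intro: cvec.subspace_scale)
    next
      case greater
      then show ?thesis using lower vN that by blast
    qed
    then show "v \<in> X" using vN by (simp add: X_def)
    fix a b x assume ab: "a < n" "b < n" "b < a" and x: "x \<in> X"
    have "mat_act n i j (mat_act n a b x) \<in> N" if "i < n" "j < n" for i j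
    proof -
      \<comment> \<open>Commuting \<open>E i j\<close> past the lowering operator leaves correction
        terms \<open>E i b x\<close> and \<open>E a j x\<close>, which lie in \<open>N\<close> since
        \<open>x\<close> is in \<open>X\<close>.\<close>
      have "mat_act n i j (mat_act n a b x) = mat_act n a b (mat_act n i j x) +
          ((if j = a then mat_act n i b x else 0) - (if b = i then mat_act n a j x else 0))"
        using mat_act_commutator[of n i j a b x] by (simp add: algebra_simps)
      moreover have "(if j = a then mat_act n i b x else 0) \<in> N" "(if b = i then mat_act n a j x else 0) \<in> N"
        "mat_act n a b (mat_act n i j x) \<in> N"
        using x that ab lower N_space cvec.subspace_0 by (auto simp: X_def)
      ultimately show ?thesis
        using N_space by (simp add: cvec.subspace_add cvec.subspace_diff)
    qed
    then show "mat_act n a b x \<in> X"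
      using x lower ab by (simp add: X_def)
  qed
  then have "N \<subseteq> X" by (rule N_least)
  moreover have "N \<subseteq> U"
    using v U by (intro N_least) (auto simp: Q_def hw_space_def)
  ultimately have "gl_submodule n (mat_act n) U N"
    using N_space by (auto simp: gl_submodule_iff X_def)
  then have "N = U"
    using irr vN v(2) unfolding gl_irreducible_def by blast
  \<comment> \<open>\<open>w'\<close> becomes the part of \<open>w\<close> orthogonal to
    \<open>v\<close>; it will turn out to be orthogonal to itself.\<close>
  define c where "c = fischer w v / fischer v v"
  define w' where "w' = w - cscale c v"
  have w': "w' \<in> hw_space n lam U"
    unfolding w'_def using v w U(1)
    by (intro cvec.subspace_diff cvec.subspace_scale subspace_hw_space) auto
  have "fischer w' v = 0"
    using v(2) by (simp add: w'_def fischer_diff_left fischer_cscale_left c_def fischer_self_eq_0_iff)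
  then have "fischer v w' = 0"
    using fischer_commute[of v w'] by simp
  \<comment> \<open>The adjoint of a lowering operator raises, and raising operators kill
    \<open>w'\<close>, so the orthogonal complement of \<open>w'\<close> is closed under lowering
    operators.\<close>
  then have "Q {x. fischer x w' = 0}"
    using w' unfolding Q_def cvec.subspace_def
    by (auto simp: fischer_add_left fischer_cscale_left fischer_mat_act hw_space_def)
  then have "N \<subseteq> {x. fischer x w' = 0}" by (rule N_least)
  then have "fischer w' w' = 0"
    using w' \<open>N = U\<close> by (auto simp: hw_space_def)
  then show ?thesis
    by (auto simp: fischer_self_eq_0_iff w'_def)
qed

text \<open>One highest weight vector from each summand that has one of weight \<open>lam\<close>
  gives a basis: by directness the components of a highest weight vector are highest weight vectors
  or 0, and each summand has at most one up to scalars.\<close>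

lemma card_irreducible_highest_weight_modules:
  assumes D: "irreducible_decomposition n (mat_act n) V D" and V: "cvec.subspace V"
  shows "card {U \<in> D. irreducible_highest_weight_module n (mat_act n) lam U} = cvec.dim (hw_space n lam V)"
proof -
  note D' = irreducible_decompositionD[OF D]
  have V0: "0 \<in> V" using V by (rule cvec.subspace_0)
  have D_sub: "U \<subseteq> V" "cvec.subspace U" "\<And>i j x. i < n \<Longrightarrow> j < n \<Longrightarrow> x \<in> U \<Longrightarrow> mat_act n i j x \<in> U"
    if "U \<in> D" for U
    using D'(2)[OF that] by (auto simp: gl_submodule_iff)
  define D\<^sub>1 where "D\<^sub>1 = {U \<in> D. irreducible_highest_weight_module n (mat_act n) lam U}"
  have D1: "finite D\<^sub>1" "D\<^sub>1 \<subseteq> D" using D'(1) by (auto simp: D\<^sub>1_def)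
  have D1_iff: "U \<in> D\<^sub>1 \<longleftrightarrow> hw_space n lam U \<noteq> {0}" if "U \<in> D" for U
    using that D'(3) irreducible_highest_weight_module_iff by (simp add: D\<^sub>1_def)
  have "\<exists>x. x \<in> hw_space n lam U \<and> x \<noteq> 0" if "U \<in> D\<^sub>1" for U
  proof -
    have "0 \<in> hw_space n lam U"
      using D_sub(2) that D1 by (intro cvec.subspace_0 subspace_hw_space) auto
    then show ?thesis using D1_iff that D1 by blast
  qed
  then obtain h where h: "\<And>U. U \<in> D\<^sub>1 \<Longrightarrow> h U \<in> hw_space n lam U" "\<And>U. U \<in> D\<^sub>1 \<Longrightarrow> h U \<noteq> 0"
    by metis
  have hU: "h U \<in> U" if "U \<in> D\<^sub>1" for U
    using h(1)[OF that] by (simp add: hw_space_def)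
  have zero: "c U = 0" if sum: "(\<Sum>U\<in>D\<^sub>1. cscale (c U) (h U)) = 0" and U: "U \<in> D\<^sub>1" for c U
  proof -
    define g where "g U = (if U \<in> D\<^sub>1 then cscale (c U) (h U) else 0)" for U
    have "(\<Sum>U\<in>D. g U) = (\<Sum>U\<in>D\<^sub>1. cscale (c U) (h U))"
      unfolding g_def using D1 D'(1) by (simp add: sum.If_cases Int_absorb1)
    moreover have "\<forall>U\<in>D. g U \<in> U"
      using hU D_sub(2) by (auto simp: g_def intro: cvec.subspace_0 cvec.subspace_scale)
    ultimately have "g U = 0"
      using D'(5)[OF V0, of g U] sum U D1 by auto
    then show ?thesis using U h(2) by (simp add: g_def)
  qed
  have inj: "inj_on h D\<^sub>1"
  proof (rule inj_onI, rule ccontr)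
    fix X Y assume XY: "X \<in> D\<^sub>1" "Y \<in> D\<^sub>1" "h X = h Y" "X \<noteq> Y"
    define c :: "(nat \<times> nat) cpoly set \<Rightarrow> complex" where "c U = (if U = X then 1 else if U = Y then - 1 else 0)" for U
    have "(\<Sum>U\<in>D\<^sub>1. cscale (c U) (h U)) = (\<Sum>U\<in>D\<^sub>1. (if U = X then h X else 0) - (if U = Y then h Y else 0))"
      by (rule sum.cong) (use XY in \<open>auto simp: c_def\<close>)
    also have "\<dots> = 0"
      using XY D1 by (simp add: sum_subtractf)
    finally show False
      using zero[of c X] XY by (simp add: c_def)
  qed
  have "cvec.dim (hw_space n lam V) = card (h ` D\<^sub>1)"
  proof (rule cvec.dim_unique)
    show "h ` D\<^sub>1 \<subseteq> hw_space n lam V"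
    proof
      fix x assume "x \<in> h ` D\<^sub>1"
      then obtain U where U: "U \<in> D\<^sub>1" "x = h U" by blast
      then have "x \<in> V" using hU D_sub(1) D1(2) by blast
      then show "x \<in> hw_space n lam V" using h(1) U by (simp add: hw_space_def)
    qed
    show "cvec.independent (h ` D\<^sub>1)"
    proof (rule cvec.independent_if_scalars_zero)
      fix c x assume "(\<Sum>v\<in>h ` D\<^sub>1. cscale (c v) v) = 0" "x \<in> h ` D\<^sub>1"
      then show "c x = 0"
        using zero[of "\<lambda>U. c (h U)"] inj by (auto simp: sum.reindex)
    qed (simp add: D1)
    show "hw_space n lam V \<subseteq> cvec.span (h ` D\<^sub>1)"
    proof
      fix v assume v: "v \<in> hw_space n lam V"
      then have "v \<in> V" by (simp add: hw_space_def)
      then obtain g where g: "\<forall>U\<in>D. g U \<in> U" "v = (\<Sum>U\<in>D. g U)"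
        using D'(4) by blast
      have g_hw: "g U \<in> hw_space n lam U" if "U \<in> D" for U
        unfolding hw_space_def
      proof (intro CollectI conjI allI impI)
        show "g U \<in> U" using g that by blast
        \<comment> \<open>Applying the operator to the sum of the \<open>g U\<close> decomposes 0
          inside the summands, so every component is annihilated.\<close>
        show "mat_act n i j (g U) = 0" if ij: "i < n" "j < n" "i < j" for i j
        proof (rule D'(5)[OF V0 _ _ \<open>U \<in> D\<close>])
          show "\<forall>U\<in>D. mat_act n i j (g U) \<in> U"
            using g(1) D_sub(3) ij by blast
          show "(\<Sum>U\<in>D. mat_act n i j (g U)) = 0"
            using v ij g(2) by (simp add: hw_space_def flip: mat_act_sum)
        qed
        show "mat_act n i i (g U) = cscale (of_nat (part lam i)) (g U)" if i: "i < n" for i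
        proof -
          have "mat_act n i i (g U) - cscale (of_nat (part lam i)) (g U) = 0"
          proof (rule D'(5)[OF V0 _ _ \<open>U \<in> D\<close>])
            show "\<forall>U\<in>D. mat_act n i i (g U) - cscale (of_nat (part lam i)) (g U) \<in> U"
              using g(1) D_sub(2,3) i by (auto intro!: cvec.subspace_diff cvec.subspace_scale)
            show "(\<Sum>U\<in>D. mat_act n i i (g U) - cscale (of_nat (part lam i)) (g U)) = 0"
              using v i g(2) by (simp add: hw_space_def sum_subtractf flip: mat_act_sum cscale_sum)
          qed
          then show ?thesis by simp
        qed
      qed
      have "g U \<in> cvec.span (h ` D\<^sub>1)" if U: "U \<in> D" for U
      proof (cases "U \<in> D\<^sub>1")
        case True
        then obtain c where "g U = cscale c (h U)"
          using hw_vector_unique[OF D'(3)[OF U] h(1) h(2) g_hw[OF U]] by blast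
        then show ?thesis
          using True by (auto intro: cvec.span_scale cvec.span_base)
      next
        case False
        then have "g U = 0" using D1_iff[OF U] g_hw[OF U] by blast
        then show ?thesis by (simp add: cvec.span_zero)
      qed
      then show "v \<in> cvec.span (h ` D\<^sub>1)"
        unfolding g(2) by (rule cvec.span_sum)
    qed
  qed simp
  then show ?thesis
    using card_image[OF inj] by (simp add: D\<^sub>1_def)
qed

text \<open>The count is the same dimension for every decomposition, which makes the definite
  description well defined.\<close>

lemma gl_multiplicity_eq_dim:
  assumes S: "finite S" and V: "gl_module n (mat_act n) V" "V \<subseteq> {p. keys p \<subseteq> S}"
    and lam: "length lam \<le> n"
  shows "gl_multiplicity n (mat_act n) V lam = cvec.dim (hw_space n lam V)"
proof -
  have V_space: "cvec.subspace V" using V(1) by (simp add: gl_module_mat_act_iff)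
  obtain D where D: "irreducible_decomposition n (mat_act n) V D"
    using ex_irreducible_decomposition[OF S V] by blast
  show ?thesis
    unfolding gl_multiplicity_def
    using lam D card_irreducible_highest_weight_modules[OF _ V_space, of n _ lam]
    by (auto intro!: the_equality)
qed

section \<open>A lexicographic order on exponents\<close>

text \<open>The last column is the most significant one, and within a column the last row.\<close>

definition lexwt :: "nat \<Rightarrow> nat \<Rightarrow> (nat \<times> nat \<Rightarrow>\<^sub>0 nat) \<Rightarrow> nat" where
  "lexwt B n m = (\<Sum>y<n * n. lookup m (y mod n, y div n) * B ^ y)"

text \<open>Additivity is the gain from encoding the lexicographic order by numbers in base
  \<open>B\<close>: leading exponents of products add.\<close>

lemma lexwt_add: "lexwt B n (a + b) = lexwt B n a + lexwt B n b"
  by (simp add: lexwt_def lookup_add distrib_right sum.distrib)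

lemma digits_less:
  fixes d :: "nat \<Rightarrow> nat"
  assumes "\<And>y. d y < B"
  shows "(\<Sum>y<M. d y * B ^ y) < B ^ M"
proof (induction M)
  case (Suc M)
  have "(\<Sum>y<Suc M. d y * B ^ y) < d M * B ^ M + B ^ M"
    using Suc by simp
  also have "\<dots> = (d M + 1) * B ^ M" by (simp add: algebra_simps)
  also have "\<dots> \<le> B * B ^ M"
    using assms[of M] by (intro mult_right_mono) auto
  finally show ?case by simp
qed simp

text \<open>Only the smaller number needs digits below \<open>B\<close>: the surplus at position
  \<open>x\<close> is at least \<open>B ^ x\<close>, which exceeds anything \<open>d\<close> can
  have below \<open>x\<close>, and large digits of \<open>d'\<close> only help.\<close>

lemma digits_lex_less:
  fixes d d' :: "nat \<Rightarrow> nat"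
  assumes "\<And>y. d y < B" "x < M" "d x < d' x" "\<And>y. x < y \<Longrightarrow> y < M \<Longrightarrow> d y = d' y"
  shows "(\<Sum>y<M. d y * B ^ y) < (\<Sum>y<M. d' y * B ^ y)"
  using assms(2,4)
proof (induction M)
  case (Suc M)
  show ?case
  proof (cases "x = M")
    case True
    have "(\<Sum>y<Suc M. d y * B ^ y) < d M * B ^ M + B ^ M"
      using digits_less[of d B M] assms(1) by simp
    also have "\<dots> = (d M + 1) * B ^ M" by (simp add: algebra_simps)
    also have "\<dots> \<le> d' M * B ^ M"
      using assms(3) True by (intro mult_right_mono) auto
    finally show ?thesis by simp
  next
    case False
    then show ?thesis using Suc by simp
  qed
qed simp

lemma lexwt_less:
  assumes B: "\<And>x. lookup m x < B" and "s < n" "j < n" "lookup m (s, j) < lookup m' (s, j)"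
    and eq: "\<And>i k. i < n \<Longrightarrow> k < n \<Longrightarrow> j < k \<or> j = k \<and> s < i \<Longrightarrow> lookup m (i, k) = lookup m' (i, k)"
  shows "lexwt B n m < lexwt B n m'"
  unfolding lexwt_def
proof (rule digits_lex_less[where x = "j * n + s"])
  show "lookup m (y mod n, y div n) < B" for y by (rule B)
  have "j * n + s < (j + 1) * n" using assms(2) by (simp add: algebra_simps)
  also have "\<dots> \<le> n * n" using assms by (intro mult_right_mono) auto
  finally show "j * n + s < n * n" .
  show "lookup m ((j * n + s) mod n, (j * n + s) div n) < lookup m' ((j * n + s) mod n, (j * n + s) div n)"
    using assms by simp
  fix y assume y: "j * n + s < y" "y < n * n"
  have "j < y div n \<or> j = y div n \<and> s < y mod n"
  proof -
    have "(j * n + s) div n \<le> y div n"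
      using y by (intro div_le_mono) simp
    moreover have "s < y mod n" if "j = y div n"
      using y that div_mult_mod_eq[of y n] by (metis add_less_cancel_left)
    ultimately show ?thesis using assms by auto
  qed
  moreover have "y mod n < n" "y div n < n"
    using y assms by (auto simp: less_mult_imp_div_less)
  ultimately show "lookup m (y mod n, y div n) = lookup m' (y mod n, y div n)"
    by (intro eq)
qed

lemma inj_on_lexwt:
  "inj_on (lexwt B n) {m. keys m \<subseteq> {..<n} \<times> {..<n} \<and> (\<forall>x. lookup m x < B)}"
proof (rule inj_onI, rule ccontr)
  fix m m' assume m: "m \<in> {m. keys m \<subseteq> {..<n} \<times> {..<n} \<and> (\<forall>x. lookup m x < B)}"
    "m' \<in> {m. keys m \<subseteq> {..<n} \<times> {..<n} \<and> (\<forall>x. lookup m x < B)}"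
    "lexwt B n m = lexwt B n m'" "m \<noteq> m'"
  define Y where "Y = {y \<in> {..<n * n}. lookup m (y mod n, y div n) \<noteq> lookup m' (y mod n, y div n)}"
  have "Y \<noteq> {}"
  proof
    assume "Y = {}"
    have "lookup m x = lookup m' x" for x
    proof (cases "x \<in> {..<n} \<times> {..<n}")
      case True
      then obtain i k where x: "x = (i, k)" "i < n" "k < n" by auto
      have "k * n + i < (k + 1) * n" using x(2) by (simp add: algebra_simps)
      also have "\<dots> \<le> n * n" using x by (intro mult_right_mono) auto
      finally have "k * n + i \<in> {..<n * n}" by simp
      then show ?thesis using \<open>Y = {}\<close> x unfolding Y_def by force
    next
      case False
      then have "x \<notin> keys m" "x \<notin> keys m'" using m by auto
      then show ?thesis by (simp add: in_keys_iff)
    qed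
    then show False using m(4) by (auto intro: poly_mapping_eqI)
  qed
  moreover have "finite Y" by (simp add: Y_def)
  ultimately have max: "Max Y \<in> Y" "\<And>y. y \<in> Y \<Longrightarrow> y \<le> Max Y" by auto
  define x where "x = Max Y"
  have eq: "lookup m (y mod n, y div n) = lookup m' (y mod n, y div n)" if "x < y" "y < n * n" for y
    using max(2)[of y] that by (fastforce simp: Y_def x_def)
  have x: "x < n * n" "lookup m (x mod n, x div n) \<noteq> lookup m' (x mod n, x div n)"
    using max(1) by (auto simp: Y_def x_def)
  then consider "lookup m (x mod n, x div n) < lookup m' (x mod n, x div n)"
    | "lookup m' (x mod n, x div n) < lookup m (x mod n, x div n)"
    by (meson linorder_neqE_nat)
  then show False
  proof cases
    case 1
    then have "lexwt B n m < lexwt B n m'"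
      unfolding lexwt_def using m eq x
      by (intro digits_lex_less[where x = x]) auto
    then show False using m(3) by simp
  next
    case 2
    then have "lexwt B n m' < lexwt B n m"
      unfolding lexwt_def using m eq x
      by (intro digits_lex_less[where x = x]) auto
    then show False using m(3) by simp
  qed
qed

lemma inj_on_lexwt_col_monos: "inj_on (lexwt (l + 2) n) (col_monos n l)"
proof (rule inj_on_subset[OF inj_on_lexwt], rule subsetI)
  fix m assume m: "m \<in> col_monos n l"
  have "lookup m x < l + 2" for x
    using lookup_le_of_col_monos[OF m, of x] by simp
  then show "m \<in> {m. keys m \<subseteq> {..<n} \<times> {..<n} \<and> (\<forall>x. lookup m x < l + 2)}"
    using m by (simp add: col_monos_def)
qed

section \<open>Strings of lowering operators\<close>

text \<open>Monomials are weight vectors, so an eigenvalue equation for \<open>E r r\<close> fixes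
  the sum of row \<open>r\<close> in all keys.\<close>

lemma mat_act_diagonal: "lookup (mat_act n r r p) m = of_nat (rowsum n r m) * lookup p m"
proof -
  have "lookup (mat_act n r r p) m = (\<Sum>k<n. of_nat (lookup m (r, k)) * lookup p m)"
    unfolding lookup_mat_act
    by (rule sum.cong) (auto simp: minus_add_expo lookup_minus of_nat_diff)
  then show ?thesis
    by (simp add: rowsum_def sum_distrib_right)
qed

lemma mat_act_funpow_cscale: "(mat_act n i j ^^ k) (cscale c p) = cscale c ((mat_act n i j ^^ k) p)"
  by (induction k) (auto simp: mat_act_cscale)

lemma fischer_mat_act_funpow: "fischer ((mat_act n i j ^^ k) p) q = fischer p ((mat_act n j i ^^ k) q)"
  by (induction k arbitrary: q) (auto simp: fischer_mat_act simp flip: funpow_swap1)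

text \<open>The standard computation in sl2 with raising operator \<open>E r s\<close> and lowering
  operator \<open>E s r\<close>: each lowering shifts the eigenvalue of \<open>E r r\<close> by -1
  and that of \<open>E s s\<close> by 1, and the commutator contributes the difference of the
  two.\<close>

lemma lowering_string:
  fixes a d :: complex
  assumes rs: "r < n" "s < n" "r \<noteq> s"
    and v: "mat_act n r s v = 0" "mat_act n r r v = cscale a v" "mat_act n s s v = cscale d v"
  defines "w \<equiv> \<lambda>i. (mat_act n s r ^^ i) v"
  shows "mat_act n r s (w (Suc i)) = cscale (of_nat (Suc i) * (a - d - of_nat i)) (w i)"
proof -
  have wS: "w (Suc i) = mat_act n s r (w i)" for i by (simp add: w_def)
  have wr: "mat_act n r r (w i) = cscale (a - of_nat i) (w i)" for i
  proof (induction i)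
    case 0 show ?case using v by (simp add: w_def)
  next
    case (Suc i)
    have "mat_act n r r (w (Suc i)) = mat_act n s r (mat_act n r r (w i)) - w (Suc i)"
      using mat_act_commutator[of n r r s r "w i"] rs by (simp add: wS algebra_simps)
    also have "\<dots> = cscale (a - of_nat (Suc i)) (w (Suc i))"
      unfolding Suc mat_act_cscale wS[symmetric]
      by (intro poly_mapping_eqI) (simp add: lookup_minus lookup_add algebra_simps)
    finally show ?case .
  qed
  have ws: "mat_act n s s (w i) = cscale (d + of_nat i) (w i)" for i
  proof (induction i)
    case 0 show ?case using v by (simp add: w_def)
  next
    case (Suc i)
    have "mat_act n s s (w (Suc i)) = mat_act n s r (mat_act n s s (w i)) + w (Suc i)"
      using mat_act_commutator[of n s s s r "w i"] rs by (simp add: wS algebra_simps)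
    also have "\<dots> = cscale (d + of_nat (Suc i)) (w (Suc i))"
      unfolding Suc mat_act_cscale wS[symmetric]
      by (intro poly_mapping_eqI) (simp add: lookup_minus lookup_add algebra_simps)
    finally show ?case .
  qed
  show ?thesis
  proof (induction i)
    case 0
    have *: "mat_act n r s (w (Suc 0)) = mat_act n s r (mat_act n r s v) + mat_act n r r (w 0) - mat_act n s s (w 0)"
      using mat_act_commutator[of n r s s r v] rs by (simp add: w_def algebra_simps)
    show ?case
      unfolding * wr ws v by (intro poly_mapping_eqI) (simp add: lookup_add lookup_minus algebra_simps)
  next
    case (Suc i)
    have *: "mat_act n r s (w (Suc (Suc i))) =
        mat_act n s r (mat_act n r s (w (Suc i))) + mat_act n r r (w (Suc i)) - mat_act n s s (w (Suc i))"
      using mat_act_commutator[of n r s s r "w (Suc i)"] rs by (simp add: wS[of "Suc i"] algebra_simps)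
    show ?case
      unfolding * wr ws Suc mat_act_cscale wS[symmetric]
      by (intro poly_mapping_eqI, simp only: lookup_add lookup_minus lookup_cscale)
        (simp add: algebra_simps)
  qed
qed

text \<open>By adjointness the squared norm of \<open>w (Suc i)\<close> is
  \<open>Suc i * (a - d - i)\<close> times that of \<open>w i\<close>; a positive norm at
  \<open>Suc i = q\<close> forces \<open>q - 1 < a - d\<close>.\<close>

lemma lowering_string_bound:
  fixes a d q :: nat
  assumes rs: "r < n" "s < n" "r \<noteq> s"
    and v: "mat_act n r s v = 0" "mat_act n r r v = cscale (of_nat a) v"
      "mat_act n s s v = cscale (of_nat d) v"
    and nz: "(mat_act n s r ^^ q) v \<noteq> 0"
  shows "d + q \<le> a"
proof -
  define w where "w i = (mat_act n s r ^^ i) v" for i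
  have norm: "fischer (w (Suc i)) (w (Suc i)) =
      of_nat (Suc i) * (of_nat a - of_nat d - of_nat i) * fischer (w i) (w i)" for i
  proof -
    have "fischer (w (Suc i)) (w (Suc i)) = fischer (w i) (mat_act n r s (w (Suc i)))"
      by (simp add: w_def fischer_mat_act)
    then show ?thesis
      using lowering_string[OF rs v, of i] by (simp add: w_def fischer_cscale_right)
  qed
  \<comment> \<open>For \<open>q = 0\<close> the choice \<open>i = 0\<close> gives only that
    \<open>a - d\<close> is not negative, which is then the claim. Otherwise the last step before
    \<open>q\<close> gives strict positivity.\<close>
  obtain i where i: "w i \<noteq> 0" "w (Suc i) \<noteq> 0 \<and> q = Suc i \<or> q = 0 \<and> i = 0"
  proof (cases q)
    case 0
    then show ?thesis using nz that[of 0] by (simp add: w_def)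
  next
    case (Suc i)
    then show ?thesis using nz that[of i] by (cases "w i = 0") (auto simp: w_def)
  qed
  obtain x where x: "fischer (w i) (w i) = of_real x" "0 < x"
    using fischer_self[of "w i"] i(1) by (metis less_eq_real_def)
  obtain y where y: "fischer (w (Suc i)) (w (Suc i)) = of_real y" "0 \<le> y" "y = 0 \<longleftrightarrow> w (Suc i) = 0"
    using fischer_self[of "w (Suc i)"] by metis
  have "complex_of_real y = of_real (real (Suc i) * (real a - real d - real i) * x)"
    using norm[of i] x y by simp
  then have eq: "y = real (Suc i) * (real a - real d - real i) * x"
    unfolding of_real_eq_iff .
  have "0 \<le> real a - real d - real i"
    using y(2) x(2) unfolding eq by (simp add: zero_le_mult_iff)
  moreover have "real a - real d - real i \<noteq> 0" if "w (Suc i) \<noteq> 0"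
    using y(3) that eq by auto
  ultimately show ?thesis using i(2) by auto
qed

section \<open>Leading exponents of highest weight vectors\<close>

text \<open>
  Write \<open>m = b + u + q e\<close> with \<open>b\<close> supported on the columns before \<open>k\<close>, \<open>e\<close> the exponent of \<open>x (r + 1) k\<close>, and
  \<open>u\<close> on the other positions of the columns from \<open>k\<close> on.  The polynomial \<open>v i\<close> below is the coefficient
  in \<open>f\<close>, as a polynomial in the columns before \<open>k\<close>, of the exponent obtained from \<open>u + q e\<close> by moving
  \<open>i\<close> units from row \<open>r + 1\<close> to row \<open>r\<close>.  Maximality of \<open>m\<close> makes \<open>v 0\<close> a highest weight vector for the
  \<open>sl\<^sub>2\<close> belonging to \<open>r\<close>, and \<open>v 0\<close> is a multiple of \<open>E\<^sup>q (v q)\<close>; hence \<open>F\<^sup>q (v 0) \<noteq> 0\<close>.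
\<close>

lemma lead_horizontal_strip:
  assumes f: "f \<in> hw_space n lam (col_space n l)" and lead: "is_lead (lexwt (l + 2) n) f m"
    and r: "Suc r < n" and k: "k < n"
  shows "(\<Sum>j<k. lookup m (Suc r, j)) + lookup m (Suc r, k) \<le> (\<Sum>j<k. lookup m (r, j))"
proof -
  define s where "s = Suc r"
  have rs: "r < n" "s < n" "r \<noteq> s" "r < s" using r by (auto simp: s_def)
  define q where "q = lookup m (s, k)"
  define part_on where "part_on X = (\<Sum>x\<in>keys m. single x (if x \<in> X then lookup m x else 0))" for X
  have part_on: "lookup (part_on X) x = (if x \<in> X then lookup m x else 0)" for X x
  proof -
    have "lookup (part_on X) x = (\<Sum>y\<in>keys m. if y = x then (if x \<in> X then lookup m x else 0) else 0)"
      unfolding part_on_def lookup_sum by (rule sum.cong) (auto simp: lookup_single when_def)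
    then show ?thesis by (simp add: in_keys_iff)
  qed
  define b where "b = part_on {x. snd x < k}"
  define u where "u = part_on {x. k \<le> snd x \<and> x \<noteq> (s, k)}"
  define t where "t i = u + single (s, k) (q - i) + single (r, k) i" for i
  have b: "lookup b (i, j) = (if j < k then lookup m (i, j) else 0)" for i j
    by (simp add: b_def part_on)
  have u: "lookup u (i, j) = (if k \<le> j \<and> (i, j) \<noteq> (s, k) then lookup m (i, j) else 0)" for i j
    by (auto simp: u_def part_on)
  have m_eq: "m = b + t 0"
    by (rule poly_mapping_eqI, rename_tac x, case_tac x)
      (auto simp: t_def b u lookup_add lookup_single when_def q_def)
  have m: "m \<in> keys f" "\<And>x. x \<in> keys f \<Longrightarrow> lexwt (l + 2) n x \<le> lexwt (l + 2) n m"
    using lead by (auto simp: is_lead_def)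
  have f_col: "keys f \<subseteq> col_monos n l"
    and Ef: "mat_act n r s f = 0"
    and f_wt: "\<And>i. i < n \<Longrightarrow> mat_act n i i f = cscale (of_nat (part lam i)) f"
    using f rs by (auto simp: hw_space_def col_space_def)
  have m_col: "m \<in> col_monos n l" using m f_col by blast
  \<comment> \<open>\<open>t i\<close> alone already has degree \<open>l\<close> in every column
    from \<open>k\<close> on, since units are moved only within column \<open>k\<close>. Hence
    \<open>v i\<close> involves only columns before \<open>k\<close>.\<close>
  have col_t: "colsum n j (t i) = l" if "k \<le> j" "j < n" "i \<le> q" for i j
  proof -
    have "colsum n j (t i) = colsum n j (t 0)"
      using rs that
      by (cases "j = k") (auto simp: t_def colsum_def lookup_add sum.distrib lookup_single when_def)
    moreover have "colsum n j b = 0" using that by (simp add: colsum_def b)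
    ultimately have "colsum n j (t i) = colsum n j m"
      by (simp add: m_eq colsum_add)
    then show ?thesis using m_col that by (simp add: col_monos_def)
  qed
  \<comment> \<open>\<open>map_key\<close> reads off coefficients along a shift of exponents; the
    shift by \<open>t i\<close> is injective, as it requires.\<close>
  define v where "v i = Poly_Mapping.map_key (\<lambda>x. x + t i) f" for i
  have v: "lookup (v i) x = lookup f (x + t i)" for i x
    unfolding v_def by (subst map_key.rep_eq) (auto simp: inj_def)
  have v_zero: "lookup (v i) x = 0" if "k \<le> j" "j < n" "i \<le> q" "0 < colsum n j x" for i j x
  proof -
    have "colsum n j (x + t i) \<noteq> l"
      using that col_t by (simp add: colsum_add)
    then have "x + t i \<notin> col_monos n l" using that by (auto simp: col_monos_def)
    then show ?thesis using f_col by (auto simp: v in_keys_iff)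
  qed
  \<comment> \<open>The exponent in question exceeds \<open>m\<close> lexicographically: it agrees
    with \<open>m\<close> at the more significant positions and has one more unit at
    \<open>(s, j)\<close>. By maximality of \<open>m\<close> it does not occur in
    \<open>f\<close>.\<close>
  have f_zero: "lookup f (x + t i - expo (r, j) + expo (s, j)) = 0"
    if x: "\<And>i' j'. i' < n \<Longrightarrow> k \<le> j' \<Longrightarrow> j' < n \<Longrightarrow> lookup x (i', j') = 0"
      and j: "j < n" "k < j \<or> k = j \<and> i = 0" for x i j
  proof (rule ccontr)
    assume "\<not> ?thesis"
    then have "lexwt (l + 2) n (x + t i - expo (r, j) + expo (s, j)) \<le> lexwt (l + 2) n m"
      by (intro m(2)) (simp add: in_keys_iff)
    moreover have "lexwt (l + 2) n m < lexwt (l + 2) n (x + t i - expo (r, j) + expo (s, j))"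
    proof (rule lexwt_less)
      show "lookup m x < l + 2" for x
        using lookup_le_of_col_monos[OF m_col, of x] by simp
      show "s < n" "j < n" by fact+
      show "lookup m (s, j) < lookup (x + t i - expo (r, j) + expo (s, j)) (s, j)"
        using j x[of s j] rs by (auto simp: t_def u lookup_add lookup_minus lookup_single when_def q_def)
      show "lookup m (i', k') = lookup (x + t i - expo (r, j) + expo (s, j)) (i', k')"
        if "i' < n" "k' < n" "j < k' \<or> j = k' \<and> s < i'" for i' k'
        using that j x[of i' k'] rs
        by (auto simp: t_def u lookup_add lookup_minus lookup_single when_def)
    qed
    ultimately show False by simp
  qed
  have E: "lookup (mat_act n r s p) x = (\<Sum>j<n. if 0 < lookup x (r, j)
      then of_nat (lookup x (s, j) + 1) * lookup p (x - expo (r, j) + expo (s, j)) else 0)" for p x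
    unfolding lookup_mat_act by (rule sum.cong) (use rs in \<open>auto simp: lookup_minus lookup_single\<close>)
  \<comment> \<open>For \<open>x\<close> without variables of the columns from \<open>k\<close> on,
    compare coefficients of \<open>x + t i\<close> in \<open>E r s f = 0\<close>: columns before
    \<open>k\<close> contribute \<open>E r s (v i)\<close>, column \<open>k\<close> contributes
    \<open>v (i - 1)\<close> with the factor \<open>(q - i) + 1\<close>, and later columns nothing
    by \<open>f_zero\<close>. For other \<open>x\<close> both sides vanish.\<close>
  have E_v: "lookup (mat_act n r s (v i)) x =
      (if i = 0 then 0 else - (of_nat (q - i + 1) * lookup (v (i - 1)) x))" if i: "i \<le> q" for i x
  proof (cases "\<exists>j. k \<le> j \<and> j < n \<and> 0 < colsum n j x")
    case True
    then obtain j where j: "k \<le> j" "j < n" "0 < colsum n j x" by blast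
    have "lookup (v i) (x - expo (r, j') + expo (s, j')) = 0" if "0 < lookup x (r, j')" "j' < n" for j'
    proof (rule v_zero[OF j(1,2) i])
      have "colsum n j (x - expo (r, j') + expo (s, j')) = colsum n j (x - expo (r, j') + expo (r, j'))"
        using rs by (simp add: colsum_add colsum_expo)
      then show "0 < colsum n j (x - expo (r, j') + expo (s, j'))"
        using minus_add_expo[OF that(1)] j(3) by simp
    qed
    then have "lookup (mat_act n r s (v i)) x = 0"
      unfolding E by (intro sum.neutral) auto
    moreover have "lookup (v (i - 1)) x = 0"
      using v_zero[OF j(1,2) _ j(3)] i by simp
    ultimately show ?thesis by simp
  next
    case False
    have x: "lookup x (i', j') = 0" if "i' < n" "k \<le> j'" "j' < n" for i' j'
    proof -
      have "colsum n j' x = 0" using False that by auto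
      then show ?thesis using that by (simp add: colsum_def)
    qed
    define y where "y = x + t i"
    define g where "g j = (if 0 < lookup y (r, j)
      then of_nat (lookup y (s, j) + 1) * lookup f (y - expo (r, j) + expo (s, j)) else 0)" for j
    define g' where "g' j = (if 0 < lookup x (r, j)
      then of_nat (lookup x (s, j) + 1) * lookup (v i) (x - expo (r, j) + expo (s, j)) else 0)" for j
    have "0 = lookup (mat_act n r s f) y" by (simp add: Ef)
    then have sum_g: "(\<Sum>j<n. g j) = 0" unfolding E g_def by simp
    have g: "g j = g' j + (if j = k then (if i = 0 then 0 else of_nat (q - i + 1) * lookup (v (i - 1)) x) else 0)"
      if j: "j < n" for j
    proof -
      consider "j < k" | "j = k" "i \<noteq> 0" | "k < j \<or> k = j \<and> i = 0" by linarith
      then show ?thesis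
      proof cases
        case 1
        have t0: "lookup (t i) (r, j) = 0" "lookup (t i) (s, j) = 0"
          using 1 by (auto simp: t_def u lookup_add lookup_single)
        have "y - expo (r, j) + expo (s, j) = x - expo (r, j) + expo (s, j) + t i" if "0 < lookup x (r, j)"
          using that by (intro poly_mapping_eqI)
            (auto simp: y_def lookup_add lookup_minus lookup_single when_def)
        then show ?thesis
          using 1 t0 by (simp add: g_def g'_def y_def lookup_add v)
      next
        case 2
        have y: "lookup y (r, k) = lookup u (r, k) + i" "lookup y (s, k) = q - i"
          using x[of r k] x[of s k] rs k by (auto simp: y_def t_def lookup_add lookup_single when_def u)
        have "y - expo (r, k) + expo (s, k) = x + t (i - 1)"
          using 2 rs i by (intro poly_mapping_eqI)
            (auto simp: y_def t_def lookup_add lookup_minus lookup_single when_def)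
        then show ?thesis
          using 2 x[of r k] rs k y by (simp add: g_def g'_def v)
      next
        case 3
        then have "g' j = 0" using x[of r j] rs j by (auto simp: g'_def)
        moreover have "g j = 0"
          using f_zero[OF x j 3] by (simp add: g_def y_def)
        ultimately show ?thesis using 3 by auto
      qed
    qed
    have "(\<Sum>j<n. g j) = (\<Sum>j<n. g' j) + (if i = 0 then 0 else of_nat (q - i + 1) * lookup (v (i - 1)) x)"
      using k by (simp add: g sum.distrib)
    moreover have "lookup (mat_act n r s (v i)) x = (\<Sum>j<n. g' j)"
      unfolding E g'_def ..
    ultimately show ?thesis
      using sum_g by (auto simp: eq_neg_iff_add_eq_0)
  qed
  have E_v0: "mat_act n r s (v 0) = 0"
    by (rule poly_mapping_eqI) (simp add: E_v)
  have E_vS: "mat_act n r s (v (Suc i)) = cscale (- of_nat (q - i)) (v i)" if "i < q" for i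
  proof (rule poly_mapping_eqI)
    fix x
    have "q - Suc i + 1 = q - i" using that by simp
    then show "lookup (mat_act n r s (v (Suc i))) x = lookup (cscale (- of_nat (q - i)) (v i)) x"
      using E_v[of "Suc i" x] that by (simp, simp add: algebra_simps)
  qed
  \<comment> \<open>Iterating the relation, raising leads from \<open>v i\<close> back to
    \<open>v 0\<close> with a product of factors \<open>- (q - j)\<close>, which are nonzero for
    \<open>j < q\<close>.\<close>
  have "\<exists>c. c \<noteq> 0 \<and> (mat_act n r s ^^ i) (v i) = cscale c (v 0)" if "i \<le> q" for i
    using that
  proof (induction i)
    case 0
    show ?case by (rule exI[of _ 1]) simp
  next
    case (Suc i)
    then obtain c where c: "c \<noteq> 0" "(mat_act n r s ^^ i) (v i) = cscale c (v 0)" by auto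
    have "(mat_act n r s ^^ Suc i) (v (Suc i)) = (mat_act n r s ^^ i) (cscale (- of_nat (q - i)) (v i))"
      using Suc.prems E_vS[of i] by (simp add: funpow_swap1)
    also have "\<dots> = cscale (- of_nat (q - i) * c) (v 0)"
      unfolding mat_act_funpow_cscale c(2) by simp
    finally show ?case
      using c(1) Suc.prems by (intro exI[of _ "- of_nat (q - i) * c"]) auto
  qed
  then obtain c where c: "c \<noteq> 0" "(mat_act n r s ^^ q) (v q) = cscale c (v 0)" by blast
  have "lookup (v 0) b \<noteq> 0"
    using m(1) by (simp add: v in_keys_iff flip: m_eq)
  then have v0: "v 0 \<noteq> 0" by auto
  \<comment> \<open>By adjointness \<open>c\<close> times the squared norm of \<open>v 0\<close> is
    the pairing of \<open>v q\<close> with this vector.\<close>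
  have "(mat_act n s r ^^ q) (v 0) \<noteq> 0"
  proof
    assume "(mat_act n s r ^^ q) (v 0) = 0"
    then have "fischer (cscale c (v 0)) (v 0) = 0"
      unfolding c(2)[symmetric] by (simp add: fischer_mat_act_funpow)
    then show False
      using c(1) v0 by (simp add: fischer_cscale_left fischer_self_eq_0_iff)
  qed
  \<comment> \<open>All keys of \<open>f\<close> have row sums \<open>part lam i\<close>, and the
    shift \<open>t 0\<close> is common to all keys of \<open>v 0\<close>, so these share the row
    sums of \<open>b\<close>.\<close>
  moreover have v0_wt: "mat_act n i i (v 0) = cscale (of_nat (rowsum n i b)) (v 0)" if "i < n" for i
  proof (rule poly_mapping_eqI)
    fix x
    have wt: "rowsum n i y = part lam i" if "y \<in> keys f" for y
    proof -
      have "of_nat (rowsum n i y) * lookup f y = of_nat (part lam i) * lookup f y"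
        using arg_cong[OF f_wt[OF \<open>i < n\<close>], of "\<lambda>p. lookup p y"] by (simp add: mat_act_diagonal)
      then show ?thesis using that by (simp add: in_keys_iff)
    qed
    have "rowsum n i x = rowsum n i b" if "lookup (v 0) x \<noteq> 0"
    proof -
      have "x + t 0 \<in> keys f" using that by (simp add: v in_keys_iff)
      then have "rowsum n i (x + t 0) = rowsum n i (b + t 0)"
        using wt m(1) m_eq by metis
      then show ?thesis by (simp add: rowsum_add)
    qed
    then show "lookup (mat_act n i i (v 0)) x = lookup (cscale (of_nat (rowsum n i b)) (v 0)) x"
      by (auto simp: mat_act_diagonal)
  qed
  ultimately have "rowsum n s b + q \<le> rowsum n r b"
    using lowering_string_bound[OF rs(1,2,3) E_v0] rs by blast
  moreover have "rowsum n i b = (\<Sum>j<k. lookup m (i, j))" for i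
    unfolding rowsum_def b using k by (auto simp: sum.If_cases intro!: sum.cong)
  ultimately show ?thesis by (simp add: s_def q_def)
qed

section \<open>Bideterminants\<close>

text \<open>The monomials of the same bidegree as \<open>a\<close>, that is, of the same weight for
  the actions on rows and on columns. Minors and their products are homogeneous in this
  sense.\<close>

definition grid_monos :: "nat \<Rightarrow> (nat \<times> nat \<Rightarrow>\<^sub>0 nat) \<Rightarrow> (nat \<times> nat \<Rightarrow>\<^sub>0 nat) set" where
  "grid_monos n a = {m. keys m \<subseteq> {..<n} \<times> {..<n} \<and>
     (\<forall>i<n. rowsum n i m = rowsum n i a \<and> colsum n i m = colsum n i a)}"

text \<open>Each of these conditions is inherited by products: weights and bidegrees add, and
  \<open>mat_act\<close> is a derivation. Bideterminants are thus reduced to single minors.\<close>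

definition hw_lead :: "nat \<Rightarrow> nat \<Rightarrow> (nat \<times> nat) cpoly \<Rightarrow> (nat \<times> nat \<Rightarrow>\<^sub>0 nat) \<Rightarrow> bool" where
  "hw_lead B n f a \<longleftrightarrow> is_lead (lexwt B n) f a \<and> keys f \<subseteq> grid_monos n a \<and>
     (\<forall>i<n. \<forall>j<n. i < j \<longrightarrow> mat_act n i j f = 0)"

text \<open>Splitting off the leading terms leaves lighter remainders; with an additive weight every
  other product is lighter than \<open>a + b\<close>, so the two leading coefficients multiply
  without interference.\<close>

lemma is_lead_mult:
  assumes wt: "\<And>a b. wt (a + b) = wt a + wt b"
    and f: "is_lead wt f a" and g: "is_lead wt g b"
  shows "is_lead wt (f * g :: 'x cpoly) (a + b)"
proof -
  define f' where "f' = f - single a (lookup f a)"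
  define g' where "g' = g - single b (lookup g b)"
  have f': "wt m < wt a" if "m \<in> keys f'" for m
  proof -
    have "m \<in> keys f" "m \<noteq> a"
      using that by (auto simp: f'_def in_keys_iff lookup_minus lookup_single when_def split: if_splits)
    then show ?thesis using f by (auto simp: is_lead_def)
  qed
  have g': "wt m < wt b" if "m \<in> keys g'" for m
  proof -
    have "m \<in> keys g" "m \<noteq> b"
      using that by (auto simp: g'_def in_keys_iff lookup_minus lookup_single when_def split: if_splits)
    then show ?thesis using g by (auto simp: is_lead_def)
  qed
  define h where "h = f' * g + single a (lookup f a) * g'"
  have "f * g = (f' + single a (lookup f a)) * (g' + single b (lookup g b))"
    by (simp add: f'_def g'_def)
  also have "\<dots> = h + single (a + b) (lookup f a * lookup g b)"
    by (simp add: h_def g'_def algebra_simps flip: mult_single)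
  finally have fg: "f * g = h + single (a + b) (lookup f a * lookup g b)" .
  have g_le: "wt m \<le> wt b" if "m \<in> keys g" for m
    using g that by (auto simp: is_lead_def)
  have h: "wt m < wt (a + b)" if "m \<in> keys h" for m
  proof -
    have "m \<in> keys (f' * g) \<or> m \<in> keys (single a (lookup f a) * g')"
      using that keys_add_subset[of "f' * g" "single a (lookup f a) * g'"] unfolding h_def by blast
    then show ?thesis
    proof
      assume "m \<in> keys (f' * g)"
      then obtain x y where "m = x + y" "x \<in> keys f'" "y \<in> keys g"
        using keys_mult[of f' g] by blast
      then show ?thesis using f'[of x] g_le[of y] by (simp add: wt)
    next
      assume "m \<in> keys (single a (lookup f a) * g')"
      then obtain x y where "m = x + y" "x \<in> keys (single a (lookup f a))" "y \<in> keys g'"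
        using keys_mult[of "single a (lookup f a)" g'] by blast
      then show ?thesis using g'[of y] by (simp add: wt split: if_splits)
    qed
  qed
  have "lookup h (a + b) = 0"
    using h[of "a + b"] by (auto simp: in_keys_iff)
  then have "lookup (f * g) (a + b) = lookup f a * lookup g b"
    by (simp add: fg lookup_add)
  moreover have "m \<in> keys h" if "m \<in> keys (f * g)" "m \<noteq> a + b" for m
    using that by (auto simp: fg in_keys_iff lookup_add lookup_single when_def)
  ultimately show ?thesis
    using f g h by (auto simp: is_lead_def in_keys_iff)
qed

lemma hw_lead_mult:
  assumes f: "hw_lead B n f a" and g: "hw_lead B n g b"
  shows "hw_lead B n (f * g) (a + b)"
proof -
  have "m \<in> grid_monos n (a + b)" if m: "m \<in> keys (f * g)" for m
  proof -
    obtain x y where "m = x + y" "x \<in> keys f" "y \<in> keys g"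
      using m keys_mult[of f g] by blast
    moreover from this have "x \<in> grid_monos n a" "y \<in> grid_monos n b"
      using f g by (auto simp: hw_lead_def)
    ultimately show ?thesis
      using keys_add_subset[of x y] by (auto simp: grid_monos_def rowsum_add colsum_add)
  qed
  moreover have "is_lead (lexwt B n) (f * g) (a + b)"
    using f g by (intro is_lead_mult lexwt_add) (auto simp: hw_lead_def)
  ultimately show ?thesis
    using f g by (auto simp: hw_lead_def mat_act_mult)
qed

lemma mat_act_one [simp]: "mat_act n i j 1 = 0"
  using mat_act_single[of n i j 0 1] by simp

lemma hw_lead_one: "hw_lead B n 1 0"
  by (simp add: hw_lead_def is_lead_def grid_monos_def)

lemma hw_lead_prod:
  assumes "\<And>x. x \<in> A \<Longrightarrow> hw_lead B n (f x) (a x)"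
  shows "hw_lead B n (\<Prod>x\<in>A. f x) (\<Sum>x\<in>A. a x)"
  using assms
  by (induction A rule: infinite_finite_induct) (auto simp: hw_lead_one hw_lead_mult)

lemma mat_act_prod:
  assumes "finite A"
  shows "mat_act n i j (\<Prod>x\<in>A. f x) = (\<Sum>x\<in>A. mat_act n i j (f x) * (\<Prod>y\<in>A - {x}. f y))"
  using assms
proof (induction A)
  case (insert a A)
  have "(\<Sum>x\<in>A. mat_act n i j (f x) * (\<Prod>y\<in>insert a A - {x}. f y)) =
      (\<Sum>x\<in>A. f a * (mat_act n i j (f x) * (\<Prod>y\<in>A - {x}. f y)))"
  proof (rule sum.cong)
    fix x assume x: "x \<in> A"
    then have "insert a A - {x} = insert a (A - {x})" "a \<notin> A - {x}" using insert.hyps by auto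
    then show "mat_act n i j (f x) * (\<Prod>y\<in>insert a A - {x}. f y) =
        f a * (mat_act n i j (f x) * (\<Prod>y\<in>A - {x}. f y))"
      using insert.hyps(1) by (simp add: mult.left_commute)
  qed simp
  then show ?case
    using insert by (simp add: mat_act_mult sum_distrib_left)
qed simp

text \<open>The rows are always the initial ones, which is what makes raising operators annihilate
  it.\<close>

definition minor :: "nat \<Rightarrow> (nat \<Rightarrow> nat) \<Rightarrow> (nat \<times> nat) cpoly" where
  "minor k c = det (mat k k (\<lambda>(i, j). pvar (i, c j)))"

definition minor_mono :: "nat \<Rightarrow> (nat \<Rightarrow> nat) \<Rightarrow> (nat \<Rightarrow> nat) \<Rightarrow> (nat \<times> nat \<Rightarrow>\<^sub>0 nat)" where
  "minor_mono k c p = (\<Sum>i<k. expo (i, c (p i)))"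

lemma minor_eq_sum:
  "minor k c = (\<Sum>p | p permutes {..<k}. signof p * single (minor_mono k c p) 1)"
  unfolding minor_def
  by (subst det_def'[OF mat_carrier]) (simp add: atLeast0LessThan prod_pvar minor_mono_def)

lemma lookup_signof_times: "lookup (signof p * q) m = of_int (sign p) * lookup q m"
  by (cases "evenperm p") (auto simp: sign_def)

lemma mat_act_signof_times: "mat_act n i j (signof p * q) = signof p * mat_act n i j q"
proof -
  have "mat_act n i j (- q) = - mat_act n i j q"
    using mat_act_cscale[of n i j "- 1" q] by simp
  then show ?thesis by (cases "evenperm p") (auto simp: sign_def)
qed

lemma lookup_minor_mono:
  "lookup (minor_mono k c p) (i, j) = (if i < k \<and> c (p i) = j then 1 else 0)"
proof -
  have "lookup (minor_mono k c p) (i, j) = (\<Sum>i'<k. if i' = i then (if c (p i) = j then 1 else 0) else 0)"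
    unfolding minor_mono_def lookup_sum by (rule sum.cong) (auto simp: lookup_single when_def)
  then show ?thesis by simp
qed

text \<open>Let \<open>x\<close> be the largest index moved by \<open>p\<close>. Columns
  \<open>c y\<close> with \<open>y > x\<close> are treated alike, while in column \<open>c x\<close>
  the identity uses row \<open>x\<close> and \<open>p\<close> uses a smaller row, which weighs less
  because later rows are more significant.\<close>

lemma lexwt_minor_mono_less:
  assumes c: "\<And>i j. i < j \<Longrightarrow> j < k \<Longrightarrow> c i < c j" "\<And>i. i < k \<Longrightarrow> c i < n" and "k \<le> n" "2 \<le> B"
    and p: "p permutes {..<k}" "p \<noteq> id"
  shows "lexwt B n (minor_mono k c p) < lexwt B n (minor_mono k c id)"
proof -
  define X where "X = {i. p i \<noteq> i}"
  have X: "X \<subseteq> {..<k}" "X \<noteq> {}"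
    using p by (auto simp: X_def permutes_def)
  from X(1) have "finite X" by (rule finite_subset) simp
  define x where "x = Max X"
  have x: "x \<in> X" "\<And>y. x < y \<Longrightarrow> p y = y"
  proof -
    show "x \<in> X" unfolding x_def by (rule Max_in[OF \<open>finite X\<close> X(2)])
    fix y assume "x < y"
    then have "y \<notin> X" using Max_ge[OF \<open>finite X\<close>, of y] by (auto simp: x_def)
    then show "p y = y" by (simp add: X_def)
  qed
  have xk: "x < k" using x X by auto
  have pk: "p i < k" if "i < k" for i
    using permutes_in_image[OF p(1), of i] that by simp
  have inj: "p i = p j \<longleftrightarrow> i = j" for i j
    using permutes_inj[OF p(1)] by (auto simp: inj_def)
  have c_eq: "c i = c j \<longleftrightarrow> i = j" if "i < k" "j < k" for i j
    using c(1) that by (metis linorder_neqE_nat less_irrefl)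
  have c_less: "c i < c j \<longleftrightarrow> i < j" if "i < k" "j < k" for i j
    using c(1) that by (metis linorder_neqE_nat less_asym less_irrefl)
  have pi: "p i = i" if "i < k" "x < p i" for i
    using x(2)[OF that(2)] inj by blast
  show ?thesis
  proof (rule lexwt_less[where s = x and j = "c x"])
    show "lookup (minor_mono k c p) y < B" for y
      using \<open>2 \<le> B\<close> by (cases y) (simp add: lookup_minor_mono)
    show "x < n" "c x < n" using xk c(2) \<open>k \<le> n\<close> by auto
    have "p x \<noteq> x" using x(1) by (simp add: X_def)
    then show "lookup (minor_mono k c p) (x, c x) < lookup (minor_mono k c id) (x, c x)"
      using xk pk c_eq by (simp add: lookup_minor_mono)
    fix i j assume j: "c x < j \<or> c x = j \<and> x < i"
    have "c (p i) = j \<longleftrightarrow> c i = j" if i: "i < k"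
    proof (cases "x < i")
      case True
      then show ?thesis using x(2) by simp
    next
      case False
      then have "c x < j" using j by blast
      moreover have "\<not> c x < c i" using False c_less xk i by blast
      moreover have "\<not> c x < c (p i)" using False c_less xk i pk[OF i] pi[OF i] by metis
      ultimately show ?thesis by auto
    qed
    then show "lookup (minor_mono k c p) (i, j) = lookup (minor_mono k c id) (i, j)"
      by (auto simp: lookup_minor_mono)
  qed
qed

lemma minor_mono_in_grid_monos:
  assumes c: "\<And>i. i < k \<Longrightarrow> c i < n" and "k \<le> n" and p: "p permutes {..<k}"
  shows "minor_mono k c p \<in> grid_monos n (minor_mono k c id)"
proof -
  have pk: "p i < k" if "i < k" for i
    using permutes_in_image[OF p, of i] that by simp
  have row: "rowsum n r (minor_mono k c q) = (if r < k then 1 else 0)"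
    if "\<And>i. i < k \<Longrightarrow> c (q i) < n" for r q
    using that by (auto simp: rowsum_def lookup_minor_mono)
  have col: "colsum n j (minor_mono k c q) = (\<Sum>i<k. if c (q i) = j then 1 else 0)" for j q
  proof -
    have "colsum n j (minor_mono k c q) = (\<Sum>i\<in>{..<n}. if i < k then (if c (q i) = j then 1 else 0) else 0)"
      unfolding colsum_def by (rule sum.cong) (auto simp: lookup_minor_mono)
    also have "\<dots> = (\<Sum>i\<in>{i \<in> {..<n}. i < k}. if c (q i) = j then 1 else 0)"
      by (rule sum.inter_filter[symmetric]) simp
    also have "{i \<in> {..<n}. i < k} = {..<k}" using \<open>k \<le> n\<close> by auto
    finally show ?thesis .
  qed
  have "colsum n j (minor_mono k c p) = colsum n j (minor_mono k c id)" for j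
    unfolding col using sum.permute[OF p, of "\<lambda>i. if c i = j then 1 else 0 :: nat"] by (simp add: comp_def)
  moreover have "keys (minor_mono k c p) \<subseteq> {..<n} \<times> {..<n}"
    using c pk \<open>k \<le> n\<close> by (auto simp: in_keys_iff lookup_minor_mono split: if_splits)
  moreover have "rowsum n r (minor_mono k c p) = rowsum n r (minor_mono k c id)" for r
    using c pk by (simp add: row)
  ultimately show ?thesis by (simp add: grid_monos_def)
qed

text \<open>By the Leibniz rule \<open>E r s\<close> replaces row \<open>s\<close> of the matrix by
  row \<open>r\<close>. For \<open>s < k\<close> this yields two equal rows, since
  \<open>r < s\<close>; otherwise row \<open>s\<close> does not occur.\<close>

lemma minor_raising:
  assumes c: "\<And>i. i < k \<Longrightarrow> c i < n" and rs: "r < s" "s < n"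
  shows "mat_act n r s (minor k c) = 0"
proof -
  define A where "A = mat k k (\<lambda>(i, j). pvar (if i = s then r else i, c j))"
  have prod: "mat_act n r s (single (minor_mono k c p) 1) =
      (if s < k then \<Prod>i<k. pvar (if i = s then r else i, c (p i)) else 0)" if p: "p permutes {..<k}" for p
  proof -
    have pk: "p i < k" if "i < k" for i
      using permutes_in_image[OF p, of i] that by simp
    define P where "P x = (\<Prod>y\<in>{..<k} - {x}. pvar (y, c (p y)))" for x
    have "mat_act n r s (single (minor_mono k c p) 1) = mat_act n r s (\<Prod>i<k. pvar (i, c (p i)))"
      by (simp add: prod_pvar minor_mono_def)
    also have "\<dots> = (\<Sum>x<k. mat_act n r s (pvar (x, c (p x))) * P x)"
      by (simp add: mat_act_prod P_def)
    also have "\<dots> = (\<Sum>x<k. if x = s then pvar (r, c (p s)) * P s else 0)"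
      by (rule sum.cong) (use c pk in \<open>auto simp: mat_act_pvar\<close>)
    also have "\<dots> = (if s < k then pvar (r, c (p s)) * P s else 0)"
      by simp
    also have "\<dots> = (if s < k then \<Prod>i<k. pvar (if i = s then r else i, c (p i)) else 0)"
    proof (cases "s < k")
      case True
      have "(\<Prod>i<k. pvar (if i = s then r else i, c (p i))) =
          pvar (r, c (p s)) * (\<Prod>i\<in>{..<k} - {s}. pvar (if i = s then r else i, c (p i)))"
        using True by (subst prod.remove[of _ s]) auto
      also have "(\<Prod>i\<in>{..<k} - {s}. pvar (if i = s then r else i, c (p i))) = P s"
        unfolding P_def by (rule prod.cong) auto
      finally show ?thesis using True by simp
    qed simp
    finally show ?thesis .
  qed
  show ?thesis
  proof (cases "s < k")
    case False
    then show ?thesis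
      by (simp add: minor_eq_sum mat_act_sum mat_act_signof_times prod)
  next
    case True
    have entry: "(\<Prod>i<k. A $$ (i, p i)) = (\<Prod>i<k. pvar (if i = s then r else i, c (p i)))"
      if "p permutes {..<k}" for p
    proof -
      have "p i < k" if "i < k" for i
        using permutes_in_image[OF \<open>p permutes _\<close>, of i] that by simp
      then show ?thesis
        unfolding A_def by (intro prod.cong) auto
    qed
    have A: "A \<in> carrier_mat k k" by (simp add: A_def)
    have "det A = (\<Sum>p | p permutes {..<k}. signof p * (\<Prod>i<k. pvar (if i = s then r else i, c (p i))))"
      unfolding det_def'[OF A] by (simp add: entry atLeast0LessThan)
    moreover have "det A = 0"
      by (rule det_identical_rows[OF A, of r s])
        (use rs True in \<open>auto simp: A_def intro!: eq_vecI\<close>)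
    ultimately show ?thesis
      using True by (simp add: minor_eq_sum mat_act_sum mat_act_signof_times prod)
  qed
qed

text \<open>All other permutations give strictly lighter monomials, so nothing cancels the diagonal
  term, whose coefficient is 1.\<close>

lemma hw_lead_minor:
  assumes c: "\<And>i j. i < j \<Longrightarrow> j < k \<Longrightarrow> c i < c j" "\<And>i. i < k \<Longrightarrow> c i < n" and k: "k \<le> n" and B: "2 \<le> B"
  shows "hw_lead B n (minor k c) (minor_mono k c id)"
proof -
  define a where "a = minor_mono k c"
  have less: "lexwt B n (a p) < lexwt B n (a id)" if "p permutes {..<k}" "p \<noteq> id" for p
    unfolding a_def by (rule lexwt_minor_mono_less) (use assms that in auto)
  have lookup: "lookup (minor k c) m = (\<Sum>p | p permutes {..<k}. of_int (sign p) * (if a p = m then 1 else 0))" for m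
    unfolding minor_eq_sum lookup_sum lookup_signof_times
    by (rule sum.cong) (auto simp: lookup_single when_def a_def)
  have keys: "\<exists>p. p permutes {..<k} \<and> m = a p" if "m \<in> keys (minor k c)" for m
  proof (rule ccontr)
    assume "\<not> ?thesis"
    then have "lookup (minor k c) m = 0"
      unfolding lookup by (intro sum.neutral) auto
    then show False using that by (simp add: in_keys_iff)
  qed
  have "lookup (minor k c) (a id) = (\<Sum>p | p permutes {..<k}. if p = id then 1 else 0)"
    unfolding lookup
  proof (rule sum.cong)
    fix p assume "p \<in> {p. p permutes {..<k}}"
    then show "of_int (sign p) * (if a p = a id then 1 else 0) = (if p = id then 1 else 0 :: complex)"
      using less[of p] by (cases "p = id") (auto simp: sign_id)
  qed simp
  also have "\<dots> = 1" by (simp add: finite_permutations permutes_id)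
  finally have "is_lead (lexwt B n) (minor k c) (a id)"
    unfolding is_lead_def using keys less by (fastforce simp: in_keys_iff)
  moreover have "a p \<in> grid_monos n (a id)" if "p permutes {..<k}" for p
    unfolding a_def by (rule minor_mono_in_grid_monos) (use c(2) k that in auto)
  then have "keys (minor k c) \<subseteq> grid_monos n (a id)"
    using keys by blast
  moreover have "mat_act n i j (minor k c) = 0" if "i < j" "j < n" for i j
    by (rule minor_raising) (use c(2) that in auto)
  ultimately show ?thesis by (simp add: hw_lead_def a_def)
qed

section \<open>Kostka numbers\<close>

lemma cells_eq: "cells lam = Sigma {..<length lam} (\<lambda>r. {..<lam ! r})"
  by (auto simp: cells_def)

lemma finite_cells: "finite (cells lam)"
  by (simp add: cells_eq)

lemma finite_semistandard_tableaux: "finite (semistandard_tableaux lam mu)"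
proof (rule finite_subset)
  show "semistandard_tableaux lam mu \<subseteq> cells lam \<rightarrow>\<^sub>E {..<length mu}"
    by (auto simp: semistandard_tableaux_def)
qed (simp add: finite_PiE finite_cells)

lemma card_cells_value:
  "card {x \<in> cells lam. T x = k} = (\<Sum>r<length lam. card {c. c < lam ! r \<and> T (r, c) = k})"
proof -
  have "{x \<in> cells lam. T x = k} = Sigma {..<length lam} (\<lambda>r. {c. c < lam ! r \<and> T (r, c) = k})"
    by (auto simp: cells_def)
  then show ?thesis by simp
qed

lemma tableau_column_strict:
  assumes lam: "sorted_wrt (\<ge>) lam" and T: "T \<in> semistandard_tableaux lam mu"
    and ij: "i < j" "(j, c) \<in> cells lam"
  shows "T (i, c) < T (j, c)"
proof -
  have up: "(i', c) \<in> cells lam" if "i' \<le> j" for i'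
  proof -
    have "lam ! j \<le> lam ! i'"
      using lam that ij by (cases "i' = j") (auto simp: sorted_wrt_iff_nth_less cells_def)
    then show ?thesis using ij that by (auto simp: cells_def)
  qed
  have "T (i, c) < T (i + Suc d, c)" if "i + Suc d \<le> j" for d
    using that
  proof (induction d)
    case 0
    then show ?case using T up[of i] up[of "Suc i"] by (auto simp: semistandard_tableaux_def)
  next
    case (Suc d)
    have "T (i + Suc d, c) < T (Suc (i + Suc d), c)"
      using T up[of "i + Suc d"] up[of "Suc (i + Suc d)"] Suc.prems by (auto simp: semistandard_tableaux_def)
    then show ?case using Suc by simp
  qed
  from this[of "j - Suc i"] show ?thesis using ij(1) by simp
qed

lemma tableau_row_mono:
  assumes T: "T \<in> semistandard_tableaux lam mu" and c: "c \<le> d" "d < lam ! r" "r < length lam"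
  shows "T (r, c) \<le> T (r, d)"
proof -
  have "T (r, c) \<le> T (r, c + e)" if "c + e < lam ! r" for e
    using that
  proof (induction e)
    case (Suc e)
    then have "T (r, c + e) \<le> T (r, Suc (c + e))"
      using T c(3) by (auto simp: semistandard_tableaux_def cells_def)
    then show ?case using Suc by simp
  qed simp
  from this[of "d - c"] show ?thesis using c by simp
qed

text \<open>The first column has more than \<open>n\<close> cells, and strict increase forces the
  entry in row \<open>i\<close> to be at least \<open>i\<close>; in row \<open>n\<close> no value
  below \<open>n\<close> is left.\<close>

lemma kostka_eq_0:
  assumes lam: "is_partition_of lam N" and n: "n < length lam" "length mu = n"
  shows "kostka lam mu = 0"
proof -
  have "False" if T: "T \<in> semistandard_tableaux lam mu" for T
  proof -
    have cell: "(i, 0) \<in> cells lam" if "i \<le> n" for i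
      using lam n that by (auto simp: cells_def is_partition_of_def)
    have "i \<le> T (i, 0)" if "i \<le> n" for i
      using that
    proof (induction i)
      case (Suc i)
      have "T (i, 0) < T (Suc i, 0)"
        using tableau_column_strict[OF _ T lessI cell[OF Suc.prems]] lam by (simp add: is_partition_of_def)
      then show ?case using Suc by simp
    qed simp
    moreover have "T (n, 0) < n"
      using T cell[of n] n by (auto simp: semistandard_tableaux_def)
    ultimately show False by (metis le_refl not_le)
  qed
  then have "semistandard_tableaux lam mu = {}" by blast
  then show ?thesis by (simp add: kostka_def)
qed

text \<open>Weak monotonicity means that the lists of values are sorted, and a sorted list is
  determined by its multiset.\<close>

lemma eq_if_mono_counts:
  fixes f g :: "nat \<Rightarrow> nat"
  assumes "\<And>c d. c \<le> d \<Longrightarrow> d < L \<Longrightarrow> f c \<le> f d" "\<And>c d. c \<le> d \<Longrightarrow> d < L \<Longrightarrow> g c \<le> g d"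
    and counts: "\<And>k. card {c. c < L \<and> f c = k} = card {c. c < L \<and> g c = k}" and "c < L"
  shows "f c = g c"
proof -
  have count: "count (mset (map h [0..<L])) k = card {c. c < L \<and> h c = k}" for h :: "nat \<Rightarrow> nat" and k
    by (simp add: count_image_mset') (rule arg_cong[where f = card], auto)
  have "mset (map f [0..<L]) = mset (map g [0..<L])"
    by (rule multiset_eqI) (simp only: count counts)
  moreover have "sorted (map f [0..<L])" "sorted (map g [0..<L])"
    using assms(1,2) by (auto simp: sorted_iff_nth_mono)
  ultimately have "map f [0..<L] = map g [0..<L]"
    by (metis properties_for_sort)
  then show ?thesis using \<open>c < L\<close> by simp
qed

text \<open>The exponent at \<open>(r, k)\<close> is the number of entries \<open>k\<close> in row
  \<open>r\<close>. It is also the product of the diagonal terms of the minors given by the columns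
  of \<open>T\<close>.\<close>

definition tableau_mono :: "nat list \<Rightarrow> (nat \<times> nat \<Rightarrow> nat) \<Rightarrow> (nat \<times> nat \<Rightarrow>\<^sub>0 nat)" where
  "tableau_mono lam T = (\<Sum>x\<in>cells lam. expo (fst x, T x))"

lemma lookup_tableau_mono:
  "lookup (tableau_mono lam T) (r, k) = card {c. (r, c) \<in> cells lam \<and> T (r, c) = k}"
proof -
  have "lookup (tableau_mono lam T) (r, k) = (\<Sum>x\<in>cells lam. if fst x = r \<and> T x = k then 1 else 0)"
    unfolding tableau_mono_def lookup_sum by (rule sum.cong) (auto simp: lookup_single when_def)
  also have "\<dots> = card {x \<in> cells lam. fst x = r \<and> T x = k}"
    using finite_cells by (simp add: sum.If_cases Int_def)
  also have "{x \<in> cells lam. fst x = r \<and> T x = k} = Pair r ` {c. (r, c) \<in> cells lam \<and> T (r, c) = k}"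
    by auto
  finally show ?thesis by (simp add: card_image inj_on_def)
qed

lemma inj_on_tableau_mono: "inj_on (tableau_mono lam) (semistandard_tableaux lam mu)"
proof (rule inj_onI, rule ext)
  fix T T' x
  assume T: "T \<in> semistandard_tableaux lam mu" and T': "T' \<in> semistandard_tableaux lam mu"
    and eq: "tableau_mono lam T = tableau_mono lam T'"
  show "T x = T' x"
  proof (cases "x \<in> cells lam")
    case True
    then obtain r c where x: "x = (r, c)" "r < length lam" "c < lam ! r" by (auto simp: cells_def)
    have "card {c. c < lam ! r \<and> T (r, c) = k} = card {c. c < lam ! r \<and> T' (r, c) = k}" for k
      using arg_cong[OF eq, of "\<lambda>m. lookup m (r, k)"] x by (simp add: lookup_tableau_mono cells_def)
    moreover have "T (r, c) \<le> T (r, d)" "T' (r, c) \<le> T' (r, d)" if "c \<le> d" "d < lam ! r" for c d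
      using tableau_row_mono[OF T that x(2)] tableau_row_mono[OF T' that x(2)] .
    ultimately show ?thesis
      unfolding x(1)
      using eq_if_mono_counts[of "lam ! r" "\<lambda>c. T (r, c)" "\<lambda>c. T' (r, c)" c] x(3) by blast
  next
    case False
    then show ?thesis using T T' by (cases x) (simp add: semistandard_tableaux_def PiE_iff extensional_def)
  qed
qed

text \<open>The bideterminant of \<open>T\<close> is the witness: column \<open>c\<close> of
  \<open>T\<close> contributes the minor on the first \<open>h c\<close> rows whose columns are the
  entries of that column. Strictness along columns makes the diagonal terms leading.\<close>

lemma tableau_mono_in_leads:
  assumes lam: "is_partition_of lam (n * l)" and len: "length lam \<le> n"
    and T: "T \<in> semistandard_tableaux lam (replicate n l)"
  shows "tableau_mono lam T \<in> leads (lexwt (l + 2) n) (hw_space n lam (col_space n l))"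
proof -
  \<comment> \<open>\<open>M\<close> is the number of columns of the diagram, with
    \<open>part\<close> giving 0 for the empty partition; \<open>h\<close> is the conjugate
    partition.\<close>
  define M where "M = part lam 0"
  define h where "h c = card {r. (r, c) \<in> cells lam}" for c
  have sorted: "sorted_wrt (\<ge>) lam" using lam by (simp add: is_partition_of_def)
  have h: "(r, c) \<in> cells lam \<longleftrightarrow> r < h c" for r c
  proof -
    have fin: "finite {r. (r, c) \<in> cells lam}"
      by (rule finite_subset[of _ "{..<length lam}"]) (auto simp: cells_def)
    have up: "(i, c) \<in> cells lam" if "i \<le> j" "(j, c) \<in> cells lam" for i j
    proof -
      have "lam ! j \<le> lam ! i"
        using sorted that by (cases "i = j") (auto simp: sorted_wrt_iff_nth_less cells_def)
      then show ?thesis using that by (auto simp: cells_def)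
    qed
    show ?thesis
    proof
      assume r: "(r, c) \<in> cells lam"
      then have "{..r} \<subseteq> {r. (r, c) \<in> cells lam}" using up by auto
      from card_mono[OF fin this] show "r < h c" by (simp add: h_def)
    next
      assume r: "r < h c"
      show "(r, c) \<in> cells lam"
      proof (rule ccontr)
        assume "(r, c) \<notin> cells lam"
        then have "{r. (r, c) \<in> cells lam} \<subseteq> {..<r}" using up by (auto simp: not_less[symmetric])
        from card_mono[OF _ this] show False using r by (simp add: h_def)
      qed
    qed
  qed
  have hn: "h c \<le> n" for c
  proof (rule ccontr)
    assume "\<not> h c \<le> n"
    then have "(n, c) \<in> cells lam" by (simp add: h)
    then show False using len by (simp add: cells_def)
  qed
  have cells: "cells lam = (\<lambda>(c, r). (r, c)) ` Sigma {..<M} (\<lambda>c. {..<h c})"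
  proof -
    have "c < M" if "(r, c) \<in> cells lam" for r c
    proof -
      have "(0, c) \<in> cells lam" using that by (simp add: h)
      then show ?thesis by (auto simp: M_def part_def cells_def)
    qed
    then show ?thesis using h by (auto simp: image_def)
  qed
  have T_less: "T (r, c) < n" if "r < h c" for r c
    using T that by (auto simp: semistandard_tableaux_def simp flip: h)
  define f where "f = (\<Prod>c<M. minor (h c) (\<lambda>i. T (i, c)))"
  define a where "a = tableau_mono lam T"
  have "(\<Sum>c<M. minor_mono (h c) (\<lambda>i. T (i, c)) id) = a"
  proof -
    have "a = (\<Sum>x\<in>Sigma {..<M} (\<lambda>c. {..<h c}). expo (snd x, T (snd x, fst x)))"
      unfolding a_def tableau_mono_def cells
      by (subst sum.reindex) (auto simp: inj_on_def case_prod_beta)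
    then show ?thesis
      by (simp add: minor_mono_def sum.Sigma case_prod_beta)
  qed
  moreover have "hw_lead (l + 2) n f (\<Sum>c<M. minor_mono (h c) (\<lambda>i. T (i, c)) id)"
    unfolding f_def
  proof (intro hw_lead_prod hw_lead_minor)
    show "T (i, c) < T (j, c)" if "i < j" "j < h c" for i j c
      using tableau_column_strict[OF sorted T that(1)] that(2) h by blast
  qed (use hn T_less in auto)
  ultimately have f: "hw_lead (l + 2) n f a" by simp
  have row: "rowsum n r a = part lam r" if "r < n" for r
  proof -
    have "rowsum n r a = (\<Sum>x\<in>cells lam. rowsum n r (expo (fst x, T x)))"
      unfolding a_def tableau_mono_def rowsum_def lookup_sum by (rule sum.swap)
    also have "\<dots> = (\<Sum>x\<in>cells lam. if fst x = r then 1 else 0)"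
      using T_less h by (intro sum.cong) (auto simp: rowsum_expo)
    also have "\<dots> = (\<Sum>i<length lam. \<Sum>c<lam ! i. if i = r then 1 else 0)"
      unfolding cells_eq by (subst sum.Sigma) (auto simp: case_prod_beta)
    also have "\<dots> = (\<Sum>i<length lam. if i = r then lam ! r else 0)"
      by (rule sum.cong) auto
    finally show ?thesis by (simp add: part_def)
  qed
  have col: "colsum n k a = l" if k: "k < n" for k
  proof -
    have "colsum n k a = (\<Sum>x\<in>cells lam. colsum n k (expo (fst x, T x)))"
      unfolding a_def tableau_mono_def colsum_def lookup_sum by (rule sum.swap)
    also have "\<dots> = (\<Sum>x\<in>cells lam. if T x = k then 1 else 0)"
      using len by (intro sum.cong) (auto simp: colsum_expo cells_def)
    also have "\<dots> = card {x \<in> cells lam. T x = k}"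
      using finite_cells by (simp add: sum.If_cases Int_def)
    finally show ?thesis
      using T k by (simp add: semistandard_tableaux_def)
  qed
  have keys_f: "keys f \<subseteq> grid_monos n a" using f by (simp add: hw_lead_def)
  then have "f \<in> col_space n l"
    using col by (auto simp: col_space_def col_monos_def grid_monos_def)
  moreover have "mat_act n i i f = cscale (of_nat (part lam i)) f" if "i < n" for i
  proof (rule poly_mapping_eqI)
    fix m
    show "lookup (mat_act n i i f) m = lookup (cscale (of_nat (part lam i)) f) m"
    proof (cases "m \<in> keys f")
      case True
      then have "rowsum n i m = part lam i" using keys_f row that by (auto simp: grid_monos_def)
      then show ?thesis by (simp add: mat_act_diagonal)
    qed (simp add: mat_act_diagonal in_keys_iff)
  qed
  ultimately have "f \<in> hw_space n lam (col_space n l)"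
    using f by (simp add: hw_space_def hw_lead_def)
  then show ?thesis
    using f by (auto simp: leads_def hw_lead_def a_def)
qed

text \<open>Row \<open>r\<close> of this tableau contains \<open>lookup m (r, k)\<close> entries \<open>k\<close>, in increasing order.\<close>

definition mono_tableau :: "(nat \<times> nat \<Rightarrow>\<^sub>0 nat) \<Rightarrow> nat \<times> nat \<Rightarrow> nat" where
  "mono_tableau m = (\<lambda>(r, c). LEAST k. c < (\<Sum>j<Suc k. lookup m (r, j)))"

text \<open>The partial sums cut the row into consecutive intervals, one per value; the bound on
  \<open>c\<close> guarantees that the \<open>LEAST\<close> in the definition exists.\<close>

lemma mono_tableau_eq_iff:
  "c < (\<Sum>j<n. lookup m (r, j)) \<Longrightarrow>
    mono_tableau m (r, c) = k \<longleftrightarrow> (\<Sum>j<k. lookup m (r, j)) \<le> c \<and> c < (\<Sum>j<Suc k. lookup m (r, j))"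
proof -
  define S where "S k = (\<Sum>j<k. lookup m (r, j))" for k
  assume c: "c < (\<Sum>j<n. lookup m (r, j))"
  have S_mono: "S i \<le> S j" if "i \<le> j" for i j
    unfolding S_def using that by (intro sum_mono2) auto
  define k\<^sub>0 where "k\<^sub>0 = mono_tableau m (r, c)"
  have k0: "k\<^sub>0 = (LEAST k. c < S (Suc k))"
    by (simp add: k\<^sub>0_def mono_tableau_def S_def)
  have "c < S n" using c by (simp add: S_def)
  then have "c < S (Suc n)" using S_mono[of n "Suc n"] by simp
  then have 1: "c < S (Suc k\<^sub>0)" unfolding k0 by (rule LeastI)
  have 2: "S k\<^sub>0 \<le> c"
  proof (cases k\<^sub>0)
    case 0
    then show ?thesis by (simp add: S_def)
  next
    case (Suc i)
    then have "i < (LEAST k. c < S (Suc k))" using k0 by simp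
    from not_less_Least[OF this] show ?thesis using Suc by simp
  qed
  have "k\<^sub>0 = k \<longleftrightarrow> S k \<le> c \<and> c < S (Suc k)"
  proof
    assume "S k \<le> c \<and> c < S (Suc k)"
    then have "S k < S (Suc k\<^sub>0)" "S k\<^sub>0 < S (Suc k)" using 1 2 by auto
    then have "\<not> Suc k\<^sub>0 \<le> k" "\<not> Suc k \<le> k\<^sub>0" using S_mono not_less by blast+
    then show "k\<^sub>0 = k" by simp
  qed (use 1 2 in auto)
  then show ?thesis by (simp add: k\<^sub>0_def S_def)
qed

text \<open>The weight makes the row sums of \<open>m\<close> the parts of \<open>lam\<close>, the
  column degrees give the content, and \<open>lead_horizontal_strip\<close> is strictness along
  columns. The second and third claims let \<open>m\<close> be recovered from its tableau.\<close>

lemma lead_is_tableau: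
  assumes lam: "is_partition_of lam (n * l)" and len: "length lam \<le> n"
    and m: "m \<in> leads (lexwt (l + 2) n) (hw_space n lam (col_space n l))"
  shows "restrict (mono_tableau m) (cells lam) \<in> semistandard_tableaux lam (replicate n l)"
    and "i < n \<Longrightarrow> k < n \<Longrightarrow> lookup m (i, k) =
      card {c. (i, c) \<in> cells lam \<and> restrict (mono_tableau m) (cells lam) (i, c) = k}"
    and "m \<in> col_monos n l"
proof -
  obtain f where f: "f \<in> hw_space n lam (col_space n l)" "is_lead (lexwt (l + 2) n) f m"
    using m by (auto simp: leads_def)
  have mf: "m \<in> keys f" using f(2) by (simp add: is_lead_def)
  then show m_col: "m \<in> col_monos n l"
    using f(1) by (auto simp: hw_space_def col_space_def)
  have row: "(\<Sum>j<n. lookup m (i, j)) = part lam i" if "i < n" for i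
  proof -
    have "mat_act n i i f = cscale (of_nat (part lam i)) f"
      using f(1) that by (simp add: hw_space_def)
    from arg_cong[OF this, of "\<lambda>p. lookup p m"] have "rowsum n i m = part lam i"
      using mf by (simp add: mat_act_diagonal in_keys_iff)
    then show ?thesis by (simp add: rowsum_def)
  qed
  define T where "T = mono_tableau m"
  have T: "T (r, c) = k \<longleftrightarrow> (\<Sum>j<k. lookup m (r, j)) \<le> c \<and> c < (\<Sum>j<Suc k. lookup m (r, j))"
    if "(r, c) \<in> cells lam" for r c k
  proof -
    have "c < (\<Sum>j<n. lookup m (r, j))"
      using row[of r] len that by (auto simp: cells_def part_def)
    then show ?thesis unfolding T_def by (rule mono_tableau_eq_iff)
  qed
  have S_mono: "(\<Sum>j<i. lookup m (r, j)) \<le> (\<Sum>j<k. lookup m (r, j))" if "i \<le> k" for i k r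
    using that by (intro sum_mono2) auto
  have T_less: "T (r, c) < n" if cell: "(r, c) \<in> cells lam" for r c
  proof (rule ccontr)
    assume "\<not> ?thesis"
    then have "(\<Sum>j<n. lookup m (r, j)) \<le> (\<Sum>j<T (r, c). lookup m (r, j))"
      by (intro S_mono) simp
    also have "\<dots> \<le> c" using T[OF cell, of "T (r, c)"] by blast
    finally show False
      using row[of r] len cell by (auto simp: cells_def part_def)
  qed
  have count: "card {c. (i, c) \<in> cells lam \<and> T (i, c) = k} = lookup m (i, k)" if ik: "i < n" "k < n" for i k
  proof (cases "i < length lam")
    case True
    have "(\<Sum>j<Suc k. lookup m (i, j)) \<le> (\<Sum>j<n. lookup m (i, j))"
      using ik by (intro S_mono) simp
    also have "\<dots> = lam ! i" using row[OF ik(1)] True by (simp add: part_def)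
    finally have le: "(\<Sum>j<Suc k. lookup m (i, j)) \<le> lam ! i" .
    have "{c. (i, c) \<in> cells lam \<and> T (i, c) = k} =
        {(\<Sum>j<k. lookup m (i, j))..<(\<Sum>j<Suc k. lookup m (i, j))}"
    proof (rule Set.set_eqI)
      fix c
      show "c \<in> {c. (i, c) \<in> cells lam \<and> T (i, c) = k} \<longleftrightarrow>
          c \<in> {(\<Sum>j<k. lookup m (i, j))..<(\<Sum>j<Suc k. lookup m (i, j))}"
      proof (cases "(i, c) \<in> cells lam")
        case True
        then show ?thesis using T[OF True, of k] by simp
      next
        case False
        then have "\<not> c < (\<Sum>j<Suc k. lookup m (i, j))"
          using le \<open>i < length lam\<close> by (auto simp: cells_def)
        then show ?thesis using False by simp
      qed
    qed
    then show ?thesis by simp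
  next
    case False
    then have "(\<Sum>j<n. lookup m (i, j)) = 0" using row[OF ik(1)] by (simp add: part_def)
    then have "lookup m (i, k) = 0" using ik by simp
    then show ?thesis using False by (simp add: cells_def)
  qed
  have "{c. (i, c) \<in> cells lam \<and> restrict T (cells lam) (i, c) = k} = {c. (i, c) \<in> cells lam \<and> T (i, c) = k}" for i k
    by auto
  then show "lookup m (i, k) = card {c. (i, c) \<in> cells lam \<and> restrict (mono_tableau m) (cells lam) (i, c) = k}"
    if "i < n" "k < n"
    using count[OF that] by (simp add: T_def)
  show "restrict (mono_tableau m) (cells lam) \<in> semistandard_tableaux lam (replicate n l)"
    unfolding semistandard_tableaux_def T_def[symmetric]
  proof (intro CollectI conjI allI impI)
    show "restrict T (cells lam) \<in> cells lam \<rightarrow>\<^sub>E {..<length (replicate n l)}"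
      using T_less by auto
    fix r c assume rc: "(r, c) \<in> cells lam \<and> (r, Suc c) \<in> cells lam"
    have "T (r, c) \<le> T (r, Suc c)"
    proof (rule ccontr)
      assume "\<not> ?thesis"
      then have "(\<Sum>j<Suc (T (r, Suc c)). lookup m (r, j)) \<le> (\<Sum>j<T (r, c). lookup m (r, j))"
        by (intro S_mono) simp
      also have "\<dots> \<le> c" using T[of r c "T (r, c)"] rc by blast
      finally show False using T[of r "Suc c" "T (r, Suc c)"] rc by auto
    qed
    then show "restrict T (cells lam) (r, c) \<le> restrict T (cells lam) (r, Suc c)"
      using rc by simp
  next
    fix r c assume rc: "(r, c) \<in> cells lam \<and> (Suc r, c) \<in> cells lam"
    define k where "k = T (Suc r, c)"
    have k: "k < n" unfolding k_def using T_less rc by blast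
    have "Suc r < n" using rc len by (auto simp: cells_def)
    \<comment> \<open>Cell \<open>c\<close> of row \<open>Suc r\<close> lies among the entries up to
      \<open>k\<close>; by the strip inequality cell \<open>c\<close> of row \<open>r\<close> then
      lies among the entries below \<open>k\<close>.\<close>
    have "c < (\<Sum>j<Suc k. lookup m (Suc r, j))"
      using T[of "Suc r" c k] rc by (auto simp: k_def)
    also have "\<dots> \<le> (\<Sum>j<k. lookup m (r, j))"
      using lead_horizontal_strip[OF f \<open>Suc r < n\<close> k] by simp
    finally have "\<not> k \<le> T (r, c)"
      using S_mono[of k "T (r, c)" r] T[of r c "T (r, c)"] rc by auto
    then show "restrict T (cells lam) (r, c) < restrict T (cells lam) (Suc r, c)"
      using rc by (simp add: k_def)
  next
    fix k assume "k < length (replicate n l)"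
    then have k: "k < n" by simp
    have "card {x \<in> cells lam. restrict T (cells lam) x = k} = card {x \<in> cells lam. T x = k}"
      by (rule arg_cong[where f = card]) auto
    also have "\<dots> = (\<Sum>r<length lam. lookup m (r, k))"
      unfolding card_cells_value
    proof (rule sum.cong)
      fix r assume "r \<in> {..<length lam}"
      then show "card {c. c < lam ! r \<and> T (r, c) = k} = lookup m (r, k)"
        using count[of r k] k len by (simp add: cells_def)
    qed simp
    also have "\<dots> = (\<Sum>r<n. lookup m (r, k))"
    proof (rule sum.mono_neutral_left)
      show "\<forall>i\<in>{..<n} - {..<length lam}. lookup m (i, k) = 0"
      proof
        fix i assume "i \<in> {..<n} - {..<length lam}"
        then show "lookup m (i, k) = 0" using count[of i k] k by (simp add: cells_def)
      qed
    qed (use len in auto)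
    also have "\<dots> = l"
      using m_col k by (simp add: col_monos_def colsum_def)
    finally show "card {x \<in> cells lam. restrict T (cells lam) x = k} = replicate n l ! k"
      using k by simp
  qed
qed

text \<open>Two injections between finite sets: tableaux give leading exponents by bideterminants,
  and leading exponents give tableaux by writing out their rows in increasing order.\<close>

lemma dim_hw_space:
  assumes lam: "is_partition_of lam (n * l)" and len: "length lam \<le> n"
  shows "cvec.dim (hw_space n lam (col_space n l)) = kostka lam (replicate n l)"
proof -
  define H where "H = hw_space n lam (col_space n l)"
  define L where "L = leads (lexwt (l + 2) n) H"
  have H: "cvec.subspace H" "H \<subseteq> {p. keys p \<subseteq> col_monos n l}"
    unfolding H_def by (intro subspace_hw_space subspace_col_space) (auto simp: hw_space_def col_space_def)
  have "L \<subseteq> col_monos n l"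
    unfolding L_def by (rule leads_subset[OF H(2)])
  then have fin: "finite L" using finite_col_monos finite_subset by blast
  have "card (semistandard_tableaux lam (replicate n l)) \<le> card L"
    using tableau_mono_in_leads[OF lam len]
    by (intro card_inj_on_le[OF inj_on_tableau_mono _ fin]) (auto simp: L_def H_def)
  moreover have "card L \<le> card (semistandard_tableaux lam (replicate n l))"
  proof (rule card_inj_on_le[OF _ _ finite_semistandard_tableaux])
    note tab = lead_is_tableau[OF lam len, folded H_def, folded L_def]
    show "(\<lambda>m. restrict (mono_tableau m) (cells lam)) ` L \<subseteq> semistandard_tableaux lam (replicate n l)"
      using tab(1) by blast
    show "inj_on (\<lambda>m. restrict (mono_tableau m) (cells lam)) L"
    proof (rule inj_onI, rule poly_mapping_eqI)
      fix m m' and x :: "nat \<times> nat"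
      assume m: "m \<in> L" "m' \<in> L"
        and eq: "restrict (mono_tableau m) (cells lam) = restrict (mono_tableau m') (cells lam)"
      obtain i k where x: "x = (i, k)" by (cases x)
      show "lookup m x = lookup m' x"
      proof (cases "i < n \<and> k < n")
        case True
        then show ?thesis
          using tab(2)[OF m(1)] tab(2)[OF m(2)] eq by (simp add: x)
      next
        case False
        then have "x \<notin> keys m" "x \<notin> keys m'"
          using tab(3) m by (auto simp: x col_monos_def)
        then show ?thesis by (simp add: in_keys_iff)
      qed
    qed
  qed
  ultimately show ?thesis
    using dim_eq_card_leads[OF finite_col_monos inj_on_lexwt_col_monos H]
    by (simp add: kostka_def L_def H_def)
qed

lemma gl_multiplicity_col_space:
  assumes lam: "is_partition_of lam (n * l)"
  shows "gl_multiplicity n (mat_act n) (col_space n l) lam = kostka lam (replicate n l)"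
proof (cases "length lam \<le> n")
  case True
  have "col_space n l \<subseteq> {p. keys p \<subseteq> col_monos n l}"
    by (simp add: col_space_def)
  from gl_multiplicity_eq_dim[OF finite_col_monos gl_module_col_space this True]
  show ?thesis by (simp add: dim_hw_space[OF lam True])
next
  case False
  then show ?thesis
    using kostka_eq_0[OF lam, of n] by (simp add: gl_multiplicity_def)
qed

section \<open>The tensor power of the symmetric power\<close>

definition sym_monos :: "nat \<Rightarrow> nat \<Rightarrow> (nat \<Rightarrow>\<^sub>0 nat) set" where
  "sym_monos n l = {b. keys b \<subseteq> {..<n} \<and> (\<Sum>x<n. lookup b x) = l}"

definition tensor_monos :: "nat \<Rightarrow> nat \<Rightarrow> (nat \<Rightarrow>\<^sub>0 nat) list set" where
  "tensor_monos n l = {bs. length bs = n \<and> set bs \<subseteq> sym_monos n l}"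

lemma sym_power_eq: "sym_power n l = {p. keys p \<subseteq> sym_monos n l}"
proof -
  have "(\<Sum>x\<in>keys m. lookup m x) = (\<Sum>x<n. lookup m x)" if "keys m \<subseteq> {..<n}" for m :: "nat \<Rightarrow>\<^sub>0 nat"
    using that by (intro sum.mono_neutral_left) (auto simp: in_keys_iff)
  then show ?thesis
    by (auto simp: sym_power_def sym_monos_def)
qed

text \<open>A zero coefficient is allowed: then \<open>single b 0\<close> has no keys, so the sum in
  \<open>pure_tensor\<close> is empty, matching the vanishing product on the right.\<close>

lemma pure_tensor_singles:
  "pure_tensor (map (\<lambda>(b, c). single b c) xs) = single (map fst xs) (prod_list (map snd xs))"
proof (cases "\<forall>(b, c)\<in>set xs. c \<noteq> 0")
  case True
  then have "listset (map keys (map (\<lambda>(b, c). single b c) xs)) = {map fst xs}"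
    by (induction xs) (auto simp: set_Cons_def)
  moreover have "(\<Prod>p<length xs. lookup (map (\<lambda>(b, c). single b c) xs ! p) (map fst xs ! p)) =
      prod_list (map snd xs)"
    by (subst prod.list_conv_set_nth) (auto simp: case_prod_beta atLeast0LessThan intro!: prod.cong)
  ultimately show ?thesis by (simp add: pure_tensor_def)
next
  case False
  then have "listset (map keys (map (\<lambda>(b, c). single b c) xs)) = {}"
    by (induction xs) (auto simp: set_Cons_def)
  moreover have "prod_list (map snd xs) = 0"
    using False by (force simp: prod_list_zero_iff)
  ultimately show ?thesis by (simp add: pure_tensor_def del: prod_list_zero_iff)
qed

lemma pure_tensor_update:
  assumes "p < length bs"
  shows "pure_tensor ((map (\<lambda>b. single b 1) bs)[p := single b c]) = single (bs[p := b]) c"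
proof -
  define xs where "xs = (map (\<lambda>b. (b, 1 :: complex)) bs)[p := (b, c)]"
  have "map (\<lambda>(b, c). single b c) xs = (map (\<lambda>b. single b 1) bs)[p := single b c]"
    by (simp add: xs_def map_update comp_def)
  moreover have "map fst xs = bs[p := b]"
    by (simp add: xs_def map_update comp_def)
  moreover have "prod_list (map snd xs) = c"
  proof -
    have "map snd xs = (replicate (length bs) 1)[p := c]"
      by (simp add: xs_def map_update comp_def map_replicate_const)
    also have "\<dots> = replicate p 1 @ c # replicate (length bs - Suc p) 1"
      using assms by (simp add: upd_conv_take_nth_drop)
    finally show ?thesis by simp
  qed
  ultimately show ?thesis using pure_tensor_singles[of xs] by metis
qed

lemma listset_nth:
  "xs \<in> listset As \<longleftrightarrow> length xs = length As \<and> (\<forall>i<length As. xs ! i \<in> As ! i)"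
proof (induction As arbitrary: xs)
  case (Cons A As)
  show ?case
  proof (cases xs)
    case (Cons y ys)
    have "xs \<in> listset (A # As) \<longleftrightarrow> y \<in> A \<and> ys \<in> listset As"
      by (simp add: Cons set_Cons_def)
    also have "\<dots> \<longleftrightarrow> length xs = length (A # As) \<and> (\<forall>i<length (A # As). xs ! i \<in> (A # As) ! i)"
      unfolding Cons.IH by (auto simp: Cons nth_Cons less_Suc_eq_0_disj split: nat.split)
    finally show ?thesis .
  qed (simp add: set_Cons_def)
qed simp

text \<open>Pure tensors of monomials are the basis elements \<open>single bs 1\<close>, so the span
  is described by its supports alone.\<close>

lemma tensor_power_eq: "tensor_power n (sym_power n l) = {t. keys t \<subseteq> tensor_monos n l}"
proof
  show "tensor_power n (sym_power n l) \<subseteq> {t. keys t \<subseteq> tensor_monos n l}"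
    unfolding tensor_power_def
  proof (rule cvec.span_minimal[OF _ subspace_keys], intro subsetI CollectI)
    fix t bs
    assume "t \<in> {pure_tensor vs |vs. length vs = n \<and> set vs \<subseteq> sym_power n l}" and "bs \<in> keys t"
    then obtain vs where vs: "length vs = n" "set vs \<subseteq> sym_power n l"
      and bs: "bs \<in> keys (pure_tensor vs)" by blast
    have "bs \<in> listset (map keys vs)"
    proof (rule ccontr)
      assume not_in: "\<not> ?thesis"
      have "lookup (pure_tensor vs) bs = 0"
        unfolding pure_tensor_def lookup_sum
        by (rule sum.neutral) (use not_in in \<open>auto simp: lookup_single when_def\<close>)
      then show False using bs by (simp add: in_keys_iff)
    qed
    then have bs: "length bs = n" "\<And>i. i < n \<Longrightarrow> bs ! i \<in> keys (vs ! i)"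
      using vs by (auto simp: listset_nth)
    have "bs ! i \<in> sym_monos n l" if "i < n" for i
    proof -
      have "vs ! i \<in> sym_power n l" using vs that by auto
      then show ?thesis using bs(2)[OF that] by (auto simp: sym_power_eq)
    qed
    then show "bs \<in> tensor_monos n l"
      using bs(1) vs by (auto simp: tensor_monos_def in_set_conv_nth)
  qed
  have singles: "single bs 1 \<in> tensor_power n (sym_power n l)" if "bs \<in> tensor_monos n l" for bs
  proof -
    have "single bs 1 = pure_tensor (map (\<lambda>(b, c). single b c) (map (\<lambda>b. (b, 1)) bs))"
      unfolding pure_tensor_singles by (simp add: comp_def map_replicate_const)
    also have "\<dots> = pure_tensor (map (\<lambda>b. single b 1) bs)"
      by (simp add: comp_def)
    also have "\<dots> \<in> tensor_power n (sym_power n l)"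
      unfolding tensor_power_def
    proof (intro cvec.span_base CollectI exI conjI)
      have "single b (1 :: complex) \<in> sym_power n l" if "b \<in> set bs" for b
      proof -
        have "b \<in> sym_monos n l"
          using \<open>bs \<in> tensor_monos n l\<close> that unfolding tensor_monos_def by blast
        then show ?thesis by (simp add: sym_power_eq)
      qed
      then show "set (map (\<lambda>b. single b (1 :: complex)) bs) \<subseteq> sym_power n l" by auto
      show "length (map (\<lambda>b. single b (1 :: complex)) bs) = n"
        using that by (simp add: tensor_monos_def)
    qed (rule refl)
    finally show ?thesis .
  qed
  show "{t. keys t \<subseteq> tensor_monos n l} \<subseteq> tensor_power n (sym_power n l)"
  proof
    fix t :: "(nat \<Rightarrow>\<^sub>0 nat) list \<Rightarrow>\<^sub>0 complex"
    assume t: "t \<in> {t. keys t \<subseteq> tensor_monos n l}"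
    show "t \<in> tensor_power n (sym_power n l)"
    proof (rule in_subspace_if_singles[OF _ finite_keys order_refl])
      show "cvec.subspace (tensor_power n (sym_power n l))"
        unfolding tensor_power_def by (rule cvec.subspace_span)
      show "single bs 1 \<in> tensor_power n (sym_power n l)" if "bs \<in> keys t" for bs
        using singles t that by blast
    qed
  qed
qed

section \<open>Exponent matrices as lists of their columns\<close>

definition column :: "nat \<Rightarrow> (nat \<times> nat \<Rightarrow>\<^sub>0 nat) \<Rightarrow> nat \<Rightarrow> (nat \<Rightarrow>\<^sub>0 nat)" where
  "column n m k = (\<Sum>i<n. single i (lookup m (i, k)))"

text \<open>Column \<open>k\<close> of the matrix becomes the \<open>k\<close>-th tensor factor: the
  \<open>n\<close> columns of variables are \<open>n\<close> copies of the variables of one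
  symmetric power.\<close>

definition columns :: "nat \<Rightarrow> (nat \<times> nat \<Rightarrow>\<^sub>0 nat) \<Rightarrow> (nat \<Rightarrow>\<^sub>0 nat) list" where
  "columns n m = map (column n m) [0..<n]"

lemma lookup_column: "lookup (column n m k) i = (if i < n then lookup m (i, k) else 0)"
proof -
  have "lookup (column n m k) i = (\<Sum>i'<n. if i' = i then lookup m (i, k) else 0)"
    unfolding column_def lookup_sum by (rule sum.cong) (auto simp: lookup_single when_def)
  then show ?thesis by simp
qed

lemma length_columns [simp]: "length (columns n m) = n"
  by (simp add: columns_def)

lemma columns_nth [simp]: "k < n \<Longrightarrow> columns n m ! k = column n m k"
  by (simp add: columns_def)

lemma bij_betw_columns: "bij_betw (columns n) (col_monos n l) (tensor_monos n l)"
  unfolding bij_betw_def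
proof
  show "inj_on (columns n) (col_monos n l)"
  proof (rule inj_onI, rule poly_mapping_eqI)
    fix m m' and x :: "nat \<times> nat"
    assume m: "m \<in> col_monos n l" "m' \<in> col_monos n l" and eq: "columns n m = columns n m'"
    obtain i k where x: "x = (i, k)" by (cases x)
    show "lookup m x = lookup m' x"
    proof (cases "i < n \<and> k < n")
      case True
      then have "column n m k = column n m' k"
        using eq columns_nth by metis
      then have "lookup (column n m k) i = lookup (column n m' k) i" by (rule arg_cong)
      then show ?thesis
        using True by (simp add: x lookup_column)
    next
      case False
      then have "x \<notin> keys m" "x \<notin> keys m'" using m by (auto simp: x col_monos_def)
      then show ?thesis by (simp add: in_keys_iff)
    qed
  qed
  show "columns n ` col_monos n l = tensor_monos n l"
  proof
    have "column n m k \<in> sym_monos n l" if "m \<in> col_monos n l" "k < n" for m k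
      using that
      by (auto simp: sym_monos_def col_monos_def colsum_def lookup_column in_keys_iff split: if_splits)
    then show "columns n ` col_monos n l \<subseteq> tensor_monos n l"
      by (auto simp: tensor_monos_def columns_def)
    show "tensor_monos n l \<subseteq> columns n ` col_monos n l"
    proof
      fix bs assume bs: "bs \<in> tensor_monos n l"
      define m where "m = (\<Sum>x\<in>{..<n} \<times> {..<n}. single x (lookup (bs ! snd x) (fst x)))"
      have m: "lookup m (i, k) = (if i < n \<and> k < n then lookup (bs ! k) i else 0)" for i k
      proof -
        have "lookup m (i, k) =
            (\<Sum>x\<in>{..<n} \<times> {..<n}. if x = (i, k) then lookup (bs ! k) i else 0)"
          unfolding m_def lookup_sum by (rule sum.cong) (auto simp: lookup_single when_def)
        then show ?thesis by simp
      qed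
      have bk: "bs ! k \<in> sym_monos n l" if "k < n" for k
        using bs that by (auto simp: tensor_monos_def)
      have "columns n m = bs"
      proof (rule nth_equalityI)
        show "length (columns n m) = length bs" using bs by (simp add: tensor_monos_def)
        fix k assume "k < length (columns n m)"
        then have k: "k < n" by simp
        have "lookup (bs ! k) i = 0" if "\<not> i < n" for i
          using bk[OF k] that by (auto simp: sym_monos_def simp flip: not_in_keys_iff_lookup_eq_zero)
        then show "columns n m ! k = bs ! k"
          using k by (intro poly_mapping_eqI) (auto simp: lookup_column m)
      qed
      moreover have "m \<in> col_monos n l"
        using bk by (auto simp: col_monos_def in_keys_iff m colsum_def sym_monos_def split: if_splits)
      ultimately show "bs \<in> columns n ` col_monos n l" by blast
    qed
  qed
qed

lemma tensor_act_superset: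
  assumes "finite A" "keys t \<subseteq> A"
  shows "tensor_act e t = (\<Sum>bs\<in>A. cscale (lookup t bs) (tensor_act e (single bs 1)))"
proof -
  have "tensor_act e (single bs 1) = (\<Sum>p<length bs. pure_tensor
      ((map (\<lambda>b. single b 1) bs)[p := e (single (bs ! p) 1)]))" for bs
    by (simp add: tensor_act_def)
  then have "tensor_act e t = (\<Sum>bs\<in>keys t. cscale (lookup t bs) (tensor_act e (single bs 1)))"
    by (simp add: tensor_act_def)
  also have "\<dots> = (\<Sum>bs\<in>A. cscale (lookup t bs) (tensor_act e (single bs 1)))"
    using assms by (intro sum.mono_neutral_left) (auto simp: in_keys_iff)
  finally show ?thesis .
qed

lemma sym_act_single:
  "sym_act i j (single b 1) = single (b - expo j + expo i) (of_nat (lookup b j))"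
  by (simp add: sym_act_def pdiff_single pvar_def mult_single add.commute)

text \<open>\<open>E i j\<close> acts in one column at a time, which is the Leibniz rule on the
  corresponding tensor factor.\<close>

lemma columns_move:
  assumes "k < n" "i < n" "j < n"
  shows "columns n (m - expo (j, k) + expo (i, k)) = (columns n m)[k := column n m k - expo j + expo i]"
proof (rule nth_equalityI)
  fix k' assume "k' < length (columns n (m - expo (j, k) + expo (i, k)))"
  then have k': "k' < n" by simp
  show "columns n (m - expo (j, k) + expo (i, k)) ! k' = (columns n m)[k := column n m k - expo j + expo i] ! k'"
    using assms k'
    by (cases "k = k'"; intro poly_mapping_eqI)
      (auto simp: lookup_column lookup_add lookup_minus lookup_single when_def)
qed simp

lemma gl_isomorphic_tensor_power:
  "gl_isomorphic n (mat_act n) (col_space n l)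
     (\<lambda>i j. tensor_act (sym_act i j)) (tensor_power n (sym_power n l))"
proof -
  define S where "S = col_monos n l"
  have fin: "finite S" by (simp add: S_def finite_col_monos)
  have bij: "bij_betw (columns n) S (tensor_monos n l)" by (simp add: S_def bij_betw_columns)
  then have inj: "columns n m = columns n m' \<longleftrightarrow> m = m'" if "m \<in> S" "m' \<in> S" for m m'
    using that by (auto simp: bij_betw_def inj_on_def)
  have img: "columns n ` S = tensor_monos n l" using bij by (simp add: bij_betw_def)
  \<comment> \<open>\<phi> sends a monomial to the tensor product of its columns; being a sum over
    \<open>S\<close>, it ignores all other monomials.\<close>
  define \<phi> where "\<phi> p = (\<Sum>m\<in>S. cscale (lookup p m) (single (columns n m) 1))" for p
  have \<phi>_add: "\<phi> (p + q) = \<phi> p + \<phi> q" for p q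
    by (simp add: \<phi>_def lookup_add cvec.scale_left_distrib sum.distrib)
  have \<phi>_cscale: "\<phi> (cscale c p) = cscale c (\<phi> p)" for c p
    by (simp add: \<phi>_def cscale_sum)
  have \<phi>_sum: "\<phi> (\<Sum>x\<in>A. f x) = (\<Sum>x\<in>A. \<phi> (f x))" for A and f :: "(nat \<times> nat \<Rightarrow>\<^sub>0 nat) \<Rightarrow> (nat \<times> nat) cpoly"
    by (induction A rule: infinite_finite_induct) (auto simp: \<phi>_add, auto simp: \<phi>_def)
  have \<phi>_single: "\<phi> (single m c) = single (columns n m) c" if "m \<in> S" for m c
  proof -
    have "\<phi> (single m c) = (\<Sum>m'\<in>S. if m' = m then single (columns n m) c else 0)"
      unfolding \<phi>_def
      by (rule sum.cong) (auto simp: lookup_single when_def simp flip: single_eq_cscale)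
    then show ?thesis using that fin by simp
  qed
  have lookup_\<phi>: "lookup (\<phi> p) (columns n m) = lookup p m" if "m \<in> S" for p m
  proof -
    have "lookup (\<phi> p) (columns n m) = (\<Sum>m'\<in>S. if m' = m then lookup p m else 0)"
      unfolding \<phi>_def lookup_sum
      by (rule sum.cong) (use inj that in \<open>auto simp: lookup_single when_def\<close>)
    then show ?thesis using that fin by simp
  qed
  have keys_\<phi>: "keys (\<phi> p) \<subseteq> tensor_monos n l" for p
  proof
    fix bs assume bs: "bs \<in> keys (\<phi> p)"
    show "bs \<in> tensor_monos n l"
    proof (rule ccontr)
      assume "\<not> ?thesis"
      then have "lookup (\<phi> p) bs = 0"
        unfolding \<phi>_def lookup_sum img[symmetric]
        by (intro sum.neutral) (auto simp: lookup_single when_def)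
      then show False using bs by (simp add: in_keys_iff)
    qed
  qed
  have "bij_betw \<phi> (col_space n l) {t :: (nat \<Rightarrow>\<^sub>0 nat) list \<Rightarrow>\<^sub>0 complex. keys t \<subseteq> tensor_monos n l}"
    unfolding bij_betw_def
  proof
    show "inj_on \<phi> (col_space n l)"
    proof (rule inj_onI, rule poly_mapping_eqI)
      fix p q m assume pq: "p \<in> col_space n l" "q \<in> col_space n l" and eq: "\<phi> p = \<phi> q"
      show "lookup p m = lookup q m"
      proof (cases "m \<in> S")
        case True
        then show ?thesis using lookup_\<phi> eq by metis
      next
        case False
        then have "m \<notin> keys p" "m \<notin> keys q" using pq by (auto simp: col_space_def S_def)
        then show ?thesis by (simp add: in_keys_iff)
      qed
    qed
    show "\<phi> ` col_space n l = {t :: (nat \<Rightarrow>\<^sub>0 nat) list \<Rightarrow>\<^sub>0 complex. keys t \<subseteq> tensor_monos n l}"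
    proof
      show "\<phi> ` col_space n l \<subseteq> {t. keys t \<subseteq> tensor_monos n l}"
        using keys_\<phi> by blast
      show "{t :: (nat \<Rightarrow>\<^sub>0 nat) list \<Rightarrow>\<^sub>0 complex. keys t \<subseteq> tensor_monos n l} \<subseteq> \<phi> ` col_space n l"
      proof safe
        fix t :: "(nat \<Rightarrow>\<^sub>0 nat) list \<Rightarrow>\<^sub>0 complex"
        assume t: "keys t \<subseteq> tensor_monos n l"
        define p where "p = (\<Sum>m\<in>S. single m (lookup t (columns n m)))"
        have p: "lookup p m = (if m \<in> S then lookup t (columns n m) else 0)" for m
        proof -
          have "lookup p m = (\<Sum>m'\<in>S. if m' = m then lookup t (columns n m) else 0)"
            unfolding p_def lookup_sum by (rule sum.cong) (auto simp: lookup_single when_def)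
          then show ?thesis using fin by simp
        qed
        have "\<phi> p = t"
        proof (rule poly_mapping_eqI)
          fix bs
          show "lookup (\<phi> p) bs = lookup t bs"
          proof (cases "bs \<in> tensor_monos n l")
            case True
            then obtain m where "m \<in> S" "bs = columns n m" using img by blast
            then show ?thesis by (simp add: lookup_\<phi> p)
          next
            case False
            then have "bs \<notin> keys (\<phi> p)" "bs \<notin> keys t" using keys_\<phi> t by blast+
            then show ?thesis by (simp add: in_keys_iff)
          qed
        qed
        moreover have "p \<in> col_space n l"
          by (auto simp: col_space_def in_keys_iff p S_def split: if_splits)
        ultimately show "t \<in> \<phi> ` col_space n l" by blast
      qed
    qed
  qed
  moreover have "\<phi> (mat_act n i j p) = tensor_act (sym_act i j) (\<phi> p)"
    if p: "p \<in> col_space n l" and ij: "i < n" "j < n" for i j p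
  proof -
    have single: "\<phi> (mat_act n i j (single m 1)) = tensor_act (sym_act i j) (single (columns n m) 1)"
      if m: "m \<in> S" for m
    proof -
      have "\<phi> (mat_act n i j (single m 1)) =
          (\<Sum>k<n. \<phi> (single (m - expo (j, k) + expo (i, k)) (of_nat (lookup m (j, k)))))"
      proof -
        have "\<phi> (\<Sum>k<n. f k) = (\<Sum>k<n. \<phi> (f k))" for f :: "nat \<Rightarrow> (nat \<times> nat) cpoly"
          by (induction n) (auto simp: \<phi>_add, auto simp: \<phi>_def)
        then show ?thesis by (simp add: mat_act_single)
      qed
      also have "\<dots> = (\<Sum>k<n. single ((columns n m)[k := column n m k - expo j + expo i])
          (of_nat (lookup (column n m k) j)))"
      proof (rule sum.cong)
        fix k assume "k \<in> {..<n}"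
        then have k: "k < n" by simp
        show "\<phi> (single (m - expo (j, k) + expo (i, k)) (of_nat (lookup m (j, k)))) =
            single ((columns n m)[k := column n m k - expo j + expo i]) (of_nat (lookup (column n m k) j))"
        \<comment> \<open>If \<open>x j k\<close> does not occur, the truncated move may leave
          \<open>S\<close>, but the coefficient is 0 on both sides.\<close>
        proof (cases "lookup m (j, k) = 0")
          case True
          then show ?thesis using ij by (simp add: lookup_column) (simp add: \<phi>_def)
        next
          case False
          then have "m - expo (j, k) + expo (i, k) \<in> S"
            using m ij by (auto simp: S_def intro: move_in_col_monos)
          then show ?thesis
            using k ij by (simp add: \<phi>_single columns_move lookup_column)
        qed
      qed simp
      also have "\<dots> = tensor_act (sym_act i j) (single (columns n m) 1)"
        by (simp add: tensor_act_def sym_act_single pure_tensor_update)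
      finally show ?thesis .
    qed
    have "keys p \<subseteq> S" using p by (simp add: col_space_def S_def)
    have "\<phi> (mat_act n i j p) = (\<Sum>m\<in>S. cscale (lookup p m) (tensor_act (sym_act i j) (single (columns n m) 1)))"
      unfolding mat_act_eq_sum[OF fin \<open>keys p \<subseteq> S\<close>] \<phi>_sum
      by (rule sum.cong) (auto simp: \<phi>_cscale single)
    also have "\<dots> = (\<Sum>bs\<in>tensor_monos n l. cscale (lookup (\<phi> p) bs) (tensor_act (sym_act i j) (single bs 1)))"
      by (subst sum.reindex_bij_betw[OF bij, symmetric]) (auto simp: lookup_\<phi> intro!: sum.cong)
    also have "\<dots> = tensor_act (sym_act i j) (\<phi> p)"
      by (rule tensor_act_superset[symmetric, OF _ keys_\<phi>])
        (use fin img in \<open>metis finite_imageI\<close>)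
    finally show ?thesis .
  qed
  ultimately show ?thesis
    unfolding gl_isomorphic_def tensor_power_eq
    by (intro exI[of _ \<phi>]) (auto simp: \<phi>_add \<phi>_cscale)
qed

theorem mainTheorem3:
  fixes n l :: nat
  assumes "n > 0" and "l > 0"
  shows "finite {\<alpha>::complex. \<not>
    ((\<forall>lam. is_partition_of lam (n * l) \<longrightarrow>
        gl_multiplicity n (mat_act n) (gl_cyclic n (mat_act n) (mat_poly n) (alpha_det n \<alpha> ^ l)) lam
          = kostka lam (replicate n l)) \<and>
     gl_isomorphic n
       (mat_act n) (gl_cyclic n (mat_act n) (mat_poly n) (alpha_det n \<alpha> ^ l))
       (\<lambda>i j. tensor_act (sym_act i j)) (tensor_power n (sym_power n l)))}"
proof (rule finite_subset[OF _ finite_nongeneric], rule Collect_mono, rule impI, erule contrapos_nn)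
  fix \<alpha> :: complex
  \<comment> \<open>Both claims depend on \<alpha> only through the cyclic module, so they hold
    wherever it is all of \<open>col_space n l\<close>.\<close>
  assume "gl_cyclic n (mat_act n) (mat_poly n) (alpha_det n \<alpha> ^ l) = col_space n l"
  then show "(\<forall>lam. is_partition_of lam (n * l) \<longrightarrow>
        gl_multiplicity n (mat_act n) (gl_cyclic n (mat_act n) (mat_poly n) (alpha_det n \<alpha> ^ l)) lam
          = kostka lam (replicate n l)) \<and>
     gl_isomorphic n
       (mat_act n) (gl_cyclic n (mat_act n) (mat_poly n) (alpha_det n \<alpha> ^ l))
       (\<lambda>i j. tensor_act (sym_act i j)) (tensor_power n (sym_power n l))"
    by (simp add: gl_multiplicity_col_space gl_isomorphic_tensor_power)
qed

end
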